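(* Consider the sparse Hamiltonian simulation problem: the Hamiltonian $H$ acts on a space of dimension at most $2^n$, has no more than $d$ nonzero entries in each column, and is given through the black-box function $f$ described in the context; the problem is to simulate the evolution $e^{-iHt}$ such that the maximum error in the final state, as quantified by the trace distance, does not exceed $\epsilon$. Let $N_{\rm bb}$ be the number of calls to $f$ required for this simulation, and put $\tau=\|H\|t$. The number of black-box calls for given $k$ (a positive integer) is $$N_{\rm bb}\in O\!\left((\log^* n)\, d^2\, 5^{2k}\,(d^2\tau)^{1+1/2k}/\epsilon^{1/2k}\right),$$ with $\log^* n\equiv\min\{r \mid \log_2^{(r)} n<2\}$, where $\log_2^{(r)}$ denotes the $r$-fold iterated logarithm.
   Context: $\|\cdot\|$ is the operator norm. Trace distance is $D(\rho,\sigma)=\frac12\mathrm{Tr}|\rho-\sigma|$, and the error of a simulation is the maximum over initial states of the trace distance between the simulated final state and the final state under $e^{-iHt}$. Exponents such as $1+1/2k$ mean $1+\frac{1}{2k}$. The integer $k$ is the order of the (Suzuki) product-formula integrator used in the simulation. Black box: if the nonzero elements in column $x$ are in positions $y_1,\dots,y_{d'}$ (in arbitrary order), where $d'\le d$, then $f(x,i)=(y_i,H_{x,y_i})$ for $i\le d'$, and $f(x,i)=(x,0)$ for $i>d'$. It is assumed that there is a corresponding unitary $U_f$ with $U_f|x,i\rangle|0\rangle=|\phi_{x,i}\rangle|y_i,H_{x,y_i}\rangle$, where $|\phi_{x,i}\rangle$ represents any additional states produced in the reversible calculation of $f$, and that calls may be made to both $U_f$ and $U_f^\dagger$.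
   Formalization: The O-bound is proved for d²5^kτ ≥ c, for every fixed c > 0 with a constant depending only on c, and for n ≥ 2; as τ → 0 (e.g. d = k = 1, ε = τ²) the stated bound tends to 0 although a call is needed. *)

theory Defs
  imports
    "Jordan_Normal_Form.Schur_Decomposition"
    "HOL-Library.Extended_Real"
    Complex_Main
begin

section \<open>Matrices, states and distances\<close>

definition hermitian_mat :: "complex mat \<Rightarrow> bool" where
  "hermitian_mat A \<longleftrightarrow> square_mat A \<and> mat_adjoint A = A"

definition unitary_mat :: "nat \<Rightarrow> complex mat \<Rightarrow> bool" where
  "unitary_mat n U \<longleftrightarrow>
     U \<in> carrier_mat n n \<and> mat_adjoint U * U = 1\<^sub>m n \<and> U * mat_adjoint U = 1\<^sub>m n"

text \<open>The order on complex numbers is the one of \<^theory>\<open>HOL-Library.Complex_Order\<close>: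
  \<open>0 \<le> z\<close> says that \<open>z\<close> is real and nonnegative.\<close>

definition positive_mat :: "complex mat \<Rightarrow> bool" where
  "positive_mat A \<longleftrightarrow>
     hermitian_mat A \<and> (\<forall>v \<in> carrier_vec (dim_col A). 0 \<le> (A *\<^sub>v v) \<bullet>c v)"

definition mat_trace :: "complex mat \<Rightarrow> complex" where
  "mat_trace A = (\<Sum>i<dim_row A. A $$ (i, i))"

definition density_mat :: "nat \<Rightarrow> complex mat \<Rightarrow> bool" where
  "density_mat n \<rho> \<longleftrightarrow> \<rho> \<in> carrier_mat n n \<and> positive_mat \<rho> \<and> mat_trace \<rho> = 1"

definition vec_l2 :: "complex vec \<Rightarrow> real" where
  "vec_l2 v = sqrt (\<Sum>i<dim_vec v. (cmod (v $ i))\<^sup>2)"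

definition op_norm :: "complex mat \<Rightarrow> real" where
  "op_norm A = Sup {vec_l2 (A *\<^sub>v v) | v. v \<in> carrier_vec (dim_col A) \<and> vec_l2 v = 1}"

definition mat_exp :: "complex mat \<Rightarrow> complex mat" where
  "mat_exp A = mat (dim_row A) (dim_row A) (\<lambda>(i, j). \<Sum>l. (A ^\<^sub>m l) $$ (i, j) / fact l)"

text \<open>The positive square root of \<open>A\<^sup>\<dagger>A\<close> exists and is unique, so the choice below is not
  a matter of convention.\<close>

definition mat_abs :: "complex mat \<Rightarrow> complex mat" where
  "mat_abs A = (SOME P. positive_mat P \<and> P * P = mat_adjoint A * A)"

definition trace_dist :: "complex mat \<Rightarrow> complex mat \<Rightarrow> real" where
  "trace_dist \<rho> \<sigma> = Re (mat_trace (mat_abs (\<rho> - \<sigma>))) / 2"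

definition evolve :: "complex mat \<Rightarrow> complex mat \<Rightarrow> complex mat" where
  "evolve U \<rho> = U * \<rho> * mat_adjoint U"

definition tensor_vec :: "complex vec \<Rightarrow> complex vec \<Rightarrow> complex vec" (infixr \<open>\<otimes>\<^sub>v\<close> 72) where
  "u \<otimes>\<^sub>v v = vec (dim_vec u * dim_vec v)
     (\<lambda>l. u $ (l div dim_vec v) * v $ (l mod dim_vec v))"

definition tensor_mat :: "complex mat \<Rightarrow> complex mat \<Rightarrow> complex mat" (infixr \<open>\<otimes>\<^sub>m\<close> 72) where
  "A \<otimes>\<^sub>m B = mat (dim_row A * dim_row B) (dim_col A * dim_col B)
     (\<lambda>(i, j). A $$ (i div dim_row B, j div dim_col B) * B $$ (i mod dim_row B, j mod dim_col B))"

text \<open>Partial trace over the first factor of a space of dimension \<open>e * D\<close>.\<close>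

definition trace_out :: "nat \<Rightarrow> nat \<Rightarrow> complex mat \<Rightarrow> complex mat" where
  "trace_out e D M = mat D D (\<lambda>(i, j). \<Sum>l<e. M $$ (l * D + i, l * D + j))"

definition zero_state :: "nat \<Rightarrow> complex mat" where
  "zero_state e = mat e e (\<lambda>(i, j). if i = 0 \<and> j = 0 then 1 else 0)"


section \<open>The black box\<close>

definition sparse_mat :: "nat \<Rightarrow> complex mat \<Rightarrow> bool" where
  "sparse_mat d H \<longleftrightarrow>
     (\<forall>x<dim_col H. card {y. y < dim_row H \<and> H $$ (y, x) \<noteq> 0} \<le> d)"

text \<open>Rows, columns and the index \<open>i\<close> are counted from 0; \<open>ys\<close> lists the positions of the
  nonzero elements of column \<open>x\<close>, in arbitrary order.\<close>

definition black_box :: "nat \<Rightarrow> complex mat \<Rightarrow> (nat \<Rightarrow> nat \<Rightarrow> nat \<times> complex) \<Rightarrow> bool" where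
  "black_box d H f \<longleftrightarrow>
     (\<forall>x<dim_col H. \<exists>ys. distinct ys \<and> set ys = {y. y < dim_row H \<and> H $$ (y, x) \<noteq> 0}
        \<and> length ys \<le> d
        \<and> (\<forall>i<d. f x i = (if i < length ys then (ys ! i, H $$ (x, ys ! i)) else (x, 0))))"

text \<open>Registers of one query, for a system of dimension \<open>D\<close>: the inputs \<open>x < D\<close> and \<open>i < d\<close>, a
  scratch register of dimension \<open>g\<close> used by the reversible calculation of \<open>f\<close>, and the outputs
  \<open>y < D\<close> and a matrix element. The matrix-element register holds the values listed in \<open>vals\<close>;
  its basis state \<open>v\<close> stands for \<open>vals ! v\<close>.\<close>

definition query_dim :: "nat \<Rightarrow> nat \<Rightarrow> complex list \<Rightarrow> nat \<Rightarrow> nat" where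
  "query_dim D d vals g = (D * d * g) * (D * length vals)"

text \<open>\<open>U\<^sub>f |x,i\<rangle>|0\<rangle> = |\<phi>\<^sub>x\<^sub>,\<^sub>i\<rangle>|y,H\<^sub>x\<^sub>,\<^sub>y\<rangle>\<close>, where the scratch register also starts in \<open>|0\<rangle>\<close>. The states
  \<open>|\<phi>\<^sub>x\<^sub>,\<^sub>i\<rangle>\<close> and the action on all other inputs are unconstrained.\<close>

definition oracle_unitary ::
  "nat \<Rightarrow> nat \<Rightarrow> complex list \<Rightarrow> nat \<Rightarrow> (nat \<Rightarrow> nat \<Rightarrow> nat \<times> complex) \<Rightarrow> complex mat \<Rightarrow> bool" where
  "oracle_unitary D d vals g f U \<longleftrightarrow>
     unitary_mat (query_dim D d vals g) U \<and>
     (\<forall>x<D. \<forall>i<d. \<exists>\<phi> \<in> carrier_vec (D * d * g). \<exists>v<length vals.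
        vals ! v = snd (f x i) \<and>
        U *\<^sub>v ((unit_vec D x \<otimes>\<^sub>v unit_vec d i \<otimes>\<^sub>v unit_vec g 0)
               \<otimes>\<^sub>v (unit_vec D 0 \<otimes>\<^sub>v unit_vec (length vals) 0))
          = \<phi> \<otimes>\<^sub>v (unit_vec D (fst (f x i)) \<otimes>\<^sub>v unit_vec (length vals) v))"


section \<open>Simulation algorithms\<close>

datatype call = Call_U | Call_U_dagger

fun call_mat :: "complex mat \<Rightarrow> call \<Rightarrow> complex mat" where
  "call_mat U Call_U = U"
| "call_mat U Call_U_dagger = mat_adjoint U"

text \<open>An algorithm applies the gate \<open>W\<^sub>0\<close> and then, for each step \<open>(c, W)\<close> in order, one call \<open>c\<close>
  followed by the gate \<open>W\<close>. The calls act on the first tensor factor (the query registers), the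
  gates on the whole space; \<open>r\<close> is the dimension of the remaining factors.\<close>

fun run :: "nat \<Rightarrow> complex mat \<Rightarrow> complex mat \<Rightarrow> (call \<times> complex mat) list \<Rightarrow> complex mat" where
  "run r U W\<^sub>0 [] = W\<^sub>0"
| "run r U W\<^sub>0 ((c, W) # steps) = run r U (W * (call_mat U c \<otimes>\<^sub>m 1\<^sub>m r) * W\<^sub>0) steps"

text \<open>The whole space is (query registers) \<open>\<otimes>\<close> (workspace of dimension \<open>a\<close>) \<open>\<otimes>\<close> (simulated system);
  all factors but the last start in \<open>|0\<rangle>\<close> and are discarded at the end.\<close>

definition simulated_state ::
  "nat \<Rightarrow> nat \<Rightarrow> nat \<Rightarrow> complex mat \<Rightarrow> complex mat \<Rightarrow> (call \<times> complex mat) list \<Rightarrow> complex mat \<Rightarrow> complex mat"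
where
  "simulated_state q a D U W\<^sub>0 steps \<rho> =
     trace_out (q * a) D (evolve (run (a * D) U W\<^sub>0 steps) (zero_state (q * a) \<otimes>\<^sub>m \<rho>))"

text \<open>The algorithm \<open>(a, W\<^sub>0, steps)\<close> may depend on the problem parameters, but the Hamiltonian
  \<open>H\<close> is available to it only through the calls.\<close>

definition simulates ::
  "nat \<Rightarrow> nat \<Rightarrow> complex list \<Rightarrow> nat \<Rightarrow> real \<Rightarrow> real \<Rightarrow> real \<Rightarrow>
   nat \<Rightarrow> complex mat \<Rightarrow> (call \<times> complex mat) list \<Rightarrow> bool"
where
  "simulates D d vals g t \<tau> \<epsilon> a W\<^sub>0 steps \<longleftrightarrow>
     0 < a \<and> unitary_mat (query_dim D d vals g * a * D) W\<^sub>0 \<and>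
     (\<forall>(c, W) \<in> set steps. unitary_mat (query_dim D d vals g * a * D) W) \<and>
     (\<forall>H f U. H \<in> carrier_mat D D \<and> hermitian_mat H \<and> sparse_mat d H
        \<and> elements_mat H \<subseteq> set vals \<and> op_norm H * t = \<tau>
        \<and> black_box d H f \<and> oracle_unitary D d vals g f U \<longrightarrow>
        (\<forall>\<rho>. density_mat D \<rho> \<longrightarrow>
           trace_dist (simulated_state (query_dim D d vals g) a D U W\<^sub>0 steps \<rho>)
             (evolve (mat_exp ((- \<i> * complex_of_real t) \<cdot>\<^sub>m H)) \<rho>) \<le> \<epsilon>))"

text \<open>The number of calls required; infinite if the simulation were impossible.\<close>

definition N_bb ::
  "nat \<Rightarrow> nat \<Rightarrow> complex list \<Rightarrow> nat \<Rightarrow> real \<Rightarrow> real \<Rightarrow> real \<Rightarrow> enat" where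
  "N_bb D d vals g t \<tau> \<epsilon> =
     Inf {enat (length steps) | a W\<^sub>0 steps. simulates D d vals g t \<tau> \<epsilon> a W\<^sub>0 steps}"

definition log_star :: "nat \<Rightarrow> nat" where
  "log_star n = (LEAST r. (log 2 ^^ r) (real n) < 2)"

end

theory Submission
  imports Defs "HOL-Analysis.L2_Norm" "Jordan_Normal_Form.Spectral_Radius"
begin

text \<open>A truncated Taylor series of the evolution with oblivious amplitude amplification meets the
  bound; no product formula is needed. The \<open>d\<close> queries on row \<open>x\<close> of \<open>H\<close> load its nonzero elements,
  which permits every unitary that is block diagonal in \<open>x\<close> with blocks depending on row \<open>x\<close>. Two such
  state preparations, one carrying the nonzero pattern and the other one the values of the row, give
  a unitary with upper left block \<open>H / (\<surd>d \<parallel>H\<parallel>)\<close>. Products of this unitary and its adjoint with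
  reflections in between have the Chebyshev polynomials of that block as upper left blocks, so a linear
  combination of them implements half of the Taylor polynomial of degree \<open>K\<close> of \<open>exp (- \<i> s x)\<close>, with
  \<open>s \<le> 1 / 2\<close>, and one round of amplitude amplification removes the factor \<open>1/2\<close> up to an error of order
  \<open>2\<^sup>-\<^sup>K\<close>. With \<open>r\<close> about \<open>2 d\<^sup>2 \<tau>\<close> segments and \<open>K\<close> about \<open>log (r / \<epsilon>)\<close> this takes \<open>24 d r K\<close> calls, and
  \<open>log (r / \<epsilon>)\<close> is at most a multiple of \<open>k (r / \<epsilon>)\<close> to the power \<open>1 / (2 k)\<close>.\<close>


section \<open>Matrices over the complex numbers\<close>

text \<open>The algorithm has to be fixed before the Hamiltonian is known, and a call leaves garbage
  states that depend on its input and are otherwise unconstrained. Each answer is therefore copied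
  and its call undone by the adjoint, so that every row-dependent operation returns the query
  registers to zero and composes freely with others. The factor 1 / (sqrt d * norm) comes from
  splitting the amplitudes unevenly: a pattern of at most \<open>d\<close> positions has norm at
  most sqrt d, and a row of a hermitian matrix has norm at most the operator norm. The bound s \<le>
  1 / 2 keeps the sum of the absolute Chebyshev coefficients at most 2, whatever the degree. Padding
  makes the attenuation exactly 1/2, the case sin(pi/6) in which a single round of amplification
  reaches sin(pi/2) = 1. The exponent 1 / (2 k) enters only in the final count: with y = (r /
  \<epsilon>)^(1 / (2 k)) the logarithm of r / \<epsilon> is 2 k log y, log y is at most a multiple
  of y, and the powers of 5 absorb the factor k.\<close>

lemma mult_sq_carrier [simp]:
  "A \<in> carrier_mat n n \<Longrightarrow> B \<in> carrier_mat n n \<Longrightarrow> A * B \<in> carrier_mat n n"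
  by (rule mult_carrier_mat)

lemma mult_sq_vec_carrier [simp]:
  "A \<in> carrier_mat n n \<Longrightarrow> v \<in> carrier_vec n \<Longrightarrow> A *\<^sub>v v \<in> carrier_vec n"
  by (rule mult_mat_vec_carrier)

lemma mult_mat_index_sum:
  assumes "A \<in> carrier_mat m k" "B \<in> carrier_mat k n" "i < m" "j < n"
  shows "(A * B) $$ (i, j) = (\<Sum>l<k. A $$ (i, l) * B $$ (l, j))"
  using assms by (simp add: scalar_prod_def atLeast0LessThan)

lemma mult_mat_vec_index_sum:
  assumes "A \<in> carrier_mat m k" "v \<in> carrier_vec k" "i < m"
  shows "(A *\<^sub>v v) $ i = (\<Sum>l<k. A $$ (i, l) * v $ l)"
  using assms by (simp add: scalar_prod_def atLeast0LessThan)

lemma mat_adjoint_dim [simp]: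
  "dim_row (mat_adjoint A) = dim_col A" "dim_col (mat_adjoint A) = dim_row A"
  by (auto simp: mat_adjoint_def)

lemma mat_adjoint_carrier [simp]:
  "A \<in> carrier_mat m n \<Longrightarrow> mat_adjoint A \<in> carrier_mat n m"
  by auto

lemma mat_adjoint_index [simp]:
  "i < dim_col A \<Longrightarrow> j < dim_row A \<Longrightarrow> mat_adjoint (A :: complex mat) $$ (i, j) = cnj (A $$ (j, i))"
  by (auto simp: mat_adjoint_def mat_of_rows_index)

lemma mat_adjoint_adjoint [simp]: "mat_adjoint (mat_adjoint A) = (A :: complex mat)"
  by (rule eq_matI) auto

lemma mat_adjoint_one [simp]: "mat_adjoint (1\<^sub>m n) = (1\<^sub>m n :: complex mat)"
  by (rule eq_matI) auto

lemma mat_adjoint_mult: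
  fixes A B :: "complex mat"
  assumes "A \<in> carrier_mat l m" "B \<in> carrier_mat m n"
  shows "mat_adjoint (A * B) = mat_adjoint B * mat_adjoint A"
  using assms by (intro eq_matI) (auto simp: scalar_prod_def mult.commute)

lemma mat_adjoint_smult: "mat_adjoint (c \<cdot>\<^sub>m A) = cnj c \<cdot>\<^sub>m mat_adjoint (A :: complex mat)"
  by (intro eq_matI) auto

lemma cscalar_prod_adjoint:
  fixes A :: "complex mat"
  assumes A: "A \<in> carrier_mat m n" and v: "v \<in> carrier_vec n" and w: "w \<in> carrier_vec m"
  shows "(A *\<^sub>v v) \<bullet>c w = v \<bullet>c (mat_adjoint A *\<^sub>v w)"
proof -
  have "(A *\<^sub>v v) \<bullet>c w = (\<Sum>i<m. \<Sum>j<n. A $$ (i, j) * v $ j * cnj (w $ i))"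
    using assms by (simp add: scalar_prod_def sum_distrib_right atLeast0LessThan)
  also have "\<dots> = (\<Sum>j<n. \<Sum>i<m. A $$ (i, j) * v $ j * cnj (w $ i))"
    by (rule sum.swap)
  also have "\<dots> = v \<bullet>c (mat_adjoint A *\<^sub>v w)"
    using assms by (auto simp: scalar_prod_def sum_distrib_left atLeast0LessThan mult_ac
        intro!: sum.cong)
  finally show ?thesis .
qed

lemma vec_l2_L2_set: "vec_l2 v = L2_set (\<lambda>i. cmod (v $ i)) {..<dim_vec v}"
  by (simp add: vec_l2_def L2_set_def)

lemma vec_l2_nonneg [simp]: "0 \<le> vec_l2 v"
  by (simp add: vec_l2_def sum_nonneg)

lemma vec_l2_square: "(vec_l2 v)\<^sup>2 = (\<Sum>i<dim_vec v. (cmod (v $ i))\<^sup>2)"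
  by (simp add: vec_l2_def sum_nonneg)

lemma cscalar_prod_self: "v \<bullet>c v = complex_of_real ((vec_l2 v)\<^sup>2)"
  unfolding vec_l2_square scalar_prod_def of_real_sum complex_norm_square
  by (auto simp: atLeast0LessThan intro!: sum.cong)

lemma vec_l2_triangle:
  assumes "v \<in> carrier_vec n" "w \<in> carrier_vec n"
  shows "vec_l2 (v + w) \<le> vec_l2 v + vec_l2 w"
proof -
  have "L2_set (\<lambda>i. cmod ((v + w) $ i)) {..<n} \<le> L2_set (\<lambda>i. cmod (v $ i) + cmod (w $ i)) {..<n}"
    using assms by (intro L2_set_mono) (auto intro: norm_triangle_ineq)
  also have "\<dots> \<le> L2_set (\<lambda>i. cmod (v $ i)) {..<n} + L2_set (\<lambda>i. cmod (w $ i)) {..<n}"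
    by (rule L2_set_triangle_ineq)
  finally show ?thesis using assms by (simp add: vec_l2_L2_set)
qed

lemma vec_l2_smult: "vec_l2 (c \<cdot>\<^sub>v v) = cmod c * vec_l2 v"
  by (simp add: vec_l2_def norm_mult power_mult_distrib real_sqrt_mult
      flip: sum_distrib_left)

lemma vec_l2_uminus: "vec_l2 (- v) = vec_l2 v"
  by (simp add: vec_l2_def)

lemma vec_l2_triangle_minus:
  assumes "u \<in> carrier_vec n" "v \<in> carrier_vec n" "w \<in> carrier_vec n"
  shows "vec_l2 (u - w) \<le> vec_l2 (u - v) + vec_l2 (v - w)"
proof -
  have "u - w = (u - v) + (v - w)" using assms by auto
  thus ?thesis using vec_l2_triangle[of "u - v" n "v - w"] assms by simp
qed

lemma vec_l2_zero [simp]: "vec_l2 (0\<^sub>v n) = 0"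
  by (simp add: vec_l2_def)

lemma vec_l2_eq_0: "v \<in> carrier_vec n \<Longrightarrow> vec_l2 v = 0 \<longleftrightarrow> v = 0\<^sub>v n"
  by (auto simp: vec_l2_def sum_nonneg_eq_0_iff intro!: eq_vecI)

lemma vec_l2_unit_vec [simp]: "i < n \<Longrightarrow> vec_l2 (unit_vec n i) = 1"
proof -
  assume i: "i < n"
  have "(\<Sum>j<n. (cmod (unit_vec n i $ j))\<^sup>2) = (\<Sum>j<n. if j = i then 1 else 0)"
    using i by (intro sum.cong) (auto simp: unit_vec_def)
  thus ?thesis using i by (simp add: vec_l2_def)
qed

lemma cmod_cscalar_prod_le:
  assumes "v \<in> carrier_vec n" "w \<in> carrier_vec n"
  shows "cmod (v \<bullet>c w) \<le> vec_l2 v * vec_l2 w"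
proof -
  have "cmod (v \<bullet>c w) \<le> (\<Sum>i<n. \<bar>cmod (v $ i)\<bar> * \<bar>cmod (w $ i)\<bar>)"
    using assms by (auto simp: scalar_prod_def atLeast0LessThan norm_mult intro!: sum_norm_le)
  also have "\<dots> \<le> vec_l2 v * vec_l2 w"
    using L2_set_mult_ineq[of "\<lambda>i. cmod (v $ i)" "\<lambda>i. cmod (w $ i)" "{..<n}"] assms
    by (simp add: vec_l2_L2_set)
  finally show ?thesis .
qed

lemma unitary_matD:
  assumes "unitary_mat n U"
  shows "U \<in> carrier_mat n n" "mat_adjoint U * U = 1\<^sub>m n" "U * mat_adjoint U = 1\<^sub>m n"
  using assms by (auto simp: unitary_mat_def)

lemma unitary_mat_one [simp]: "unitary_mat n (1\<^sub>m n)"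
  by (simp add: unitary_mat_def)

lemma unitary_mat_adjoint: "unitary_mat n U \<Longrightarrow> unitary_mat n (mat_adjoint U)"
  by (auto simp: unitary_mat_def)

lemma mult_cancel_middle:
  fixes A B C D :: "complex mat"
  assumes "A \<in> carrier_mat n n" "B \<in> carrier_mat n n" "C \<in> carrier_mat n n" "D \<in> carrier_mat n n"
    and "B * C = 1\<^sub>m n" 
  shows "(A * B) * (C * D) = A * D"
proof -
  have "(A * B) * (C * D) = A * (B * (C * D))"
    using assms by (simp add: assoc_mult_mat[of A n n B n "C * D" n])
  also have "B * (C * D) = (B * C) * D"
    using assms(2-4) by (rule assoc_mult_mat[symmetric])
  finally show ?thesis using assms by simp
qed

lemma unitary_mat_mult:
  assumes U: "unitary_mat n U" and V: "unitary_mat n V"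
  shows "unitary_mat n (U * V)"
  using unitary_matD[OF U] unitary_matD[OF V]
  by (simp add: unitary_mat_def mat_adjoint_mult[of _ n n _ n] mult_cancel_middle[of _ n])

text \<open>In finite dimension a left inverse is two-sided, so one of the two equations of
  unitarity has to be checked.\<close>

lemma unitary_matI:
  assumes U: "U \<in> carrier_mat n n" and "mat_adjoint U * U = 1\<^sub>m n"
  shows "unitary_mat n U"
  using assms mat_mult_left_right_inverse[of "mat_adjoint U" n U]
  by (auto simp: unitary_mat_def)

lemma unitary_mat_preserves_cscalar_prod:
  assumes U: "unitary_mat n U" and v: "v \<in> carrier_vec n" and w: "w \<in> carrier_vec n"
  shows "(U *\<^sub>v v) \<bullet>c (U *\<^sub>v w) = v \<bullet>c w"
proof -
  note D = unitary_matD[OF U]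
  have "(U *\<^sub>v v) \<bullet>c (U *\<^sub>v w) = v \<bullet>c (mat_adjoint U *\<^sub>v (U *\<^sub>v w))"
    using D v w by (intro cscalar_prod_adjoint) auto
  also have "mat_adjoint U *\<^sub>v (U *\<^sub>v w) = (mat_adjoint U * U) *\<^sub>v w"
    using D w by (subst assoc_mult_mat_vec[of _ n n _ n]) auto
  finally show ?thesis using D w by simp
qed

lemma unitary_mat_preserves_vec_l2:
  assumes U: "unitary_mat n U" and v: "v \<in> carrier_vec n"
  shows "vec_l2 (U *\<^sub>v v) = vec_l2 v"
proof -
  have "complex_of_real ((vec_l2 (U *\<^sub>v v))\<^sup>2) = complex_of_real ((vec_l2 v)\<^sup>2)"
    using unitary_mat_preserves_cscalar_prod[OF U v v] by (simp only: cscalar_prod_self)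
  thus ?thesis by (simp only: of_real_eq_iff) (simp add: power2_eq_iff_nonneg)
qed

text \<open>The Householder reflection along \<open>c u - e\<^sub>0\<close>, where the phase \<open>c\<close> makes the first entry
  of \<open>c u\<close> real, exchanges \<open>e\<^sub>0\<close> and \<open>c u\<close>.\<close>

lemma unitary_completion:
  assumes u: "u \<in> carrier_vec n" and u1: "vec_l2 u = 1"
  obtains V where "unitary_mat n V" "\<And>i. i < n \<Longrightarrow> V $$ (i, 0) = u $ i"
proof -
  have n: "0 < n"
  proof (rule ccontr)
    assume "\<not> 0 < n"
    hence "dim_vec u = 0" using u by auto
    thus False using u1 by (simp add: vec_l2_def)
  qed
  define c where "c = (if u $ 0 = 0 then 1 else cnj (u $ 0) / cmod (u $ 0))"
  have cc: "cmod c = 1" by (auto simp: c_def norm_divide)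
  have ccn: "c * cnj c = 1" using cc by (simp add: complex_norm_square[symmetric])
  define v where "v = c \<cdot>\<^sub>v u"
  define a where "a = cmod (u $ 0)"
  have v: "v \<in> carrier_vec n" using u by (simp add: v_def)
  have v0: "v $ 0 = complex_of_real a"
    using n u by (auto simp: v_def c_def a_def complex_norm_square[symmetric] field_simps power2_eq_square)
  have vn: "(\<Sum>i<n. v $ i * cnj (v $ i)) = 1"
  proof -
    have "vec_l2 v = 1" using u1 cc by (simp add: v_def vec_l2_smult)
    hence "v \<bullet>c v = 1" by (simp add: cscalar_prod_self)
    thus ?thesis using v by (simp add: scalar_prod_def atLeast0LessThan)
  qed
  define w where "w = (\<lambda>i. v $ i - (if i = 0 then 1 else 0))"
  have split: "(\<Sum>i<n. f i) = f 0 + (\<Sum>i\<in>{1..<n}. f i)" for f :: "nat \<Rightarrow> complex"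
    using n by (simp add: lessThan_atLeast0 sum.atLeast_Suc_lessThan)
  have wn: "(\<Sum>i<n. w i * cnj (w i)) = complex_of_real (2 - 2 * a)"
  proof -
    have "(\<Sum>i<n. w i * cnj (w i)) = (a - 1)\<^sup>2 + (\<Sum>i\<in>{1..<n}. v $ i * cnj (v $ i))"
      unfolding split by (auto simp: w_def v0 power2_eq_square intro!: sum.cong)
    moreover have "(\<Sum>i\<in>{1..<n}. v $ i * cnj (v $ i)) = 1 - a\<^sup>2"
      using vn unfolding split by (simp add: v0 power2_eq_square algebra_simps)
    ultimately show ?thesis by (simp add: power2_eq_square algebra_simps)
  qed
  \<comment> \<open>The reflection subtracts \<open>b\<close> times the matrix with entries
    \<open>w i * cnj (w j)\<close> from the identity, which requires \<open>b\<close> = 2 / |w|^2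
    with |w|^2 = 2 - 2 a. If \<open>a\<close> = 1 then \<open>w\<close> vanishes, and
    \<open>b\<close> = 0 gives the identity.\<close>
  define b where "b = (if a = 1 then 0 else 1 / (1 - a))"
  have wz: "w i = 0" if "a = 1" "i < n" for i
  proof -
    have "(\<Sum>i<n. w i * cnj (w i)) = complex_of_real (\<Sum>i<n. (cmod (w i))\<^sup>2)"
      by (simp only: of_real_sum complex_norm_square)
    hence "complex_of_real (\<Sum>i<n. (cmod (w i))\<^sup>2) = 0" using wn that by simp
    hence "(\<Sum>i<n. (cmod (w i))\<^sup>2) = 0" by (simp only: of_real_eq_0_iff)
    thus ?thesis using that by (simp add: sum_nonneg_eq_0_iff)
  qed
  \<comment> \<open>The factor \<open>cnj c\<close> takes the phase back: the reflection sends the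
    first basis vector to \<open>v\<close> = c u.\<close>
  define V where "V = mat n n (\<lambda>(i, j). cnj c * ((if i = j then 1 else 0) - b * w i * cnj (w j)))"
  have Vc: "V \<in> carrier_mat n n" by (simp add: V_def)
  have "mat_adjoint V * V = 1\<^sub>m n"
  proof (rule eq_matI)
    fix i j assume "i < dim_row (1\<^sub>m n :: complex mat)" "j < dim_col (1\<^sub>m n :: complex mat)"
    hence ij: "i < n" "j < n" by auto
    let ?d = "\<lambda>i j. if i = j then 1 else (0 :: complex)"
    have "(mat_adjoint V * V) $$ (i, j) = (\<Sum>l<n. cnj (V $$ (l, i)) * V $$ (l, j))"
      using ij Vc by (simp add: scalar_prod_def atLeast0LessThan)
    also have "\<dots> = (\<Sum>l<n. c * cnj c * ((if l = i then ?d i j else 0)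
        - (if l = j then b * cnj (w j) * w i else 0) - (if l = i then b * w i * cnj (w j) else 0)
        + b * b * w i * cnj (w j) * (w l * cnj (w l))))"
      using ij by (intro sum.cong) (auto simp: V_def algebra_simps)
    also have "\<dots> = ?d i j - 2 * b * w i * cnj (w j) + b * b * w i * cnj (w j) * (\<Sum>l<n. w l * cnj (w l))"
      using ij by (simp add: ccn sum.distrib sum_subtractf sum_distrib_left)
    also have "\<dots> = ?d i j"
    proof (cases "a = 1")
      case False
      have "b * (1 - a) = 1" using False by (simp add: b_def)
      hence "complex_of_real (b * (1 - a)) = 1" by simp
      hence ba: "complex_of_real b * (1 - complex_of_real a) = 1" by simp
      have "b * b * w i * cnj (w j) * complex_of_real (2 - 2 * a)
        = 2 * b * w i * cnj (w j) * (b * (1 - complex_of_real a))"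
        by (simp add: algebra_simps)
      thus ?thesis unfolding wn ba by simp
    qed (simp add: b_def)
    finally show "(mat_adjoint V * V) $$ (i, j) = 1\<^sub>m n $$ (i, j)" using ij by simp
  qed (use Vc in auto)
  hence "unitary_mat n V" using Vc by (rule unitary_matI[rotated])
  moreover have "V $$ (i, 0) = u $ i" if i: "i < n" for i
  proof -
    have "(if i = 0 then 1 else 0) - b * w i * cnj (w 0) = v $ i"
    proof (cases "a = 1")
      case True
      thus ?thesis using wz[OF True i] by (auto simp: w_def)
    next
      case False
      have "b * (1 - a) = 1" using False by (simp add: b_def)
      hence "complex_of_real (b * (1 - a)) = 1" by simp
      hence "b * cnj (w 0) = - 1" by (simp add: w_def v0 algebra_simps)
      hence "b * w i * cnj (w 0) = - w i" by (metis mult.assoc mult.commute mult_minus_left mult_1)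
      thus ?thesis by (simp add: w_def)
    qed
    moreover have "cnj c * v $ i = u $ i" using i u ccn by (simp add: v_def mult.commute mult.left_commute)
    ultimately show ?thesis using i n by (simp add: V_def)
  qed
  ultimately show ?thesis by (rule that)
qed


section \<open>Spectral calculus of hermitian matrices\<close>

definition diag_of :: "nat \<Rightarrow> (nat \<Rightarrow> complex) \<Rightarrow> complex mat" where
  "diag_of n f = mat n n (\<lambda>(i, j). if i = j then f i else 0)"

lemma diag_of_carrier [simp]: "diag_of n f \<in> carrier_mat n n"
  by (simp add: diag_of_def)

lemma diag_of_dim [simp]: "dim_row (diag_of n f) = n" "dim_col (diag_of n f) = n"
  by (simp_all add: diag_of_def)

text \<open>For unitary \<open>V\<close>, the matrix with eigenbasis \<open>V\<close> and
  eigenvalues \<open>f\<close>. With \<open>V\<close> fixed, products, adjoints, powers and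
  exponentials act pointwise on \<open>f\<close>, so polynomials in the Hamiltonian are handled
  eigenvalue by eigenvalue.\<close>

definition spec_mat :: "nat \<Rightarrow> complex mat \<Rightarrow> (nat \<Rightarrow> complex) \<Rightarrow> complex mat" where
  "spec_mat n V f = V * diag_of n f * mat_adjoint V"

lemma spec_mat_carrier [simp]: "V \<in> carrier_mat n n \<Longrightarrow> spec_mat n V f \<in> carrier_mat n n"
  by (auto simp: spec_mat_def)

lemma spec_mat_dim [simp]:
  "dim_row (spec_mat n V f) = dim_row V" "dim_col (spec_mat n V f) = dim_row V"
  by (auto simp: spec_mat_def)

lemma spec_mat_cong:
  assumes "\<And>i. i < n \<Longrightarrow> f i = g i"
  shows "spec_mat n V f = spec_mat n V g"
proof -
  have "diag_of n f = diag_of n g" using assms by (auto simp: diag_of_def intro!: eq_matI)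
  thus ?thesis by (simp add: spec_mat_def)
qed

lemma spec_mat_index:
  assumes V: "V \<in> carrier_mat n n" and ij: "i < n" "j < n"
  shows "spec_mat n V f $$ (i, j) = (\<Sum>l<n. V $$ (i, l) * f l * cnj (V $$ (j, l)))"
proof -
  have "(V * diag_of n f) $$ (i, l) = V $$ (i, l) * f l" if "l < n" for l
    using V ij that by (simp add: scalar_prod_def diag_of_def if_distrib cong: if_cong)
  moreover have "spec_mat n V f $$ (i, j) = (\<Sum>l<n. (V * diag_of n f) $$ (i, l) * mat_adjoint V $$ (l, j))"
    unfolding spec_mat_def using V ij by (intro mult_mat_index_sum[of _ n]) auto
  ultimately show ?thesis using V ij by (simp del: index_mult_mat)
qed

lemma cnj_cols_orthonormal:
  assumes V: "unitary_mat n V" and ij: "i < n" "j < n"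
  shows "(\<Sum>l<n. cnj (V $$ (l, i)) * V $$ (l, j)) = (if i = j then 1 else 0)"
proof -
  have "(mat_adjoint V * V) $$ (i, j) = (\<Sum>l<n. cnj (V $$ (l, i)) * V $$ (l, j))"
    using unitary_matD(1)[OF V] ij by (simp add: scalar_prod_def atLeast0LessThan)
  thus ?thesis using unitary_matD(2)[OF V] ij by simp
qed

lemma spec_mat_mult:
  assumes V: "unitary_mat n V"
  shows "spec_mat n V f * spec_mat n V g = spec_mat n V (\<lambda>i. f i * g i)"
proof -
  note D = unitary_matD[OF V]
  have dd: "diag_of n f * diag_of n g = diag_of n (\<lambda>i. f i * g i)"
    by (rule eq_matI) (auto simp: diag_of_def scalar_prod_def if_distrib cong: if_cong)
  have "spec_mat n V f * spec_mat n V g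
      = (V * diag_of n f) * mat_adjoint V * (V * (diag_of n g * mat_adjoint V))"
    using D by (simp add: spec_mat_def assoc_mult_mat[of V n n "diag_of n g" n "mat_adjoint V" n])
  also have "\<dots> = (V * diag_of n f) * (diag_of n g * mat_adjoint V)"
    using D by (intro mult_cancel_middle[of _ n]) auto
  also have "\<dots> = V * (diag_of n f * diag_of n g) * mat_adjoint V"
    using D by (simp add: assoc_mult_mat[of _ n n _ n _ n])
  finally show ?thesis unfolding dd spec_mat_def .
qed

lemma spec_mat_smult:
  assumes V: "V \<in> carrier_mat n n"
  shows "c \<cdot>\<^sub>m spec_mat n V f = spec_mat n V (\<lambda>i. c * f i)"
  using V
  by (intro eq_matI) (auto simp: spec_mat_index sum_distrib_left mult_ac)

lemma spec_mat_minus: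
  assumes V: "V \<in> carrier_mat n n"
  shows "spec_mat n V f - spec_mat n V g = spec_mat n V (\<lambda>i. f i - g i)"
  using V
  by (intro eq_matI) (auto simp: spec_mat_index left_diff_distrib right_diff_distrib sum_subtractf)

lemma spec_mat_adjoint:
  assumes V: "V \<in> carrier_mat n n"
  shows "mat_adjoint (spec_mat n V f) = spec_mat n V (\<lambda>i. cnj (f i))"
  using V
  by (intro eq_matI) (auto simp: spec_mat_index mult_ac)

lemma spec_mat_one:
  assumes V: "unitary_mat n V"
  shows "spec_mat n V (\<lambda>_. 1) = 1\<^sub>m n"
proof -
  have "diag_of n (\<lambda>_. 1) = 1\<^sub>m n" by (rule eq_matI) (auto simp: diag_of_def)
  thus ?thesis using unitary_matD[OF V] by (simp add: spec_mat_def)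
qed

lemma spec_mat_power:
  assumes V: "unitary_mat n V"
  shows "spec_mat n V f ^\<^sub>m l = spec_mat n V (\<lambda>i. f i ^ l)"
proof (induction l)
  case 0
  thus ?case using unitary_matD[OF V] spec_mat_one[OF V] by auto
next
  case (Suc l)
  thus ?case by (simp add: spec_mat_mult[OF V] mult.commute)
qed

text \<open>In the coordinates of the eigenbasis the matrix multiplies entry \<open>i\<close> by
  \<open>f i\<close>, and \<open>V\<close> preserves the norm.\<close>

lemma vec_l2_spec_mat_le:
  assumes V: "unitary_mat n V" and v: "v \<in> carrier_vec n" and f: "\<And>i. i < n \<Longrightarrow> cmod (f i) \<le> c"
    and c: "0 \<le> c"
  shows "vec_l2 (spec_mat n V f *\<^sub>v v) \<le> c * vec_l2 v"
proof -
  note D = unitary_matD[OF V]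
  let ?w = "mat_adjoint V *\<^sub>v v"
  have w: "?w \<in> carrier_vec n" using D v by simp
  have dw: "diag_of n f *\<^sub>v ?w = vec n (\<lambda>i. f i * ?w $ i)"
  proof (rule eq_vecI)
    fix i assume "i < dim_vec (vec n (\<lambda>i. f i * ?w $ i))"
    thus "(diag_of n f *\<^sub>v ?w) $ i = vec n (\<lambda>i. f i * ?w $ i) $ i"
      using mult_mat_vec_index_sum[OF diag_of_carrier w, of i f]
      by (simp add: diag_of_def if_distrib[of "\<lambda>x. x * _"] del: index_mult_mat_vec cong: if_cong)
  qed simp
  have "spec_mat n V f *\<^sub>v v = V *\<^sub>v (diag_of n f *\<^sub>v ?w)"
    using D v w by (simp add: spec_mat_def assoc_mult_mat_vec[of _ n n _ n])
  hence "vec_l2 (spec_mat n V f *\<^sub>v v) = vec_l2 (diag_of n f *\<^sub>v ?w)"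
    using unitary_mat_preserves_vec_l2[OF V, of "diag_of n f *\<^sub>v ?w"] w mult_sq_vec_carrier[OF diag_of_carrier w] by simp
  also have "\<dots> \<le> L2_set (\<lambda>i. c * cmod (?w $ i)) {..<n}"
    unfolding dw vec_l2_L2_set using f
    by (auto simp: norm_mult mult_right_mono intro!: L2_set_mono)
  also have "\<dots> = c * vec_l2 ?w"
    using c carrier_vecD[OF w] by (simp add: vec_l2_L2_set L2_set_right_distrib del: dim_mult_mat_vec)
  also have "vec_l2 ?w = vec_l2 v"
    using unitary_mat_preserves_vec_l2[OF unitary_mat_adjoint[OF V] v] .
  finally show ?thesis .
qed

lemma unitary_spec_mat:
  assumes V: "unitary_mat n V" and f: "\<And>i. i < n \<Longrightarrow> cmod (f i) = 1"
  shows "unitary_mat n (spec_mat n V f)"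
proof (rule unitary_matI)
  note D = unitary_matD[OF V]
  show "spec_mat n V f \<in> carrier_mat n n" using D by simp
  have "mat_adjoint (spec_mat n V f) * spec_mat n V f = spec_mat n V (\<lambda>i. cnj (f i) * f i)"
    using D by (simp add: spec_mat_adjoint spec_mat_mult[OF V])
  also have "\<dots> = spec_mat n V (\<lambda>_. 1)"
  proof (rule spec_mat_cong)
    fix i assume "i < n"
    thus "cnj (f i) * f i = 1" using f[of i] complex_norm_square[of "f i"] by (simp add: mult.commute)
  qed
  finally show "mat_adjoint (spec_mat n V f) * spec_mat n V f = 1\<^sub>m n"
    by (simp add: spec_mat_one[OF V])
qed

lemma hermitian_index:
  assumes "hermitian_mat A" "A \<in> carrier_mat n n" "i < n" "j < n"
  shows "cnj (A $$ (j, i)) = A $$ (i, j)"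
  using assms by (metis carrier_matD hermitian_mat_def mat_adjoint_index)

text \<open>Induction on the dimension. A unitary whose first column is a unit eigenvector brings
  \<open>A\<close> to a form whose first column is a multiple of the first basis vector; being
  hermitian, that form has such a first row as well, and what remains is a hermitian block of
  smaller dimension.\<close>

lemma hermitian_spectral:
  assumes "A \<in> carrier_mat n n" "hermitian_mat A"
  obtains V l where "unitary_mat n V" "A = spec_mat n V (\<lambda>i. complex_of_real (l i))"
proof -
  have "\<exists>V l. unitary_mat n V \<and> A = spec_mat n V (\<lambda>i. complex_of_real (l i))"
    using assms
  proof (induction n arbitrary: A)
    case 0
    hence "A = spec_mat 0 (1\<^sub>m 0) (\<lambda>i. complex_of_real ((\<lambda>_. 0) i))"
      by (intro eq_matI) (auto simp: spec_mat_def)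
    with unitary_mat_one show ?case by (intro exI conjI)
  next
    case (Suc m)
    note A = Suc.prems(1) and herm = Suc.prems(2)
    have "spectrum A \<noteq> {}" using A by (intro spectrum_non_empty) auto
    then obtain e v where ev: "eigenvector A v e"
      by (auto simp: spectrum_def eigenvalue_def)
    hence v: "v \<in> carrier_vec (Suc m)" "v \<noteq> 0\<^sub>v (Suc m)" "A *\<^sub>v v = e \<cdot>\<^sub>v v"
      using A by (auto simp: eigenvector_def)
    have vn: "vec_l2 v \<noteq> 0" using v vec_l2_eq_0 by blast
    define u where "u = complex_of_real (1 / vec_l2 v) \<cdot>\<^sub>v v"
    have u: "u \<in> carrier_vec (Suc m)" using v by (simp add: u_def)
    have u1: "vec_l2 u = 1" using vn by (simp add: u_def vec_l2_smult norm_divide)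
    have Au: "A *\<^sub>v u = e \<cdot>\<^sub>v u"
      using A v by (simp add: u_def mult_mat_vec smult_smult_assoc mult.commute)
    obtain U where U: "unitary_mat (Suc m) U" "\<And>i. i < Suc m \<Longrightarrow> U $$ (i, 0) = u $ i"
      using unitary_completion[OF u u1] by blast
    note D = unitary_matD[OF U(1)]
    define B where "B = mat_adjoint U * A * U"
    have B: "B \<in> carrier_mat (Suc m) (Suc m)" using A D mat_adjoint_carrier[OF D(1)] by (simp add: B_def)
    have hB: "mat_adjoint B = B"
    proof -
      have "mat_adjoint B = mat_adjoint U * mat_adjoint (mat_adjoint U * A)"
        unfolding B_def using A D(1) by (intro mat_adjoint_mult) auto
      also have "mat_adjoint (mat_adjoint U * A) = mat_adjoint A * mat_adjoint (mat_adjoint U)"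
        using A D(1) by (intro mat_adjoint_mult) auto
      also have "\<dots> = A * U" using herm by (simp add: hermitian_mat_def)
      also have "mat_adjoint U * (A * U) = B"
        unfolding B_def using A D(1) by (intro assoc_mult_mat[symmetric]) auto
      finally show ?thesis .
    qed
    have Ue: "col U 0 = u" using U(2) D u by (intro eq_vecI) auto
    have "col B 0 = (mat_adjoint U * A) *\<^sub>v col U 0"
      unfolding B_def using A D(1) by (intro col_mult2) auto
    also have "\<dots> = mat_adjoint U *\<^sub>v (A *\<^sub>v col U 0)"
      using A D(1) by (intro assoc_mult_mat_vec[of _ "Suc m" "Suc m" _ "Suc m"]) (auto simp: Ue u)
    also have "\<dots> = e \<cdot>\<^sub>v col (mat_adjoint U * U) 0"
    proof -
      have "col (mat_adjoint U * U) 0 = mat_adjoint U *\<^sub>v col U 0"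
        using D(1) by (intro col_mult2) auto
      thus ?thesis using D(1) u by (simp add: Ue Au mult_mat_vec[of _ "Suc m" "Suc m"])
    qed
    finally have colB: "col B 0 = e \<cdot>\<^sub>v unit_vec (Suc m) 0" using D by simp
    have Bi0: "B $$ (i, 0) = (if i = 0 then e else 0)" if "i < Suc m" for i
      using arg_cong[OF colB, of "\<lambda>v. v $ i"] B that by (auto simp: unit_vec_def)
    have hBi: "cnj (B $$ (j, i)) = B $$ (i, j)" if "i < Suc m" "j < Suc m" for i j
      using arg_cong[OF hB, of "\<lambda>M. M $$ (i, j)"] that B by simp
    have B0j: "B $$ (0, j) = (if j = 0 then e else 0)" if "j < Suc m" for j
      using Bi0[of j] Bi0[of 0] hBi[of 0 j] that by auto
    \<comment> \<open>A diagonal entry of a hermitian matrix is real, hence so is the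
      eigenvalue.\<close>
    have "cnj e = e" using hBi[of 0 0] Bi0[of 0] by simp
    then obtain er where e: "e = complex_of_real er"
      by (metis Reals_cnj_iff complex_is_Real_iff of_real_Re)
    define B' where "B' = mat m m (\<lambda>(i, j). B $$ (Suc i, Suc j))"
    have "hermitian_mat B'"
    proof -
      have "cnj (B $$ (Suc j, Suc i)) = B $$ (Suc i, Suc j)" if "i < m" "j < m" for i j
        using that hBi by simp
      thus ?thesis by (auto simp: hermitian_mat_def B'_def intro!: eq_matI)
    qed
    then obtain V' l' where V': "unitary_mat m V'" "B' = spec_mat m V' (\<lambda>i. complex_of_real (l' i))"
      using Suc.IH[of B'] by (auto simp: B'_def)
    note D' = unitary_matD[OF V'(1)]
    \<comment> \<open>Block sum of the number 1 and \<open>V'\<close>; \<open>l\<close>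
      correspondingly puts the eigenvalue found first in front.\<close>
    define V where "V = mat (Suc m) (Suc m) (\<lambda>(i, j). case (i, j) of
       (0, 0) \<Rightarrow> 1 | (Suc i, Suc j) \<Rightarrow> V' $$ (i, j) | _ \<Rightarrow> 0)"
    define l where "l = (\<lambda>i. case i of 0 \<Rightarrow> er | Suc i \<Rightarrow> l' i)"
    have Vc: "V \<in> carrier_mat (Suc m) (Suc m)" by (simp add: V_def)
    have V0: "V $$ (0, 0) = 1" "\<And>x. x < m \<Longrightarrow> V $$ (0, Suc x) = 0" "\<And>x. x < m \<Longrightarrow> V $$ (Suc x, 0) = 0"
      "\<And>x y. x < m \<Longrightarrow> y < m \<Longrightarrow> V $$ (Suc x, Suc y) = V' $$ (x, y)"
      by (auto simp: V_def)
    have V: "unitary_mat (Suc m) V"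
    proof (rule unitary_matI[OF Vc], rule eq_matI)
      fix i j assume "i < dim_row (1\<^sub>m (Suc m) :: complex mat)" "j < dim_col (1\<^sub>m (Suc m) :: complex mat)"
      hence ij: "i < Suc m" "j < Suc m" by auto
      have "(mat_adjoint V * V) $$ (i, j) = (\<Sum>l<Suc m. mat_adjoint V $$ (i, l) * V $$ (l, j))"
        using ij Vc by (intro mult_mat_index_sum) auto
      also have "\<dots> = (\<Sum>l<Suc m. cnj (V $$ (l, i)) * V $$ (l, j))"
        using ij Vc by (intro sum.cong) auto
      also have "\<dots> = cnj (V $$ (0, i)) * V $$ (0, j) + (\<Sum>l<m. cnj (V $$ (Suc l, i)) * V $$ (Suc l, j))"
        by (rule sum.lessThan_Suc_shift)
      also have "\<dots> = (if i = j then 1 else 0)"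
        using ij cnj_cols_orthonormal[OF V'(1), of "i - 1" "j - 1"]
        by (cases i; cases j) (simp_all add: V0)
      finally show "(mat_adjoint V * V) $$ (i, j) = 1\<^sub>m (Suc m) $$ (i, j)" using ij by simp
    qed (use Vc in auto)
    have BV: "B = spec_mat (Suc m) V (\<lambda>i. complex_of_real (l i))"
    proof (rule eq_matI)
      fix i j assume "i < dim_row (spec_mat (Suc m) V (\<lambda>i. complex_of_real (l i)))"
         "j < dim_col (spec_mat (Suc m) V (\<lambda>i. complex_of_real (l i)))"
      hence ij: "i < Suc m" "j < Suc m" using Vc by (auto simp: spec_mat_def)
      have B'ij: "B $$ (Suc i, Suc j) = (\<Sum>l<m. V' $$ (i, l) * l' l * cnj (V' $$ (j, l)))"
        if "i < m" "j < m" for i j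
        using arg_cong[OF V'(2), of "\<lambda>M. M $$ (i, j)"] that D' by (simp add: B'_def spec_mat_index)
      have sum: "spec_mat (Suc m) V (\<lambda>i. complex_of_real (l i)) $$ (i, j) =
          V $$ (i, 0) * er * cnj (V $$ (j, 0)) + (\<Sum>x<m. V $$ (i, Suc x) * l' x * cnj (V $$ (j, Suc x)))"
        unfolding spec_mat_index[OF Vc ij] sum.lessThan_Suc_shift by (simp add: l_def)
      show "B $$ (i, j) = spec_mat (Suc m) V (\<lambda>i. complex_of_real (l i)) $$ (i, j)"
        unfolding sum using ij Bi0[OF ij(1)] B0j[OF ij(2)] e
        by (cases i; cases j) (simp_all add: V0 B'ij)
    qed (use B Vc in \<open>auto simp: spec_mat_def\<close>)
    have "A = U * B * mat_adjoint U"
    proof -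
      have "B = mat_adjoint U * (A * U)"
        unfolding B_def using A D(1) by (intro assoc_mult_mat) auto
      hence "U * B = U * (mat_adjoint U * (A * U))" by (rule arg_cong)
      also have "\<dots> = (U * mat_adjoint U) * (A * U)"
        using A D(1) by (intro assoc_mult_mat[symmetric]) auto
      also have "\<dots> = A * U" unfolding D(3) using A D(1) by simp
      finally have "U * B * mat_adjoint U = A * U * mat_adjoint U" by (rule arg_cong)
      also have "\<dots> = A * (U * mat_adjoint U)"
        using A D(1) by (intro assoc_mult_mat) auto
      finally show ?thesis unfolding D(3) using A by simp
    qed
    also have "\<dots> = spec_mat (Suc m) (U * V) (\<lambda>i. complex_of_real (l i))"
    proof -
      let ?D = "diag_of (Suc m) (\<lambda>i. complex_of_real (l i))"
      have "U * (V * ?D * mat_adjoint V) = U * (V * ?D) * mat_adjoint V"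
        using D(1) Vc by (intro assoc_mult_mat[symmetric]) auto
      moreover have "U * (V * ?D) = U * V * ?D"
        using D(1) Vc by (intro assoc_mult_mat[symmetric]) auto
      moreover have "U * V * ?D * mat_adjoint V * mat_adjoint U = U * V * ?D * (mat_adjoint V * mat_adjoint U)"
        using D(1) Vc by (intro assoc_mult_mat) auto
      moreover have "mat_adjoint V * mat_adjoint U = mat_adjoint (U * V)"
        using D(1) Vc by (intro mat_adjoint_mult[symmetric]) auto
      ultimately show ?thesis unfolding BV spec_mat_def by simp
    qed
    finally have "A = spec_mat (Suc m) (U * V) (\<lambda>i. complex_of_real (l i))" .
    with unitary_mat_mult[OF U(1) V] show ?case by (intro exI conjI)
  qed
  then obtain V where "\<exists>l. unitary_mat n V \<and> A = spec_mat n V (\<lambda>i. complex_of_real (l i))"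
    by (rule exE)
  then obtain l where Vl: "unitary_mat n V \<and> A = spec_mat n V (\<lambda>i. complex_of_real (l i))"
    by (rule exE)
  show ?thesis by (rule that[OF Vl[THEN conjunct1] Vl[THEN conjunct2]])
qed

text \<open>\<open>op_norm\<close> is a supremum of reals, which bounds its set only if that set is
  bounded above; the absolute row sums of \<open>A\<close> provide such a bound. The claim then
  reduces to the normalised vector.\<close>

lemma vec_l2_mult_le_op_norm:
  assumes A: "A \<in> carrier_mat m n" and v: "v \<in> carrier_vec n"
  shows "vec_l2 (A *\<^sub>v v) \<le> op_norm A * vec_l2 v"
proof (cases "vec_l2 v = 0")
  case True
  hence "v = 0\<^sub>v n" using vec_l2_eq_0[OF v] by blast
  hence "A *\<^sub>v v = 0\<^sub>v m" using A by (simp add: mult_mat_vec_def scalar_prod_def zero_vec_def)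
  thus ?thesis using True by simp
next
  case False
  define S where "S = {vec_l2 (A *\<^sub>v w) | w. w \<in> carrier_vec (dim_col A) \<and> vec_l2 w = 1}"
  have "bdd_above S"
  proof (rule bdd_aboveI)
    fix x assume "x \<in> S"
    then obtain w where w: "w \<in> carrier_vec n" "vec_l2 w = 1" and x: "x = vec_l2 (A *\<^sub>v w)"
      using A by (auto simp: S_def)
    have "cmod (w $ j) \<le> 1" if "j < n" for j
      using w that member_le_L2_set[of "{..<n}" j "\<lambda>j. cmod (w $ j)"] by (simp add: vec_l2_L2_set)
    hence "cmod ((A *\<^sub>v w) $ i) \<le> (\<Sum>j<n. cmod (A $$ (i, j)))" if "i < m" for i
      using A w that by (auto simp: scalar_prod_def atLeast0LessThan norm_mult mult_left_le
          intro!: sum_norm_le)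
    thus "x \<le> L2_set (\<lambda>i. \<Sum>j<n. cmod (A $$ (i, j))) {..<m}"
      using A unfolding x vec_l2_L2_set by (auto intro!: L2_set_mono)
  qed
  moreover have "vec_l2 (A *\<^sub>v (complex_of_real (1 / vec_l2 v) \<cdot>\<^sub>v v)) \<in> S"
    using A v False unfolding S_def
    by (intro CollectI exI[of _ "complex_of_real (1 / vec_l2 v) \<cdot>\<^sub>v v"]) (auto simp: vec_l2_smult norm_divide)
  ultimately have "vec_l2 (A *\<^sub>v (complex_of_real (1 / vec_l2 v) \<cdot>\<^sub>v v)) \<le> op_norm A"
    unfolding op_norm_def S_def[symmetric] by (rule cSup_upper[rotated])
  hence "vec_l2 (A *\<^sub>v v) / vec_l2 v \<le> op_norm A"
    using A v by (simp add: mult_mat_vec vec_l2_smult norm_inverse divide_inverse mult.commute)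
  thus ?thesis using False vec_l2_nonneg[of v] by (simp add: divide_le_eq)
qed

section \<open>Trace distance\<close>

lemma spec_mat_real_hermitian:
  assumes V: "V \<in> carrier_mat n n"
  shows "hermitian_mat (spec_mat n V (\<lambda>i. complex_of_real (f i)))"
  using V by (simp add: hermitian_mat_def spec_mat_adjoint)

text \<open>Square roots of the eigenvalues give a hermitian \<open>?Q\<close> with square
  \<open>?P\<close>, so the quadratic form of \<open>?P\<close> at \<open>v\<close> is the squared
  norm of \<open>?Q *\<^sub>v v\<close>.\<close>

lemma spec_mat_nonneg_positive:
  assumes V: "unitary_mat n V" and f: "\<And>i. i < n \<Longrightarrow> 0 \<le> f i"
  shows "positive_mat (spec_mat n V (\<lambda>i. complex_of_real (f i)))"
proof -
  note D = unitary_matD[OF V]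
  let ?P = "spec_mat n V (\<lambda>i. complex_of_real (f i))"
  let ?Q = "spec_mat n V (\<lambda>i. complex_of_real (sqrt (f i)))"
  have Q: "?Q \<in> carrier_mat n n" using D by simp
  have QQ: "?Q * ?Q = ?P"
    unfolding spec_mat_mult[OF V]
    using f by (intro spec_mat_cong) (auto simp flip: of_real_mult)
  have "0 \<le> (?P *\<^sub>v v) \<bullet>c v" if v: "v \<in> carrier_vec n" for v
  proof -
    have "(?P *\<^sub>v v) \<bullet>c v = (?Q *\<^sub>v (?Q *\<^sub>v v)) \<bullet>c v"
      using Q v unfolding QQ[symmetric] by (simp add: assoc_mult_mat_vec[of _ n n _ n])
    also have "\<dots> = (?Q *\<^sub>v v) \<bullet>c (mat_adjoint ?Q *\<^sub>v v)"
      using Q v by (intro cscalar_prod_adjoint) auto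
    also have "mat_adjoint ?Q = ?Q" using D by (simp add: spec_mat_adjoint)
    finally show ?thesis by (simp add: cscalar_prod_self less_eq_complex_def)
  qed
  thus ?thesis using D by (auto simp: positive_mat_def spec_mat_real_hermitian)
qed

lemma adjoint_mult_self_hermitian:
  assumes "A \<in> carrier_mat m n"
  shows "hermitian_mat (mat_adjoint A * (A :: complex mat))"
  using assms mat_adjoint_mult[of "mat_adjoint A" n m A n] by (simp add: hermitian_mat_def)

text \<open>Column \<open>i\<close> of \<open>V\<close> is a unit eigenvector, and the quadratic
  form at it reads off its eigenvalue.\<close>

lemma cscalar_prod_spec_mat_col:
  assumes V: "unitary_mat n V" and i: "i < n"
  shows "(spec_mat n V f *\<^sub>v col V i) \<bullet>c col V i = f i"
proof -
  note D = unitary_matD[OF V]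
  have e: "mat_adjoint V *\<^sub>v col V i = unit_vec n i"
    using col_mult2[OF mat_adjoint_carrier[OF D(1)] D(1) i] D(2) i by simp
  have c: "col V i \<in> carrier_vec n" using D by auto
  have d: "diag_of n f *\<^sub>v unit_vec n i = f i \<cdot>\<^sub>v unit_vec n i"
    using i by (intro eq_vecI) (auto simp: diag_of_def)
  have "spec_mat n V f *\<^sub>v col V i = V *\<^sub>v (diag_of n f *\<^sub>v (mat_adjoint V *\<^sub>v col V i))"
    using D(1) c by (simp add: spec_mat_def assoc_mult_mat_vec[of _ n n _ n])
  hence "(spec_mat n V f *\<^sub>v col V i) \<bullet>c col V i
      = (diag_of n f *\<^sub>v unit_vec n i) \<bullet>c (mat_adjoint V *\<^sub>v col V i)"
    using c cscalar_prod_adjoint[OF D(1), of "diag_of n f *\<^sub>v unit_vec n i" "col V i"]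
    by (simp add: mult_sq_vec_carrier[OF diag_of_carrier] e)
  thus ?thesis unfolding e d using i by simp
qed

text \<open>Gives meaning to the choice in \<open>mat_abs\<close>. An eigenvalue of
  \<open>mat_adjoint A * A\<close> is the squared norm of the image under \<open>A\<close> of a unit
  eigenvector, hence nonnegative with a real square root.\<close>

lemma mat_abs_exists:
  assumes A: "A \<in> carrier_mat n n"
  shows "\<exists>P. positive_mat P \<and> P * P = mat_adjoint A * A"
proof -
  have AA: "mat_adjoint A * A \<in> carrier_mat n n" using A by simp
  obtain V l where V: "unitary_mat n V" and l: "mat_adjoint A * A = spec_mat n V (\<lambda>i. complex_of_real (l i))"
    using hermitian_spectral[OF AA adjoint_mult_self_hermitian[OF A]] .
  note D = unitary_matD[OF V]
  have "0 \<le> l i" if i: "i < n" for i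
  proof -
    have c: "col V i \<in> carrier_vec n" using D by auto
    have "complex_of_real (l i) = (mat_adjoint A * A *\<^sub>v col V i) \<bullet>c col V i"
      unfolding l by (rule cscalar_prod_spec_mat_col[OF V i, symmetric])
    also have "\<dots> = (mat_adjoint A *\<^sub>v (A *\<^sub>v col V i)) \<bullet>c col V i"
      using A c by (subst assoc_mult_mat_vec[of _ n n _ n]) auto
    also have "\<dots> = (A *\<^sub>v col V i) \<bullet>c (mat_adjoint (mat_adjoint A) *\<^sub>v col V i)"
      using A c by (intro cscalar_prod_adjoint) auto
    finally have "complex_of_real (l i) = complex_of_real ((vec_l2 (A *\<^sub>v col V i))\<^sup>2)"
      by (simp add: cscalar_prod_self)
    thus ?thesis by (simp only: of_real_eq_iff) simp
  qed
  hence P: "positive_mat (spec_mat n V (\<lambda>i. complex_of_real (sqrt (l i))))"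
    and PP: "spec_mat n V (\<lambda>i. complex_of_real (sqrt (l i))) * spec_mat n V (\<lambda>i. complex_of_real (sqrt (l i)))
       = mat_adjoint A * A"
    unfolding spec_mat_mult[OF V] l
    by (intro spec_mat_nonneg_positive[OF V] spec_mat_cong; simp flip: of_real_mult)+
  show ?thesis by (intro exI conjI; fact P PP)
qed

lemma mat_abs_carrier_square:
  assumes A: "A \<in> carrier_mat n n"
  shows "mat_abs A \<in> carrier_mat n n" "hermitian_mat (mat_abs A)" "mat_abs A * mat_abs A = mat_adjoint A * A"
proof -
  have *: "positive_mat (mat_abs A) \<and> mat_abs A * mat_abs A = mat_adjoint A * A"
    unfolding mat_abs_def by (rule someI_ex[OF mat_abs_exists[OF A]])
  thus "hermitian_mat (mat_abs A)" and AA: "mat_abs A * mat_abs A = mat_adjoint A * A"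
    by (auto simp: positive_mat_def)
  \<comment> \<open>The choice does not mention the dimension; it is read off from the
    square.\<close>
  have "dim_row (mat_abs A * mat_abs A) = n" "dim_col (mat_abs A * mat_abs A) = n"
    unfolding AA using A by auto
  thus "mat_abs A \<in> carrier_mat n n" by auto
qed

text \<open>Cauchy-Schwarz applied to |y|^2 = <T y, a> for y =
  \<open>mat_adjoint T *\<^sub>v a\<close>, after which one factor |y| cancels.\<close>

lemma vec_l2_adjoint_le:
  assumes T: "T \<in> carrier_mat m n" and c: "\<And>x. x \<in> carrier_vec n \<Longrightarrow> vec_l2 (T *\<^sub>v x) \<le> vec_l2 x"
    and a: "a \<in> carrier_vec m"
  shows "vec_l2 (mat_adjoint T *\<^sub>v a) \<le> vec_l2 a"
proof -
  let ?y = "mat_adjoint T *\<^sub>v a"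
  have y: "?y \<in> carrier_vec n" using T by (intro mult_mat_vec_carrier[of _ n m]) (auto simp: a)
  have Ty: "T *\<^sub>v ?y \<in> carrier_vec m" using T y by (rule mult_mat_vec_carrier)
  have "(T *\<^sub>v ?y) \<bullet>c a = ?y \<bullet>c ?y" by (rule cscalar_prod_adjoint[OF T y a])
  hence "(vec_l2 ?y)\<^sup>2 = cmod ((T *\<^sub>v ?y) \<bullet>c a)" by (simp add: cscalar_prod_self norm_power)
  also have "\<dots> \<le> vec_l2 (T *\<^sub>v ?y) * vec_l2 a" by (rule cmod_cscalar_prod_le[OF Ty a])
  also have "\<dots> \<le> vec_l2 ?y * vec_l2 a" by (intro mult_right_mono c y) simp
  finally have "vec_l2 ?y * vec_l2 ?y \<le> vec_l2 ?y * vec_l2 a" by (simp add: power2_eq_square)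
  thus ?thesis using vec_l2_nonneg[of ?y] vec_l2_nonneg[of a]
    by (metis mult_left_le_imp_le order.order_iff_strict)
qed

text \<open>With \<open>T\<close> the partial isometry of the polar decomposition, \<open>|A| = T\<^sup>\<dagger>A\<close>, so that
  \<open>Tr |A|\<close> is a sum of scalar products \<open>\<langle>b\<^sub>j, T\<^sup>\<dagger>a\<^sub>j\<rangle>\<close>.\<close>

lemma mat_trace_mat_abs_le:
  assumes A: "A \<in> carrier_mat n n" and J: "finite J"
    and a: "\<And>j. j \<in> J \<Longrightarrow> a j \<in> carrier_vec n" and b: "\<And>j. j \<in> J \<Longrightarrow> b j \<in> carrier_vec n"
    and dec: "\<And>i k. i < n \<Longrightarrow> k < n \<Longrightarrow> A $$ (i, k) = (\<Sum>j\<in>J. a j $ i * cnj (b j $ k))"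
  shows "Re (mat_trace (mat_abs A)) \<le> (\<Sum>j\<in>J. vec_l2 (a j) * vec_l2 (b j))"
proof -
  note P = mat_abs_carrier_square[OF A]
  obtain V p where V: "unitary_mat n V" and p: "mat_abs A = spec_mat n V (\<lambda>i. complex_of_real (p i))"
    using hermitian_spectral[OF P(1,2)] .
  note D = unitary_matD[OF V]
  \<comment> \<open>Pseudo-inverse of |A|: the eigenvalue 0 is kept at 0, so T = A S is isometric on
    the range of |A| and zero on its kernel.\<close>
  define S where "S = spec_mat n V (\<lambda>i. complex_of_real (if p i = 0 then 0 else 1 / p i))"
  have S: "S \<in> carrier_mat n n" "mat_adjoint S = S" using D by (auto simp: S_def spec_mat_adjoint)
  define T where "T = A * S"
  have T: "T \<in> carrier_mat n n" using A S by (simp add: T_def)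
  have adjT: "mat_adjoint T = S * mat_adjoint A" using A S by (simp add: T_def mat_adjoint_mult[of _ n n _ n])
  have AA: "mat_adjoint A * A = spec_mat n V (\<lambda>i. complex_of_real (p i * p i))"
    using P(3) unfolding p spec_mat_mult[OF V] by simp
  have TA: "mat_adjoint T * A = mat_abs A"
  proof -
    have "mat_adjoint T * A = S * (mat_adjoint A * A)"
      unfolding adjT using A S by (intro assoc_mult_mat) auto
    also have "\<dots> = mat_abs A"
      unfolding AA S_def p spec_mat_mult[OF V] by (intro spec_mat_cong) auto
    finally show ?thesis .
  qed
  \<comment> \<open>The projection onto the range of |A|. Its eigenvalues are 0 and 1, which makes T
    a contraction.\<close>
  have TT: "mat_adjoint T * T = spec_mat n V (\<lambda>i. complex_of_real (if p i = 0 then 0 else 1))"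
  proof -
    have "mat_adjoint T * T = mat_abs A * S"
      unfolding TA[symmetric] unfolding T_def using A S
      by (intro assoc_mult_mat[symmetric]) (auto simp: mult_sq_carrier[of "A" n S] intro!: mat_adjoint_carrier)
    also have "\<dots> = spec_mat n V (\<lambda>i. complex_of_real (if p i = 0 then 0 else 1))"
      unfolding S_def p spec_mat_mult[OF V] by (intro spec_mat_cong) auto
    finally show ?thesis .
  qed
  have cT: "vec_l2 (T *\<^sub>v x) \<le> vec_l2 x" if x: "x \<in> carrier_vec n" for x
  proof -
    have Tx: "T *\<^sub>v x \<in> carrier_vec n" using T x by simp
    have TTx: "mat_adjoint T * T *\<^sub>v x \<in> carrier_vec n" using T x by simp
    have "(T *\<^sub>v x) \<bullet>c (T *\<^sub>v x) = x \<bullet>c (mat_adjoint T *\<^sub>v (T *\<^sub>v x))"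
      by (rule cscalar_prod_adjoint[OF T x Tx])
    also have "mat_adjoint T *\<^sub>v (T *\<^sub>v x) = mat_adjoint T * T *\<^sub>v x"
      using T x by (intro assoc_mult_mat_vec[symmetric]) auto
    finally have "(vec_l2 (T *\<^sub>v x))\<^sup>2 = cmod (x \<bullet>c (mat_adjoint T * T *\<^sub>v x))"
      by (metis cscalar_prod_self norm_of_real abs_power2)
    also have "\<dots> \<le> vec_l2 x * vec_l2 (mat_adjoint T * T *\<^sub>v x)"
      by (rule cmod_cscalar_prod_le[OF x TTx])
    also have "\<dots> \<le> vec_l2 x * (1 * vec_l2 x)"
      unfolding TT by (intro mult_left_mono vec_l2_spec_mat_le[OF V x]) auto
    finally show ?thesis by (simp add: power2_eq_square flip: power2_eq_square) 
  qed
  have "mat_trace (mat_abs A) = (\<Sum>i<n. (mat_adjoint T * A) $$ (i, i))"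
    using P(1) by (simp add: mat_trace_def TA)
  also have "\<dots> = (\<Sum>i<n. \<Sum>k<n. mat_adjoint T $$ (i, k) * A $$ (k, i))"
    using A T by (intro sum.cong refl mult_mat_index_sum) auto
  also have "\<dots> = (\<Sum>i<n. \<Sum>k<n. \<Sum>j\<in>J. mat_adjoint T $$ (i, k) * a j $ k * cnj (b j $ i))"
    by (intro sum.cong refl) (simp add: dec sum_distrib_left mult.assoc)
  also have "\<dots> = (\<Sum>i<n. \<Sum>j\<in>J. \<Sum>k<n. mat_adjoint T $$ (i, k) * a j $ k * cnj (b j $ i))"
    by (intro sum.cong refl sum.swap)
  also have "\<dots> = (\<Sum>j\<in>J. \<Sum>i<n. (\<Sum>k<n. mat_adjoint T $$ (i, k) * a j $ k) * cnj (b j $ i))"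
    by (subst sum.swap) (simp add: sum_distrib_right)
  also have "\<dots> = (\<Sum>j\<in>J. (mat_adjoint T *\<^sub>v a j) \<bullet>c b j)"
  proof (intro sum.cong refl)
    fix j assume j: "j \<in> J"
    have "(mat_adjoint T *\<^sub>v a j) $ i = (\<Sum>k<n. mat_adjoint T $$ (i, k) * a j $ k)" if "i < n" for i
      using T a[OF j] that by (intro mult_mat_vec_index_sum) auto
    thus "(\<Sum>i<n. (\<Sum>k<n. mat_adjoint T $$ (i, k) * a j $ k) * cnj (b j $ i)) = (mat_adjoint T *\<^sub>v a j) \<bullet>c b j"
      using b[OF j] by (simp add: scalar_prod_def atLeast0LessThan del: index_mult_mat_vec)
  qed
  finally have "Re (mat_trace (mat_abs A)) = (\<Sum>j\<in>J. Re ((mat_adjoint T *\<^sub>v a j) \<bullet>c b j))" by simp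
  also have "\<dots> \<le> (\<Sum>j\<in>J. vec_l2 (a j) * vec_l2 (b j))"
  proof (rule sum_mono)
    fix j assume j: "j \<in> J"
    have "Re ((mat_adjoint T *\<^sub>v a j) \<bullet>c b j) \<le> cmod ((mat_adjoint T *\<^sub>v a j) \<bullet>c b j)"
      by (rule complex_Re_le_cmod)
    also have "\<dots> \<le> vec_l2 (mat_adjoint T *\<^sub>v a j) * vec_l2 (b j)"
      using T a[OF j] b[OF j] by (intro cmod_cscalar_prod_le[of _ n]) auto
    also have "\<dots> \<le> vec_l2 (a j) * vec_l2 (b j)"
      by (intro mult_right_mono vec_l2_adjoint_le[OF T cT a[OF j]]) auto
    finally show "Re ((mat_adjoint T *\<^sub>v a j) \<bullet>c b j) \<le> vec_l2 (a j) * vec_l2 (b j)" .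
  qed
  finally show ?thesis .
qed

section \<open>Mixed states as sums of outer products\<close>

text \<open>Eigenvectors scaled by the square roots of their eigenvalues; the unit trace becomes the
  sum of the squared norms. The evolution of mixed states thereby reduces to the images of
  vectors.\<close>

lemma density_mat_decomposition:
  assumes "density_mat n \<rho>"
  obtains b where "\<And>m. m < n \<Longrightarrow> b m \<in> carrier_vec n" "(\<Sum>m<n. (vec_l2 (b m))\<^sup>2) = 1"
    "\<And>i j. i < n \<Longrightarrow> j < n \<Longrightarrow> \<rho> $$ (i, j) = (\<Sum>m<n. b m $ i * cnj (b m $ j))"
proof -
  have \<rho>: "\<rho> \<in> carrier_mat n n" "hermitian_mat \<rho>" "mat_trace \<rho> = 1"
    and pos: "\<And>v. v \<in> carrier_vec n \<Longrightarrow> 0 \<le> (\<rho> *\<^sub>v v) \<bullet>c v"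
    using assms by (auto simp: density_mat_def positive_mat_def)
  obtain V p where V: "unitary_mat n V" and p: "\<rho> = spec_mat n V (\<lambda>i. complex_of_real (p i))"
    using hermitian_spectral[OF \<rho>(1,2)] .
  note D = unitary_matD[OF V]
  have p0: "0 \<le> p i" if i: "i < n" for i
  proof -
    have "0 \<le> (\<rho> *\<^sub>v col V i) \<bullet>c col V i" using D by (intro pos) auto
    thus ?thesis unfolding p cscalar_prod_spec_mat_col[OF V i] by (simp add: less_eq_complex_def)
  qed
  define b where "b = (\<lambda>m. complex_of_real (sqrt (p m)) \<cdot>\<^sub>v col V m)"
  have b: "b m \<in> carrier_vec n" if "m < n" for m using D that by (auto simp: b_def)
  have dec: "\<rho> $$ (i, j) = (\<Sum>m<n. b m $ i * cnj (b m $ j))" if ij: "i < n" "j < n" for i j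
  proof -
    have "complex_of_real (p m) = complex_of_real (sqrt (p m)) * complex_of_real (sqrt (p m))" if "m < n" for m
      using p0[OF that] by (simp flip: of_real_mult)
    thus ?thesis using D(1) ij unfolding p spec_mat_index[OF D(1) ij] by (auto simp: b_def intro!: sum.cong)
  qed
  have "complex_of_real (\<Sum>m<n. (vec_l2 (b m))\<^sup>2) = (\<Sum>m<n. \<Sum>i<n. b m $ i * cnj (b m $ i))"
    using b unfolding vec_l2_square of_real_sum complex_norm_square by (intro sum.cong refl) auto
  also have "\<dots> = mat_trace \<rho>"
    using \<rho>(1) by (subst sum.swap) (simp add: mat_trace_def dec)
  finally have "(\<Sum>m<n. (vec_l2 (b m))\<^sup>2) = 1" unfolding \<rho>(3) using of_real_eq_1_iff by blast
  with b dec show ?thesis by (intro that[of b])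
qed

lemma sum_lessThan_mult:
  "(\<Sum>i<m * n. f i) = (\<Sum>l<m. \<Sum>i<n. f (l * n + i))" for f :: "nat \<Rightarrow> 'a :: comm_monoid_add"
proof (cases "n = 0")
  case False
  have "(\<Sum>i<m * n. f i) = (\<Sum>l<m. sum f {l * n..<l * n + n})"
    by (rule sum.nat_group[symmetric])
  also have "\<dots> = (\<Sum>l<m. \<Sum>i<n. f (l * n + i))"
  proof (rule sum.cong[OF refl])
    fix l
    show "sum f {l * n..<l * n + n} = (\<Sum>i<n. f (l * n + i))"
      using sum.shift_bounds_nat_ivl[of f 0 "l * n" n] by (simp add: atLeast0LessThan add.commute)
  qed
  finally show ?thesis .
qed simp

text \<open>The component of \<open>w\<close> in which the discarded registers are in basis state
  \<open>l\<close>; the system is the last tensor factor, so its index runs fastest.\<close>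

definition block_vec :: "nat \<Rightarrow> complex vec \<Rightarrow> nat \<Rightarrow> complex vec" where
  "block_vec D w l = vec D (\<lambda>i. w $ (l * D + i))"

lemma block_vec_carrier [simp]: "block_vec D w l \<in> carrier_vec D"
  by (simp add: block_vec_def)

lemma vec_l2_block_vec:
  assumes "w \<in> carrier_vec (e * D)"
  shows "(vec_l2 w)\<^sup>2 = (\<Sum>l<e. (vec_l2 (block_vec D w l))\<^sup>2)"
  using carrier_vecD[OF assms] by (simp add: vec_l2_square block_vec_def sum_lessThan_mult)

lemma mult_lt_mult: "l < e \<Longrightarrow> i < D \<Longrightarrow> l * D + i < e * (D :: nat)"
proof -
  assume "l < e" "i < D"
  hence "l * D + i < Suc l * D" "Suc l * D \<le> e * D" by (auto simp del: mult_Suc intro!: mult_le_mono1) simp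
  thus ?thesis by linarith
qed

text \<open>Outer products of the vectors \<open>b k\<close> are carried to outer products of their
  images, also by a rectangular \<open>F\<close>.\<close>

lemma evolve_index:
  assumes F: "F \<in> carrier_mat m n" and \<rho>: "\<rho> \<in> carrier_mat n n"
    and b: "\<And>k. k < n \<Longrightarrow> b k \<in> carrier_vec n"
    and dec: "\<And>i j. i < n \<Longrightarrow> j < n \<Longrightarrow> \<rho> $$ (i, j) = (\<Sum>k<n. b k $ i * cnj (b k $ j))"
    and i: "i < m" and j: "j < m"
  shows "evolve F \<rho> $$ (i, j) = (\<Sum>k<n. (F *\<^sub>v b k) $ i * cnj ((F *\<^sub>v b k) $ j))"
proof -
  have Fb: "(F *\<^sub>v b k) $ i = (\<Sum>x<n. F $$ (i, x) * b k $ x)" if "k < n" "i < m" for k i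
    by (rule mult_mat_vec_index_sum[OF F b[OF that(1)] that(2)])
  have F\<rho>: "F * \<rho> \<in> carrier_mat m n" using F \<rho> by (rule mult_carrier_mat)
  have "evolve F \<rho> $$ (i, j) = (\<Sum>y<n. (F * \<rho>) $$ (i, y) * mat_adjoint F $$ (y, j))"
    unfolding evolve_def using F \<rho> F\<rho> i j by (intro mult_mat_index_sum) auto
  also have "\<dots> = (\<Sum>y<n. (\<Sum>x<n. F $$ (i, x) * \<rho> $$ (x, y)) * cnj (F $$ (j, y)))"
    using F i j by (intro sum.cong refl arg_cong2[of _ _ _ _ "(*)"] mult_mat_index_sum[OF F \<rho>]) auto
  also have "\<dots> = (\<Sum>y<n. \<Sum>x<n. \<Sum>k<n. F $$ (i, x) * b k $ x * cnj (F $$ (j, y) * b k $ y))"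
    by (intro sum.cong refl) (simp add: dec sum_distrib_left sum_distrib_right mult_ac)
  also have "\<dots> = (\<Sum>y<n. \<Sum>k<n. \<Sum>x<n. F $$ (i, x) * b k $ x * cnj (F $$ (j, y) * b k $ y))"
    by (intro sum.cong refl sum.swap)
  also have "\<dots> = (\<Sum>k<n. \<Sum>y<n. \<Sum>x<n. F $$ (i, x) * b k $ x * cnj (F $$ (j, y) * b k $ y))"
    by (rule sum.swap)
  also have "\<dots> = (\<Sum>k<n. (F *\<^sub>v b k) $ i * cnj ((F *\<^sub>v b k) $ j))"
    by (intro sum.cong refl) (simp add: Fb i j sum_distrib_left sum_distrib_right cnj_sum del: index_mult_mat_vec)
  finally show ?thesis .
qed

section \<open>The reduced state behind an isometry compared with a unitary evolution\<close>

context
  fixes e D :: nat and F G \<rho> :: "complex mat"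
  assumes F: "F \<in> carrier_mat (e * D) D" and G: "G \<in> carrier_mat D D"
    and Fi: "\<And>v. v \<in> carrier_vec D \<Longrightarrow> vec_l2 (F *\<^sub>v v) = vec_l2 v"
    and Gi: "\<And>v. v \<in> carrier_vec D \<Longrightarrow> vec_l2 (G *\<^sub>v v) = vec_l2 v"
    and \<rho>: "density_mat D \<rho>"
begin

text \<open>The difference of the states is a signed sum of outer products of the blocks of
  \<open>F *\<^sub>v b m\<close> and of the vectors \<open>G *\<^sub>v b m\<close>. The squared
  norms of either family add up to 1, so the trace norm is at most 2.\<close>

lemma trace_dist_trace_out_le_1: "trace_dist (trace_out e D (evolve F \<rho>)) (evolve G \<rho>) \<le> 1"
proof -
  obtain b where b: "\<And>m. m < D \<Longrightarrow> b m \<in> carrier_vec D" and b1: "(\<Sum>m<D. (vec_l2 (b m))\<^sup>2) = 1"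
    and dec: "\<And>i j. i < D \<Longrightarrow> j < D \<Longrightarrow> \<rho> $$ (i, j) = (\<Sum>m<D. b m $ i * cnj (b m $ j))"
    using density_mat_decomposition[OF \<rho>] by blast
  have \<rho>c: "\<rho> \<in> carrier_mat D D" using \<rho> by (simp add: density_mat_def)
  let ?B = "\<lambda>m l. block_vec D (F *\<^sub>v b m) l"
  \<comment> \<open>The extra index l = e holds the subtracted state; its sign goes into one of the
    two factors only.\<close>
  let ?a = "\<lambda>(m, l). if l < e then ?B m l else - (G *\<^sub>v b m)"
  let ?c = "\<lambda>(m, l). if l < e then ?B m l else G *\<^sub>v b m"
  let ?A = "trace_out e D (evolve F \<rho>) - evolve G \<rho>"
  have Ac: "?A \<in> carrier_mat D D" using F G by (auto simp: trace_out_def evolve_def)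
  have "Re (mat_trace (mat_abs ?A)) \<le> (\<Sum>j\<in>{..<D} \<times> {..<Suc e}. vec_l2 (?a j) * vec_l2 (?c j))"
  proof (rule mat_trace_mat_abs_le[OF Ac])
    fix i k assume ik: "i < D" "k < D"
    have "?A $$ (i, k) = (\<Sum>l<e. evolve F \<rho> $$ (l * D + i, l * D + k)) - evolve G \<rho> $$ (i, k)"
      using ik F G by (simp add: trace_out_def evolve_def)
    also have "\<dots> = (\<Sum>l<e. \<Sum>m<D. ?B m l $ i * cnj (?B m l $ k))
        - (\<Sum>m<D. (G *\<^sub>v b m) $ i * cnj ((G *\<^sub>v b m) $ k))"
      using ik evolve_index[OF F \<rho>c b dec mult_lt_mult mult_lt_mult] evolve_index[OF G \<rho>c b dec ik]
      by (simp add: block_vec_def del: index_mult_mat_vec)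
    also have "\<dots> = (\<Sum>j\<in>{..<D} \<times> {..<Suc e}. ?a j $ i * cnj (?c j $ k))"
      using ik carrier_matD[OF G] unfolding sum.cartesian_product'
      by (subst sum.swap) (simp add: sum_subtractf del: index_mult_mat_vec)
    finally show "?A $$ (i, k) = (\<Sum>j\<in>{..<D} \<times> {..<Suc e}. ?a j $ i * cnj (?c j $ k))" .
  qed (use G b in auto)
  also have "\<dots> = (\<Sum>m<D. (\<Sum>l<e. (vec_l2 (?B m l))\<^sup>2) + (vec_l2 (G *\<^sub>v b m))\<^sup>2)"
    unfolding sum.cartesian_product' by (simp add: vec_l2_uminus power2_eq_square)
  also have "\<dots> = (\<Sum>m<D. 2 * (vec_l2 (b m))\<^sup>2)"
  proof (intro sum.cong refl)
    fix m assume "m \<in> {..<D}"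
    hence bm: "b m \<in> carrier_vec D" using b by simp
    have "(\<Sum>l<e. (vec_l2 (?B m l))\<^sup>2) = (vec_l2 (F *\<^sub>v b m))\<^sup>2"
      using F bm by (intro vec_l2_block_vec[symmetric] mult_mat_vec_carrier)
    thus "(\<Sum>l<e. (vec_l2 (?B m l))\<^sup>2) + (vec_l2 (G *\<^sub>v b m))\<^sup>2 = 2 * (vec_l2 (b m))\<^sup>2"
      by (simp add: Fi[OF bm] Gi[OF bm])
  qed
  also have "\<dots> = 2"
    using sum_distrib_left[of 2 "\<lambda>m. (vec_l2 (b m))\<^sup>2" "{..<D}"] unfolding b1 by simp
  finally show ?thesis by (simp add: trace_dist_def)
qed

text \<open>The vector subtracted in the hypothesis is \<open>G *\<^sub>v v\<close> with all
  discarded registers at zero. Block 0 yields a difference of two outer products, rewritten as two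
  outer products with a small vector in one factor each, together at most 2 \<delta>. The remaining
  blocks are small in both factors, so they enter only quadratically.\<close>

lemma trace_dist_trace_out_le:
  assumes e: "0 < e"
    and err: "\<And>v. v \<in> carrier_vec D \<Longrightarrow>
      vec_l2 (F *\<^sub>v v - vec (e * D) (\<lambda>i. if i < D then (G *\<^sub>v v) $ i else 0)) \<le> \<delta> * vec_l2 v"
    and \<delta>: "0 \<le> \<delta>"
  shows "trace_dist (trace_out e D (evolve F \<rho>)) (evolve G \<rho>) \<le> \<delta> + \<delta>\<^sup>2 / 2"
proof -
  obtain b where b: "\<And>m. m < D \<Longrightarrow> b m \<in> carrier_vec D" and b1: "(\<Sum>m<D. (vec_l2 (b m))\<^sup>2) = 1"
    and dec: "\<And>i j. i < D \<Longrightarrow> j < D \<Longrightarrow> \<rho> $$ (i, j) = (\<Sum>m<D. b m $ i * cnj (b m $ j))"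
    using density_mat_decomposition[OF \<rho>] by blast
  have \<rho>c: "\<rho> \<in> carrier_mat D D" using \<rho> by (simp add: density_mat_def)
  let ?B = "\<lambda>m l. block_vec D (F *\<^sub>v b m) l"
  let ?e = "\<lambda>m. ?B m 0 - G *\<^sub>v b m"
  \<comment> \<open>With B for block 0 of the image: index 0 holds |B - Gb><B|, index
    \<open>e\<close> holds |Gb><B - Gb|, and the indices between pair the other blocks with
    themselves.\<close>
  define a where "a = (\<lambda>(m, l). if l = 0 then ?e m else if l < e then ?B m l else G *\<^sub>v b m)"
  define c where "c = (\<lambda>(m, l). if l < e then ?B m l else ?e m)"
  let ?A = "trace_out e D (evolve F \<rho>) - evolve G \<rho>"
  obtain e' where e': "e = Suc e'" using e by (cases e) auto
  have Ac: "?A \<in> carrier_mat D D" using F G by (auto simp: trace_out_def evolve_def)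
  have bound: "Re (mat_trace (mat_abs ?A)) \<le> (\<Sum>j\<in>{..<D} \<times> {..<Suc e}. vec_l2 (a j) * vec_l2 (c j))"
  proof (rule mat_trace_mat_abs_le[OF Ac])
    fix i k assume ik: "i < D" "k < D"
    have "?A $$ (i, k) = (\<Sum>l<e. evolve F \<rho> $$ (l * D + i, l * D + k)) - evolve G \<rho> $$ (i, k)"
      using ik F G by (simp add: trace_out_def evolve_def)
    also have "\<dots> = (\<Sum>l<e. \<Sum>m<D. ?B m l $ i * cnj (?B m l $ k))
        - (\<Sum>m<D. (G *\<^sub>v b m) $ i * cnj ((G *\<^sub>v b m) $ k))"
      using ik evolve_index[OF F \<rho>c b dec mult_lt_mult mult_lt_mult] evolve_index[OF G \<rho>c b dec ik]
      by (simp add: block_vec_def del: index_mult_mat_vec)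
    finally have eq1: "?A $$ (i, k) = \<dots>" .
    have eq2: "(\<Sum>l<e. \<Sum>m<D. ?B m l $ i * cnj (?B m l $ k))
        - (\<Sum>m<D. (G *\<^sub>v b m) $ i * cnj ((G *\<^sub>v b m) $ k)) = (\<Sum>m<D. (\<Sum>l<e. ?B m l $ i * cnj (?B m l $ k))
        - (G *\<^sub>v b m) $ i * cnj ((G *\<^sub>v b m) $ k))"
      by (subst sum.swap) (simp add: sum_subtractf)
    have eq3: "(\<Sum>m<D. (\<Sum>l<e. ?B m l $ i * cnj (?B m l $ k))
        - (G *\<^sub>v b m) $ i * cnj ((G *\<^sub>v b m) $ k)) = (\<Sum>m<D. \<Sum>l<Suc e. a (m, l) $ i * cnj (c (m, l) $ k))"
    proof (intro sum.cong refl)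
      fix m assume "m \<in> {..<D}"
      hence Gb: "dim_vec (G *\<^sub>v b m) = D" "dim_vec (?B m 0) = D" using G by (auto simp: block_vec_def)
      have arith: "p * cnj q + S - r * cnj s = (p - r) * cnj q + S + r * cnj (q - s)" for p q r s S :: complex
        by (simp add: algebra_simps)
      let ?S = "\<Sum>l<e'. ?B m (Suc l) $ i * cnj (?B m (Suc l) $ k)"
      have 1: "(\<Sum>l<e. ?B m l $ i * cnj (?B m l $ k)) = ?B m 0 $ i * cnj (?B m 0 $ k) + ?S"
        unfolding e' by (rule sum.lessThan_Suc_shift)
      have "(\<Sum>l<e. a (m, l) $ i * cnj (c (m, l) $ k))
          = a (m, 0) $ i * cnj (c (m, 0) $ k) + (\<Sum>l<e'. a (m, Suc l) $ i * cnj (c (m, Suc l) $ k))"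
        unfolding e' by (rule sum.lessThan_Suc_shift)
      also have "(\<Sum>l<e'. a (m, Suc l) $ i * cnj (c (m, Suc l) $ k)) = ?S"
        by (intro sum.cong refl) (simp add: e' a_def c_def)
      finally have 2: "(\<Sum>l<Suc e. a (m, l) $ i * cnj (c (m, l) $ k)) =
          ?e m $ i * cnj (?B m 0 $ k) + ?S + (G *\<^sub>v b m) $ i * cnj (?e m $ k)"
        using e by (simp add: a_def c_def)
      have 3: "?e m $ i = ?B m 0 $ i - (G *\<^sub>v b m) $ i" "?e m $ k = ?B m 0 $ k - (G *\<^sub>v b m) $ k"
        using ik Gb by (simp_all del: index_mult_mat_vec)
      show "(\<Sum>l<e. ?B m l $ i * cnj (?B m l $ k)) - (G *\<^sub>v b m) $ i * cnj ((G *\<^sub>v b m) $ k)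
          = (\<Sum>l<Suc e. a (m, l) $ i * cnj (c (m, l) $ k))"
        unfolding 1 2 3 by (rule arith)
    qed
    show "?A $$ (i, k) = (\<Sum>j\<in>{..<D} \<times> {..<Suc e}. a j $ i * cnj (c j $ k))"
      by (rule trans[OF eq1 trans[OF eq2 trans[OF eq3 sum.cartesian_product'[symmetric]]]])
  qed (use G b in \<open>auto simp: a_def c_def\<close>)
  have eq1: "(\<Sum>j\<in>{..<D} \<times> {..<Suc e}. vec_l2 (a j) * vec_l2 (c j))
      = (\<Sum>m<D. \<Sum>l<Suc e. vec_l2 (a (m, l)) * vec_l2 (c (m, l)))"
    by (rule sum.cartesian_product')
  have le: "(\<Sum>m<D. \<Sum>l<Suc e. vec_l2 (a (m, l)) * vec_l2 (c (m, l)))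
      \<le> (\<Sum>m<D. (\<delta>\<^sup>2 + 2 * \<delta>) * (vec_l2 (b m))\<^sup>2)"
  proof (rule sum_mono)
    fix m assume "m \<in> {..<D}"
    hence bm: "b m \<in> carrier_vec D" using b by simp
    have Fb: "F *\<^sub>v b m \<in> carrier_vec (e * D)" and Gb: "G *\<^sub>v b m \<in> carrier_vec D"
      using F G bm by (auto intro: mult_mat_vec_carrier)
    let ?w = "F *\<^sub>v b m - vec (e * D) (\<lambda>i. if i < D then (G *\<^sub>v b m) $ i else 0)"
    have B0: "block_vec D ?w 0 = ?e m"
      using carrier_vecD[OF Fb] carrier_vecD[OF Gb] mult_lt_mult[OF e, of _ D]
      by (intro eq_vecI) (simp_all add: block_vec_def del: index_mult_mat_vec dim_mult_mat_vec)
    have Bl: "block_vec D ?w (Suc l) = ?B m (Suc l)" if "l < e'" for l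
      using carrier_vecD[OF Fb] mult_lt_mult[of "Suc l" e _ D] that e'
      by (intro eq_vecI) (auto simp: block_vec_def simp del: index_mult_mat_vec dim_mult_mat_vec)
    \<comment> \<open>Pythagoras over the blocks: block 0 of the error is the small vector, and the
      other blocks are those of the image itself, since the target vanishes there.\<close>
    have "(vec_l2 (?e m))\<^sup>2 + (\<Sum>l<e'. (vec_l2 (?B m (Suc l)))\<^sup>2) = (vec_l2 ?w)\<^sup>2"
    proof -
      have "(vec_l2 ?w)\<^sup>2 = (\<Sum>l<e. (vec_l2 (block_vec D ?w l))\<^sup>2)"
        using Fb by (intro vec_l2_block_vec) auto
      also have "\<dots> = (vec_l2 (block_vec D ?w 0))\<^sup>2 + (\<Sum>l<e'. (vec_l2 (block_vec D ?w (Suc l)))\<^sup>2)"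
        using sum.lessThan_Suc_shift[of "\<lambda>l. (vec_l2 (block_vec D ?w l))\<^sup>2" e'] unfolding e'[symmetric] .
      finally show ?thesis unfolding B0 by (simp add: Bl)
    qed
    also have "\<dots> \<le> (\<delta> * vec_l2 (b m))\<^sup>2" by (intro power_mono err bm) simp
    finally have s: "(vec_l2 (?e m))\<^sup>2 + (\<Sum>l<e'. (vec_l2 (?B m (Suc l)))\<^sup>2) \<le> (\<delta> * vec_l2 (b m))\<^sup>2" .
    hence "(vec_l2 (?e m))\<^sup>2 \<le> (\<delta> * vec_l2 (b m))\<^sup>2"
      using sum_nonneg[of "{..<e'}" "\<lambda>l. (vec_l2 (?B m (Suc l)))\<^sup>2"] by simp
    hence em: "vec_l2 (?e m) \<le> \<delta> * vec_l2 (b m)" by (rule power2_le_imp_le) (simp add: \<delta>)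
    have "(vec_l2 (?B m 0))\<^sup>2 \<le> (vec_l2 (F *\<^sub>v b m))\<^sup>2"
      unfolding vec_l2_block_vec[OF Fb] using e by (intro member_le_sum) auto
    hence B0l: "vec_l2 (?B m 0) \<le> vec_l2 (b m)" unfolding Fi[OF bm] by (rule power2_le_imp_le) simp
    have eq: "(\<Sum>l<Suc e. vec_l2 (a (m, l)) * vec_l2 (c (m, l)))
        = vec_l2 (?e m) * vec_l2 (?B m 0) + (\<Sum>l<e'. (vec_l2 (?B m (Suc l)))\<^sup>2)
          + vec_l2 (G *\<^sub>v b m) * vec_l2 (?e m)"
    proof -
      have "(\<Sum>l<e. vec_l2 (a (m, l)) * vec_l2 (c (m, l)))
          = vec_l2 (a (m, 0)) * vec_l2 (c (m, 0)) + (\<Sum>l<e'. vec_l2 (a (m, Suc l)) * vec_l2 (c (m, Suc l)))"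
        using sum.lessThan_Suc_shift[of "\<lambda>l. vec_l2 (a (m, l)) * vec_l2 (c (m, l))" e'] unfolding e'[symmetric] .
      also have "(\<Sum>l<e'. vec_l2 (a (m, Suc l)) * vec_l2 (c (m, Suc l))) = (\<Sum>l<e'. (vec_l2 (?B m (Suc l)))\<^sup>2)"
        using e' by (intro sum.cong refl) (simp add: power2_eq_square a_def c_def)
      finally show ?thesis using e by (simp add: a_def c_def)
    qed
    have 1: "vec_l2 (?e m) * vec_l2 (?B m 0) \<le> \<delta> * vec_l2 (b m) * vec_l2 (b m)"
      using \<delta> by (intro mult_mono[OF em B0l]) simp_all
    have 2: "(\<Sum>l<e'. (vec_l2 (?B m (Suc l)))\<^sup>2) \<le> (\<delta> * vec_l2 (b m))\<^sup>2"
      using s zero_le_power2[of "vec_l2 (?e m)"] by linarith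
    have 3: "vec_l2 (G *\<^sub>v b m) * vec_l2 (?e m) \<le> vec_l2 (b m) * (\<delta> * vec_l2 (b m))"
      unfolding Gi[OF bm] by (rule mult_left_mono[OF em vec_l2_nonneg])
    have 4: "(\<delta>\<^sup>2 + 2 * \<delta>) * (vec_l2 (b m))\<^sup>2
        = \<delta> * vec_l2 (b m) * vec_l2 (b m) + (\<delta> * vec_l2 (b m))\<^sup>2 + vec_l2 (b m) * (\<delta> * vec_l2 (b m))"
      by (simp add: power2_eq_square algebra_simps)
    show "(\<Sum>l<Suc e. vec_l2 (a (m, l)) * vec_l2 (c (m, l))) \<le> (\<delta>\<^sup>2 + 2 * \<delta>) * (vec_l2 (b m))\<^sup>2"
      unfolding eq 4 by (rule add_mono[OF add_mono[OF 1 2] 3])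
  qed
  have eq2: "(\<Sum>m<D. (\<delta>\<^sup>2 + 2 * \<delta>) * (vec_l2 (b m))\<^sup>2) = \<delta>\<^sup>2 + 2 * \<delta>"
    using sum_distrib_left[of "\<delta>\<^sup>2 + 2 * \<delta>" "\<lambda>m. (vec_l2 (b m))\<^sup>2" "{..<D}"] unfolding b1 by simp
  have "Re (mat_trace (mat_abs ?A)) \<le> \<delta>\<^sup>2 + 2 * \<delta>"
    using bound le unfolding eq1 eq2 by (rule order_trans)
  thus ?thesis by (simp add: trace_dist_def)
qed

end

section \<open>Tensor products and controlled gates\<close>

lemma tensor_mat_carrier [simp]:
  "A \<in> carrier_mat m n \<Longrightarrow> B \<in> carrier_mat k l \<Longrightarrow> A \<otimes>\<^sub>m B \<in> carrier_mat (m * k) (n * l)"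
  by (auto simp: tensor_mat_def)

lemma tensor_mat_dim [simp]:
  "dim_row (A \<otimes>\<^sub>m B) = dim_row A * dim_row B" "dim_col (A \<otimes>\<^sub>m B) = dim_col A * dim_col B"
  by (simp_all add: tensor_mat_def)

lemma tensor_vec_carrier [simp]:
  "u \<in> carrier_vec m \<Longrightarrow> v \<in> carrier_vec n \<Longrightarrow> u \<otimes>\<^sub>v v \<in> carrier_vec (m * n)"
  by (auto simp: tensor_vec_def)

lemma tensor_vec_dim [simp]: "dim_vec (u \<otimes>\<^sub>v v) = dim_vec u * dim_vec v"
  by (simp add: tensor_vec_def)

lemma lt_mult_div_mod:
  assumes "i < m * (n :: nat)"
  shows "i div n < m" "i mod n < n"
  using assms by (auto simp: less_mult_imp_div_less) (metis mod_less_divisor mult_0_right not_less0 neq0_conv)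

lemma div_mod_mult_add [simp]:
  assumes "b < (n :: nat)"
  shows "(a * n + b) div n = a" "(a * n + b) mod n = b"
  using assms by auto

lemma tensor_vec_index_add:
  assumes "u \<in> carrier_vec m" "v \<in> carrier_vec n" "i < m" "j < n"
  shows "(u \<otimes>\<^sub>v v) $ (i * n + j) = u $ i * v $ j"
  using assms mult_lt_mult[of i m j n] by (simp add: tensor_vec_def)

lemma tensor_vec_index:
  assumes "u \<in> carrier_vec m" "v \<in> carrier_vec n" "i < m * n"
  shows "(u \<otimes>\<^sub>v v) $ i = u $ (i div n) * v $ (i mod n)"
  using assms by (simp add: tensor_vec_def)

lemma tensor_mat_index:
  assumes "A \<in> carrier_mat m n" "B \<in> carrier_mat k l" "i < m * k" "j < n * l"
  shows "(A \<otimes>\<^sub>m B) $$ (i, j) = A $$ (i div k, j div l) * B $$ (i mod k, j mod l)"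
  using assms by (simp add: tensor_mat_def)

lemma tensor_unit_vec:
  assumes "i < m" "j < n"
  shows "unit_vec m i \<otimes>\<^sub>v unit_vec n j = unit_vec (m * n) (i * n + j)"
proof (rule eq_vecI)
  fix l assume "l < dim_vec (unit_vec (m * n) (i * n + j))"
  hence l: "l < m * n" by simp
  have "l = i * n + j \<longleftrightarrow> l div n = i \<and> l mod n = j"
    using assms(2) by (metis div_mod_mult_add div_mult_mod_eq)
  thus "(unit_vec m i \<otimes>\<^sub>v unit_vec n j) $ l = unit_vec (m * n) (i * n + j) $ l"
    using l assms lt_mult_div_mod[OF l]
    by (simp add: tensor_vec_index[OF unit_vec_carrier unit_vec_carrier l] mult_lt_mult)
qed auto

lemma tensor_mat_mult:
  fixes A B P Q :: "complex mat"
  assumes A: "A \<in> carrier_mat m n" and P: "P \<in> carrier_mat n k"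
    and B: "B \<in> carrier_mat m' n'" and Q: "Q \<in> carrier_mat n' k'"
  shows "(A \<otimes>\<^sub>m B) * (P \<otimes>\<^sub>m Q) = (A * P) \<otimes>\<^sub>m (B * Q)"
proof (rule eq_matI)
  have AP: "A * P \<in> carrier_mat m k" and BQ: "B * Q \<in> carrier_mat m' k'"
    using assms by (auto intro: mult_carrier_mat)
  fix i j assume "i < dim_row ((A * P) \<otimes>\<^sub>m (B * Q))" "j < dim_col ((A * P) \<otimes>\<^sub>m (B * Q))"
  hence i: "i < m * m'" and j: "j < k * k'" using assms by auto
  note i' = lt_mult_div_mod[OF i] and j' = lt_mult_div_mod[OF j]
  have "((A \<otimes>\<^sub>m B) * (P \<otimes>\<^sub>m Q)) $$ (i, j) = (\<Sum>l<n * n'. (A \<otimes>\<^sub>m B) $$ (i, l) * (P \<otimes>\<^sub>m Q) $$ (l, j))"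
    using assms i j by (intro mult_mat_index_sum) auto
  also have "\<dots> = (\<Sum>a<n. \<Sum>b<n'. (A $$ (i div m', a) * P $$ (a, j div k')) * (B $$ (i mod m', b) * Q $$ (b, j mod k')))"
    unfolding sum_lessThan_mult
    by (intro sum.cong refl) (simp add: tensor_mat_index[OF A B i] tensor_mat_index[OF P Q _ j] mult_lt_mult)
  also have "\<dots> = (A * P) $$ (i div m', j div k') * (B * Q) $$ (i mod m', j mod k')"
    unfolding mult_mat_index_sum[OF A P i'(1) j'(1)] mult_mat_index_sum[OF B Q i'(2) j'(2)]
    by (simp add: sum_product)
  also have "\<dots> = ((A * P) \<otimes>\<^sub>m (B * Q)) $$ (i, j)"
    by (simp only: tensor_mat_index[OF AP BQ i j])
  finally show "((A \<otimes>\<^sub>m B) * (P \<otimes>\<^sub>m Q)) $$ (i, j) = ((A * P) \<otimes>\<^sub>m (B * Q)) $$ (i, j)" .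
qed (use assms in auto)

lemma tensor_mat_mult_vec:
  assumes A: "A \<in> carrier_mat m n" and B: "B \<in> carrier_mat k l"
    and u: "u \<in> carrier_vec n" and v: "v \<in> carrier_vec l"
  shows "(A \<otimes>\<^sub>m B) *\<^sub>v (u \<otimes>\<^sub>v v) = (A *\<^sub>v u) \<otimes>\<^sub>v (B *\<^sub>v v)"
proof (rule eq_vecI)
  have Au: "A *\<^sub>v u \<in> carrier_vec m" and Bv: "B *\<^sub>v v \<in> carrier_vec k"
    using assms by (auto intro: mult_mat_vec_carrier)
  fix i assume "i < dim_vec ((A *\<^sub>v u) \<otimes>\<^sub>v (B *\<^sub>v v))"
  hence i: "i < m * k" using assms by auto
  note i' = lt_mult_div_mod[OF i]
  have "((A \<otimes>\<^sub>m B) *\<^sub>v (u \<otimes>\<^sub>v v)) $ i = (\<Sum>j<n * l. (A \<otimes>\<^sub>m B) $$ (i, j) * (u \<otimes>\<^sub>v v) $ j)"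
    using assms i by (intro mult_mat_vec_index_sum) auto
  also have "\<dots> = (\<Sum>a<n. \<Sum>b<l. (A $$ (i div k, a) * u $ a) * (B $$ (i mod k, b) * v $ b))"
    unfolding sum_lessThan_mult
    by (intro sum.cong refl) (simp add: tensor_mat_index[OF A B i] tensor_vec_index_add[OF u v] mult_lt_mult)
  also have "\<dots> = (A *\<^sub>v u) $ (i div k) * (B *\<^sub>v v) $ (i mod k)"
    unfolding mult_mat_vec_index_sum[OF A u i'(1)] mult_mat_vec_index_sum[OF B v i'(2)]
    by (simp add: sum_product)
  also have "\<dots> = ((A *\<^sub>v u) \<otimes>\<^sub>v (B *\<^sub>v v)) $ i"
    by (simp only: tensor_vec_index[OF Au Bv i])
  finally show "((A \<otimes>\<^sub>m B) *\<^sub>v (u \<otimes>\<^sub>v v)) $ i = ((A *\<^sub>v u) \<otimes>\<^sub>v (B *\<^sub>v v)) $ i" .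
qed (use assms in auto)

lemma mat_adjoint_tensor: "mat_adjoint (A \<otimes>\<^sub>m B) = mat_adjoint A \<otimes>\<^sub>m mat_adjoint (B :: complex mat)"
proof (rule eq_matI)
  fix i j assume "i < dim_row (mat_adjoint A \<otimes>\<^sub>m mat_adjoint B)" "j < dim_col (mat_adjoint A \<otimes>\<^sub>m mat_adjoint B)"
  hence "i < dim_col A * dim_col B" "j < dim_row A * dim_row B" by auto
  thus "mat_adjoint (A \<otimes>\<^sub>m B) $$ (i, j) = (mat_adjoint A \<otimes>\<^sub>m mat_adjoint B) $$ (i, j)"
    using lt_mult_div_mod[of i "dim_col A" "dim_col B"] lt_mult_div_mod[of j "dim_row A" "dim_row B"]
    by (simp add: tensor_mat_def)
qed auto

lemma tensor_mat_one: "1\<^sub>m m \<otimes>\<^sub>m 1\<^sub>m n = (1\<^sub>m (m * n) :: complex mat)"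
proof (rule eq_matI)
  fix i j assume "i < dim_row (1\<^sub>m (m * n) :: complex mat)" "j < dim_col (1\<^sub>m (m * n) :: complex mat)"
  hence ij: "i < m * n" "j < m * n" by auto
  have "i = j \<longleftrightarrow> i div n = j div n \<and> i mod n = j mod n"
    by (metis div_mult_mod_eq)
  thus "(1\<^sub>m m \<otimes>\<^sub>m 1\<^sub>m n) $$ (i, j) = (1\<^sub>m (m * n) :: complex mat) $$ (i, j)"
    using ij lt_mult_div_mod[OF ij(1)] lt_mult_div_mod[OF ij(2)] by (simp add: tensor_mat_def)
qed auto

lemma unitary_mat_tensor:
  assumes U: "unitary_mat m U" and V: "unitary_mat n V"
  shows "unitary_mat (m * n) (U \<otimes>\<^sub>m V)"
proof (rule unitary_matI)
  note D = unitary_matD[OF U] unitary_matD[OF V]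
  show "U \<otimes>\<^sub>m V \<in> carrier_mat (m * n) (m * n)" using D by simp
  have "mat_adjoint (U \<otimes>\<^sub>m V) * (U \<otimes>\<^sub>m V) = (mat_adjoint U * U) \<otimes>\<^sub>m (mat_adjoint V * V)"
    unfolding mat_adjoint_tensor using D(1,4) by (intro tensor_mat_mult) auto
  thus "mat_adjoint (U \<otimes>\<^sub>m V) * (U \<otimes>\<^sub>m V) = 1\<^sub>m (m * n)"
    by (simp only: D(2,5) tensor_mat_one)
qed

section \<open>Permutation gates and gates controlled by a label\<close>

definition perm_mat :: "nat \<Rightarrow> (nat \<Rightarrow> nat) \<Rightarrow> complex mat" where
  "perm_mat n \<sigma> = mat n n (\<lambda>(i, j). if i = \<sigma> j then 1 else 0)"

lemma perm_mat_carrier [simp]: "perm_mat n \<sigma> \<in> carrier_mat n n"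
  by (simp add: perm_mat_def)

lemma perm_mat_mult_unit_vec:
  assumes "j < n" "\<sigma> j < n"
  shows "perm_mat n \<sigma> *\<^sub>v unit_vec n j = unit_vec n (\<sigma> j)"
  using assms by (intro eq_vecI) (auto simp: perm_mat_def)

lemma unitary_perm_mat:
  assumes "\<And>j. j < n \<Longrightarrow> \<sigma> j < n" "inj_on \<sigma> {..<n}"
  shows "unitary_mat n (perm_mat n \<sigma>)"
proof (rule unitary_matI[OF perm_mat_carrier], rule eq_matI)
  fix i j assume "i < dim_row (1\<^sub>m n :: complex mat)" "j < dim_col (1\<^sub>m n :: complex mat)"
  hence ij: "i < n" "j < n" by auto
  have "(mat_adjoint (perm_mat n \<sigma>) * perm_mat n \<sigma>) $$ (i, j)
      = (\<Sum>l<n. mat_adjoint (perm_mat n \<sigma>) $$ (i, l) * perm_mat n \<sigma> $$ (l, j))"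
    using ij by (intro mult_mat_index_sum) auto
  also have "\<dots> = (\<Sum>l<n. if l = \<sigma> i then if \<sigma> i = \<sigma> j then 1 else 0 else 0)"
    using ij by (intro sum.cong) (auto simp: perm_mat_def)
  also have "\<dots> = (if \<sigma> i = \<sigma> j then 1 else 0)" using assms(1)[OF ij(1)] by simp
  also have "\<sigma> i = \<sigma> j \<longleftrightarrow> i = j" using assms(2) ij by (auto dest: inj_onD)
  finally show "(mat_adjoint (perm_mat n \<sigma>) * perm_mat n \<sigma>) $$ (i, j) = 1\<^sub>m n $$ (i, j)" using ij by simp
qed (auto simp: perm_mat_def)

text \<open>Block diagonality for the partition of the basis by \<open>lab\<close>. This is what
  allows \<open>lab\<close> to act as a control value: the gate that it selects must not change
  it.\<close>

definition preserves :: "nat \<Rightarrow> (nat \<Rightarrow> 'c) \<Rightarrow> complex mat \<Rightarrow> bool" where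
  "preserves n lab A \<longleftrightarrow> (\<forall>i<n. \<forall>j<n. A $$ (i, j) \<noteq> 0 \<longrightarrow> lab i = lab j)"

text \<open>Column \<open>j\<close> comes from the gate that the label of \<open>j\<close> selects.
  The label may be any function of the basis index, such as a register or a part of one.\<close>

definition ctrl_mat :: "nat \<Rightarrow> (nat \<Rightarrow> 'c) \<Rightarrow> ('c \<Rightarrow> complex mat) \<Rightarrow> complex mat" where
  "ctrl_mat n lab G = mat n n (\<lambda>(i, j). G (lab j) $$ (i, j))"

lemma ctrl_mat_carrier [simp]: "ctrl_mat n lab G \<in> carrier_mat n n"
  by (simp add: ctrl_mat_def)

lemma ctrl_mat_dim [simp]: "dim_row (ctrl_mat n lab G) = n" "dim_col (ctrl_mat n lab G) = n"
  by (simp_all add: ctrl_mat_def)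

lemma preservesD: "preserves n lab A \<Longrightarrow> i < n \<Longrightarrow> j < n \<Longrightarrow> lab i \<noteq> lab j \<Longrightarrow> A $$ (i, j) = 0"
  by (auto simp: preserves_def)

lemma preserves_adjoint:
  "A \<in> carrier_mat n n \<Longrightarrow> preserves n lab A \<Longrightarrow> preserves n lab (mat_adjoint A)"
  by (auto simp: preserves_def)

lemma preserves_one: "preserves n lab (1\<^sub>m n)"
  by (auto simp: preserves_def)

lemma preserves_tensor_one_left:
  assumes "B \<in> carrier_mat s s"
  shows "preserves (m * s) (\<lambda>i. f (i div s)) (1\<^sub>m m \<otimes>\<^sub>m B)"
  unfolding preserves_def
proof (intro allI impI)
  fix i j assume ij: "i < m * s" "j < m * s" "(1\<^sub>m m \<otimes>\<^sub>m B) $$ (i, j) \<noteq> 0"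
  thus "f (i div s) = f (j div s)"
    using lt_mult_div_mod[OF ij(1)] lt_mult_div_mod[OF ij(2)]
    by (auto simp: tensor_mat_index[OF one_carrier_mat assms] split: if_splits)
qed

lemma preserves_tensor_one_right:
  assumes "A \<in> carrier_mat m m"
  shows "preserves (m * s) (\<lambda>i. f (i mod s)) (A \<otimes>\<^sub>m 1\<^sub>m s)"
  unfolding preserves_def
proof (intro allI impI)
  fix i j assume ij: "i < m * s" "j < m * s" "(A \<otimes>\<^sub>m 1\<^sub>m s) $$ (i, j) \<noteq> 0"
  thus "f (i mod s) = f (j mod s)"
    using lt_mult_div_mod[OF ij(1)] lt_mult_div_mod[OF ij(2)]
    by (auto simp: tensor_mat_index[OF assms one_carrier_mat] split: if_splits)
qed

lemma preserves_tensor_right: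
  assumes "A \<in> carrier_mat m m" "B \<in> carrier_mat s s" "preserves s lab B"
  shows "preserves (m * s) (\<lambda>i. lab (i mod s)) (A \<otimes>\<^sub>m B)"
  unfolding preserves_def
proof (intro allI impI)
  fix i j assume ij: "i < m * s" "j < m * s" "(A \<otimes>\<^sub>m B) $$ (i, j) \<noteq> 0"
  thus "lab (i mod s) = lab (j mod s)"
    using lt_mult_div_mod[OF ij(1)] lt_mult_div_mod[OF ij(2)] assms(3)
    by (auto simp: tensor_mat_index[OF assms(1,2)] preserves_def)
qed

text \<open>Columns with equal labels are columns of one unitary; columns with different labels have
  disjoint supports and so are orthogonal.\<close>

lemma unitary_ctrl_mat:
  assumes U: "\<And>j. j < n \<Longrightarrow> unitary_mat n (G (lab j))"
    and pr: "\<And>j. j < n \<Longrightarrow> preserves n lab (G (lab j))"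
  shows "unitary_mat n (ctrl_mat n lab G)"
proof (rule unitary_matI[OF ctrl_mat_carrier], rule eq_matI)
  fix i j assume "i < dim_row (1\<^sub>m n :: complex mat)" "j < dim_col (1\<^sub>m n :: complex mat)"
  hence ij: "i < n" "j < n" by auto
  have "(mat_adjoint (ctrl_mat n lab G) * ctrl_mat n lab G) $$ (i, j)
      = (\<Sum>l<n. mat_adjoint (ctrl_mat n lab G) $$ (i, l) * ctrl_mat n lab G $$ (l, j))"
    using ij by (intro mult_mat_index_sum) auto
  also have "\<dots> = (\<Sum>l<n. cnj (G (lab i) $$ (l, i)) * G (lab j) $$ (l, j))"
    using ij by (intro sum.cong) (auto simp: ctrl_mat_def)
  also have "\<dots> = (if i = j then 1 else 0)"
  proof (cases "lab i = lab j")
    case True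
    thus ?thesis using cnj_cols_orthonormal[OF U[OF ij(2)] ij] by simp
  next
    case False
    have "cnj (G (lab i) $$ (l, i)) * G (lab j) $$ (l, j) = 0" if "l < n" for l
      using False preservesD[OF pr[OF ij(1)] that ij(1)] preservesD[OF pr[OF ij(2)] that ij(2)]
      by (cases "lab l = lab i") auto
    hence "(\<Sum>l<n. cnj (G (lab i) $$ (l, i)) * G (lab j) $$ (l, j)) = 0"
      by (intro sum.neutral ballI) (simp only: lessThan_iff)
    thus ?thesis using False by auto
  qed
  finally show "(mat_adjoint (ctrl_mat n lab G) * ctrl_mat n lab G) $$ (i, j) = 1\<^sub>m n $$ (i, j)"
    using ij by simp
qed auto

text \<open>Entries between different labels vanish, so it makes no difference whether the row or
  the column selects the gate.\<close>

lemma mat_adjoint_ctrl_mat: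
  assumes c: "\<And>j. j < n \<Longrightarrow> G (lab j) \<in> carrier_mat n n" and pr: "\<And>j. j < n \<Longrightarrow> preserves n lab (G (lab j))"
  shows "mat_adjoint (ctrl_mat n lab G) = ctrl_mat n lab (\<lambda>x. mat_adjoint (G x))"
proof (rule eq_matI)
  fix i j assume "i < dim_row (ctrl_mat n lab (\<lambda>x. mat_adjoint (G x)))" "j < dim_col (ctrl_mat n lab (\<lambda>x. mat_adjoint (G x)))"
  hence ij: "i < n" "j < n" by auto
  show "mat_adjoint (ctrl_mat n lab G) $$ (i, j) = ctrl_mat n lab (\<lambda>x. mat_adjoint (G x)) $$ (i, j)"
    using c[OF ij(2)] ij preservesD[OF pr[OF ij(1)] ij(2,1)] preservesD[OF pr[OF ij(2)] ij(2,1)]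
    by (cases "lab i = lab j") (simp_all add: ctrl_mat_def)
qed auto

text \<open>Membership in the subspace of label \<open>c\<close>, on which \<open>ctrl_mat\<close>
  acts as the single gate \<open>G c\<close>.\<close>

definition supported :: "(nat \<Rightarrow> 'c) \<Rightarrow> 'c \<Rightarrow> complex vec \<Rightarrow> bool" where
  "supported lab c v \<longleftrightarrow> (\<forall>j<dim_vec v. v $ j \<noteq> 0 \<longrightarrow> lab j = c)"

lemma ctrl_mat_mult_vec:
  assumes v: "v \<in> carrier_vec n" and s: "supported lab c v" and G: "G c \<in> carrier_mat n n"
  shows "ctrl_mat n lab G *\<^sub>v v = G c *\<^sub>v v"
proof (rule eq_vecI)
  fix i assume "i < dim_vec (G c *\<^sub>v v)"
  hence i: "i < n" using G by simp
  have "G (lab j) $$ (i, j) * v $ j = G c $$ (i, j) * v $ j" if "j < n" for j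
    using s that v by (cases "v $ j = 0") (auto simp: supported_def)
  hence "(\<Sum>j<n. G (lab j) $$ (i, j) * v $ j) = (\<Sum>j<n. G c $$ (i, j) * v $ j)"
    by (intro sum.cong refl) (simp only: lessThan_iff)
  thus "(ctrl_mat n lab G *\<^sub>v v) $ i = (G c *\<^sub>v v) $ i"
    unfolding mult_mat_vec_index_sum[OF ctrl_mat_carrier v i] mult_mat_vec_index_sum[OF G v i]
    using i by (simp add: ctrl_mat_def)
qed (use G in auto)

lemma supported_mult_vec:
  assumes v: "v \<in> carrier_vec n" and s: "supported lab c v" and A: "A \<in> carrier_mat n n"
    and pr: "preserves n lab A"
  shows "supported lab c (A *\<^sub>v v)"
  unfolding supported_def
proof (intro allI impI)
  fix i assume "i < dim_vec (A *\<^sub>v v)" and nz: "(A *\<^sub>v v) $ i \<noteq> 0"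
  hence i: "i < n" using A by simp
  from nz obtain j where "j < n" "A $$ (i, j) * v $ j \<noteq> 0"
    unfolding mult_mat_vec_index_sum[OF A v i] by (metis (no_types, lifting) lessThan_iff sum.neutral)
  thus "lab i = c" using s v pr i by (auto simp: supported_def preserves_def)
qed

lemma supported_tensor_right:
  assumes "u \<in> carrier_vec m" "v \<in> carrier_vec s" "supported lab c v"
  shows "supported (\<lambda>i. lab (i mod s)) c (u \<otimes>\<^sub>v v)"
  unfolding supported_def
proof (intro allI impI)
  fix i assume "i < dim_vec (u \<otimes>\<^sub>v v)" and nz: "(u \<otimes>\<^sub>v v) $ i \<noteq> 0"
  hence i: "i < m * s" using assms by simp
  thus "lab (i mod s) = c" using nz lt_mult_div_mod[OF i] assms(2,3)
    by (auto simp: tensor_vec_index[OF assms(1,2) i] supported_def)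
qed

lemma supported_tensor_left:
  assumes "u \<in> carrier_vec m" "v \<in> carrier_vec s" "supported lab c u"
  shows "supported (\<lambda>i. lab (i div s)) c (u \<otimes>\<^sub>v v)"
  unfolding supported_def
proof (intro allI impI)
  fix i assume "i < dim_vec (u \<otimes>\<^sub>v v)" and nz: "(u \<otimes>\<^sub>v v) $ i \<noteq> 0"
  hence i: "i < m * s" using assms by simp
  thus "lab (i div s) = c" using nz lt_mult_div_mod[OF i] assms(1,3)
    by (auto simp: tensor_vec_index[OF assms(1,2) i] supported_def)
qed

lemma supported_unit_vec: "supported lab (lab i) (unit_vec n i)"
  by (auto simp: supported_def unit_vec_def)

section \<open>Appending registers in state zero\<close>

text \<open>The isometry that adds registers in state zero: the system is the last tensor factor, so
  its first \<open>r\<close> indices are those with every other register at zero.\<close>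

definition embed_mat :: "nat \<Rightarrow> nat \<Rightarrow> complex mat" where
  "embed_mat n r = mat n r (\<lambda>(i, j). if i = j then 1 else 0)"

lemma embed_mat_carrier [simp]: "embed_mat n r \<in> carrier_mat n r"
  by (simp add: embed_mat_def)

lemma embed_mat_dim [simp]: "dim_row (embed_mat n r) = n" "dim_col (embed_mat n r) = r"
  by (simp_all add: embed_mat_def)

lemma embed_mat_mult_vec:
  assumes "v \<in> carrier_vec r"
  shows "embed_mat n r *\<^sub>v v = vec n (\<lambda>i. if i < r then v $ i else 0)"
proof (rule eq_vecI)
  fix i assume "i < dim_vec (vec n (\<lambda>i. if i < r then v $ i else 0))"
  hence i: "i < n" by simp
  have "(embed_mat n r *\<^sub>v v) $ i = (\<Sum>j<r. if j = i then v $ j else 0)"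
    unfolding mult_mat_vec_index_sum[OF embed_mat_carrier assms i]
    using i by (intro sum.cong) (auto simp: embed_mat_def)
  thus "(embed_mat n r *\<^sub>v v) $ i = vec n (\<lambda>i. if i < r then v $ i else 0) $ i" using i by simp
qed auto

lemma embed_mat_tensor:
  assumes v: "v \<in> carrier_vec s" and m: "0 < m"
  shows "embed_mat (m * s) s *\<^sub>v v = unit_vec m 0 \<otimes>\<^sub>v v"
proof (rule eq_vecI)
  fix i assume "i < dim_vec (unit_vec m 0 \<otimes>\<^sub>v v)"
  hence i: "i < m * s" using v by simp
  hence "0 < s" by (cases s) auto
  hence "i div s = 0 \<longleftrightarrow> i < s" by (simp add: div_eq_0_iff)
  thus "(embed_mat (m * s) s *\<^sub>v v) $ i = (unit_vec m 0 \<otimes>\<^sub>v v) $ i"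
    unfolding embed_mat_mult_vec[OF v] tensor_vec_index[OF unit_vec_carrier v i]
    using i m lt_mult_div_mod[OF i] by simp
qed (use v in auto)

lemma embed_mat_comp:
  assumes "r \<le> s" "s \<le> n"
  shows "embed_mat n s * embed_mat s r = embed_mat n r"
proof (rule eq_matI)
  fix i j assume "i < dim_row (embed_mat n r)" "j < dim_col (embed_mat n r)"
  hence ij: "i < n" "j < r" by auto
  have "(embed_mat n s * embed_mat s r) $$ (i, j) = (\<Sum>l<s. embed_mat n s $$ (i, l) * embed_mat s r $$ (l, j))"
    using ij by (intro mult_mat_index_sum) auto
  also have "\<dots> = (\<Sum>l<s. if l = j then if i = j then 1 else 0 else 0)"
    using ij by (intro sum.cong) (auto simp: embed_mat_def)
  finally show "(embed_mat n s * embed_mat s r) $$ (i, j) = embed_mat n r $$ (i, j)"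
    using ij assms by (simp add: embed_mat_def)
qed auto

lemma mat_eqI_unit_vec:
  fixes A B :: "complex mat"
  assumes A: "A \<in> carrier_mat m n" and B: "B \<in> carrier_mat m n"
    and eq: "\<And>j. j < n \<Longrightarrow> A *\<^sub>v unit_vec n j = B *\<^sub>v unit_vec n j"
  shows "A = B"
proof (rule eq_matI)
  fix i j assume "i < dim_row B" "j < dim_col B"
  hence ij: "i < m" "j < n" using B by auto
  have "C $$ (i, j) = (C *\<^sub>v unit_vec n j) $ i" if "C \<in> carrier_mat m n" for C :: "complex mat"
    unfolding mult_mat_vec_index_sum[OF that unit_vec_carrier ij(1)] using ij
    by (simp add: unit_vec_def if_distrib cong: if_cong)
  thus "A $$ (i, j) = B $$ (i, j)" using A B eq[OF ij(2)] by simp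
qed (use A B in auto)

section \<open>Circuits\<close>

text \<open>The gates are quantified outside \<open>U\<close>: one program with \<open>m\<close>
  calls has to serve every oracle. \<open>V\<close> is the resulting unitary as a function of the
  oracle, which lets programs be multiplied like matrices.\<close>

definition circuit :: "nat \<Rightarrow> nat \<Rightarrow> nat \<Rightarrow> (complex mat \<Rightarrow> complex mat) \<Rightarrow> bool" where
  "circuit q r m V \<longleftrightarrow> (\<exists>W\<^sub>0 steps. length steps = m \<and> unitary_mat (q * r) W\<^sub>0 \<and>
     (\<forall>(c, W) \<in> set steps. unitary_mat (q * r) W) \<and>
     (\<forall>U. unitary_mat q U \<longrightarrow> V U = run r U W\<^sub>0 steps))"

lemma unitary_call_mat: "unitary_mat q U \<Longrightarrow> unitary_mat q (call_mat U c)"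
  by (cases c) (auto intro: unitary_mat_adjoint)

lemma run_append: "run r U W\<^sub>0 (steps @ steps') = run r U (run r U W\<^sub>0 steps) steps'"
proof (induction steps arbitrary: W\<^sub>0)
  case (Cons x steps)
  thus ?case by (cases x) simp
qed simp

lemma unitary_run:
  assumes "unitary_mat q U" "unitary_mat (q * r) W\<^sub>0" "\<forall>(c, W) \<in> set steps. unitary_mat (q * r) W"
  shows "unitary_mat (q * r) (run r U W\<^sub>0 steps)"
  using assms(2,3)
proof (induction steps arbitrary: W\<^sub>0)
  case (Cons x steps)
  obtain c W where x: "x = (c, W)" by force
  have "unitary_mat (q * r) (W * (call_mat U c \<otimes>\<^sub>m 1\<^sub>m r) * W\<^sub>0)"
    using Cons.prems by (intro unitary_mat_mult unitary_mat_tensor unitary_call_mat assms(1)) (auto simp: x)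
  thus ?case using Cons by (simp add: x)
qed simp

text \<open>\<open>run\<close> only multiplies from the left, so a right factor of the initial gate
  passes through.\<close>

lemma run_mult:
  assumes U: "unitary_mat q U" and W: "W \<in> carrier_mat (q * r) (q * r)" and X: "X \<in> carrier_mat (q * r) (q * r)"
    and steps: "\<forall>(c, W) \<in> set steps. unitary_mat (q * r) W"
  shows "run r U (W * X) steps = run r U W steps * X"
  using W steps
proof (induction steps arbitrary: W)
  case (Cons x steps)
  obtain c Y where x: "x = (c, Y)" by force
  let ?T = "call_mat U c \<otimes>\<^sub>m 1\<^sub>m r"
  have Y: "Y \<in> carrier_mat (q * r) (q * r)" using Cons.prems unitary_matD(1) by (auto simp: x)
  have T: "?T \<in> carrier_mat (q * r) (q * r)"
    using unitary_matD(1)[OF unitary_call_mat[OF U]] by simp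
  have "Y * ?T * (W * X) = Y * ?T * W * X"
    using Y T Cons.prems(1) X by (intro assoc_mult_mat[of _ "q * r" "q * r" _ "q * r" _ "q * r", symmetric]) auto
  moreover have "run r U (Y * ?T * W * X) steps = run r U (Y * ?T * W) steps * X"
    using Y T Cons.prems by (intro Cons.IH) (auto simp: x)
  ultimately show ?case by (simp add: x)
qed simp

lemma circuit_gate: "unitary_mat (q * r) W \<Longrightarrow> circuit q r 0 (\<lambda>_. W)"
  unfolding circuit_def by (intro exI[of _ W] exI[of _ "[]"]) auto

lemma circuit_call: "circuit q r 1 (\<lambda>U. call_mat U c \<otimes>\<^sub>m 1\<^sub>m r)"
  unfolding circuit_def
proof (intro exI conjI allI impI)
  show "length [(c, 1\<^sub>m (q * r) :: complex mat)] = 1" by simp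
  fix U assume U: "unitary_mat q U"
  have "call_mat U c \<otimes>\<^sub>m 1\<^sub>m r \<in> carrier_mat (q * r) (q * r)"
    using unitary_matD(1)[OF unitary_call_mat[OF U]] by simp
  thus "call_mat U c \<otimes>\<^sub>m 1\<^sub>m r = run r U (1\<^sub>m (q * r)) [(c, 1\<^sub>m (q * r))]"
    by (simp add: left_mult_one_mat[of _ "q * r" "q * r"] right_mult_one_mat[of _ "q * r" "q * r"])
qed auto

text \<open>\<open>V'\<close> is applied first. A program has one gate before its first call and one
  after each call, so the initial gate of \<open>V\<close> has to be merged into the last gate of
  \<open>V'\<close>.\<close>

lemma circuit_comp:
  assumes "circuit q r m V" "circuit q r n V'"
  shows "circuit q r (m + n) (\<lambda>U. V U * V' U)"
proof -
  obtain W\<^sub>0 steps where 1: "length steps = m" "unitary_mat (q * r) W\<^sub>0"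
     "\<forall>(c, W) \<in> set steps. unitary_mat (q * r) W" "\<And>U. unitary_mat q U \<Longrightarrow> V U = run r U W\<^sub>0 steps"
    using assms(1) by (auto simp: circuit_def)
  obtain W\<^sub>0' steps' where 2: "length steps' = n" "unitary_mat (q * r) W\<^sub>0'"
     "\<forall>(c, W) \<in> set steps'. unitary_mat (q * r) W" "\<And>U. unitary_mat q U \<Longrightarrow> V' U = run r U W\<^sub>0' steps'"
    using assms(2) by (auto simp: circuit_def)
  have "\<exists>X ss. length ss = n \<and> unitary_mat (q * r) X \<and> (\<forall>(c, W) \<in> set ss. unitary_mat (q * r) W) \<and>
     (\<forall>U. unitary_mat q U \<longrightarrow> run r U X ss = W\<^sub>0 * run r U W\<^sub>0' steps')"
  \<comment> \<open>If \<open>V'\<close> makes no call, its last gate is its initial gate.\<close>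
  proof (cases steps' rule: rev_cases)
    case Nil
    thus ?thesis using 1(2) 2(1,2)
      by (intro exI[of _ "W\<^sub>0 * W\<^sub>0'"] exI[of _ "[]"]) (auto intro: unitary_mat_mult)
  next
    case (snoc ss x)
    obtain c Y where x: "x = (c, Y)" by force
    have Y: "unitary_mat (q * r) Y" using 2(3) by (auto simp: snoc x)
    have "run r U W\<^sub>0' (ss @ [(c, W\<^sub>0 * Y)]) = W\<^sub>0 * run r U W\<^sub>0' steps'" if U: "unitary_mat q U" for U
    proof -
      let ?T = "call_mat U c \<otimes>\<^sub>m 1\<^sub>m r" and ?R = "run r U W\<^sub>0' ss"
      have T: "?T \<in> carrier_mat (q * r) (q * r)"
        using unitary_matD(1)[OF unitary_call_mat[OF U]] by simp
      have R: "?R \<in> carrier_mat (q * r) (q * r)"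
        using 2(2,3) by (intro unitary_matD(1) unitary_run[OF U]) (auto simp: snoc)
      note c = unitary_matD(1)[OF 1(2)] unitary_matD(1)[OF Y] T R
      have "W\<^sub>0 * Y * ?T = W\<^sub>0 * (Y * ?T)" using c by (intro assoc_mult_mat[of _ "q * r" "q * r" _ "q * r" _ "q * r"]) auto
      moreover have "W\<^sub>0 * (Y * ?T) * ?R = W\<^sub>0 * (Y * ?T * ?R)" using c by (intro assoc_mult_mat[of _ "q * r" "q * r" _ "q * r" _ "q * r"]) auto
      ultimately show ?thesis by (simp add: run_append snoc x)
    qed
    thus ?thesis using 1(2) 2 Y
      by (intro exI[of _ W\<^sub>0'] exI[of _ "ss @ [(c, W\<^sub>0 * Y)]"]) (auto simp: snoc intro: unitary_mat_mult)
  qed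
  then obtain X ss where 3: "length ss = n" "unitary_mat (q * r) X" "\<forall>(c, W) \<in> set ss. unitary_mat (q * r) W"
     "\<And>U. unitary_mat q U \<Longrightarrow> run r U X ss = W\<^sub>0 * run r U W\<^sub>0' steps'" by auto
  have "run r U X (ss @ steps) = V U * V' U" if U: "unitary_mat q U" for U
  proof -
    have "run r U (W\<^sub>0 * run r U W\<^sub>0' steps') steps = run r U W\<^sub>0 steps * run r U W\<^sub>0' steps'"
      by (intro run_mult[OF U unitary_matD(1)[OF 1(2)] unitary_matD(1)[OF unitary_run[OF U 2(2,3)]] 1(3)])
    thus ?thesis by (simp add: run_append 3(4)[OF U] 1(4)[OF U] 2(4)[OF U])
  qed
  thus ?thesis unfolding circuit_def using 1 2 3
    by (intro exI[of _ X] exI[of _ "ss @ steps"]) auto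
qed

lemma circuit_unitary:
  assumes "circuit q r m V" "unitary_mat q U"
  shows "unitary_mat (q * r) (V U)"
  using assms unitary_run[OF assms(2)] by (auto simp: circuit_def)

section \<open>Operations that may depend on the rows of the Hamiltonian\<close>

text \<open>Matrix families \<open>F\<close> that can be realised for an unknown \<open>H\<close>,
  with the calls they cost, on a space of dimension \<open>s\<close> whose last factor is the
  system. A column operation leaves the system index \<open>x\<close> alone and applies a unitary
  depending on row \<open>x\<close>: loading the row takes \<open>d\<close> queries of two calls
  each, and unloading it as many, hence \<open>4 * d\<close>. Unitarity is demanded for every
  function \<open>h\<close>, because the gate is selected by the contents of a register.\<close>

inductive impl :: "nat \<Rightarrow> nat \<Rightarrow> nat \<Rightarrow> nat \<Rightarrow> (complex mat \<Rightarrow> complex mat) \<Rightarrow> bool"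
  for D d s :: nat where
  impl_gate: "unitary_mat s G \<Longrightarrow> impl D d s 0 (\<lambda>_. G)"
| impl_column: "(\<And>h. unitary_mat s (G h)) \<Longrightarrow> (\<And>h. preserves s (\<lambda>i. i mod D) (G h)) \<Longrightarrow>
    impl D d s (4 * d) (\<lambda>H. ctrl_mat s (\<lambda>i. i mod D) (\<lambda>x. G (\<lambda>y. if y < D then H $$ (x, y) else 0)))"
| impl_comp: "impl D d s m F \<Longrightarrow> impl D d s n F' \<Longrightarrow> impl D d s (m + n) (\<lambda>H. F H * F' H)"

lemma impl_unitary: "impl D d s m F \<Longrightarrow> unitary_mat s (F H)"
  by (induction rule: impl.induct) (auto intro: unitary_mat_mult unitary_ctrl_mat)

text \<open>The adjoint of a column operation is again one, and products are reversed; the cost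
  stays the same.\<close>

lemma impl_adjoint: "impl D d s m F \<Longrightarrow> impl D d s m (\<lambda>H. mat_adjoint (F H))"
proof (induction rule: impl.induct)
  case (impl_gate G)
  thus ?case by (intro impl.impl_gate unitary_mat_adjoint)
next
  case (impl_column G)
  have "impl D d s (4 * d) (\<lambda>H. ctrl_mat s (\<lambda>i. i mod D)
      (\<lambda>x. mat_adjoint (G (\<lambda>y. if y < D then H $$ (x, y) else 0))))"
    using impl_column unitary_matD(1)
    by (intro impl.impl_column[of s "\<lambda>h. mat_adjoint (G h)"] unitary_mat_adjoint preserves_adjoint) auto
  moreover have "mat_adjoint (ctrl_mat s (\<lambda>i. i mod D) (\<lambda>x. G (\<lambda>y. if y < D then H $$ (x, y) else 0)))
      = ctrl_mat s (\<lambda>i. i mod D) (\<lambda>x. mat_adjoint (G (\<lambda>y. if y < D then H $$ (x, y) else 0)))" for H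
    using impl_column unitary_matD(1) by (intro mat_adjoint_ctrl_mat) auto
  ultimately show ?case by simp
next
  case (impl_comp m F n F')
  have "mat_adjoint (F H * F' H) = mat_adjoint (F' H) * mat_adjoint (F H)" for H
    using unitary_matD(1)[OF impl_unitary[OF impl_comp.hyps(1)]] unitary_matD(1)[OF impl_unitary[OF impl_comp.hyps(2)]]
    by (rule mat_adjoint_mult)
  thus ?case using impl.impl_comp[OF impl_comp.IH(2,1)] by (simp add: add.commute)
qed

text \<open>The sum of |m><m| tensor \<open>F m\<close>, the selection step of a linear combination
  of unitaries.\<close>

definition block_diag :: "nat \<Rightarrow> nat \<Rightarrow> (nat \<Rightarrow> complex mat) \<Rightarrow> complex mat" where
  "block_diag M s F = mat (M * s) (M * s)
     (\<lambda>(i, j). if i div s = j div s then F (j div s) $$ (i mod s, j mod s) else 0)"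

lemma block_diag_carrier [simp]: "block_diag M s F \<in> carrier_mat (M * s) (M * s)"
  by (simp add: block_diag_def)

lemma block_diag_dim [simp]: "dim_row (block_diag M s F) = M * s" "dim_col (block_diag M s F) = M * s"
  by (simp_all add: block_diag_def)

lemma block_diag_ctrl_mat:
  assumes "\<And>m. F m \<in> carrier_mat s s"
  shows "block_diag M s F = ctrl_mat (M * s) (\<lambda>i. i div s) (\<lambda>m. 1\<^sub>m M \<otimes>\<^sub>m F m)"
proof (rule eq_matI)
  fix i j assume "i < dim_row (ctrl_mat (M * s) (\<lambda>i. i div s) (\<lambda>m. 1\<^sub>m M \<otimes>\<^sub>m F m))"
    "j < dim_col (ctrl_mat (M * s) (\<lambda>i. i div s) (\<lambda>m. 1\<^sub>m M \<otimes>\<^sub>m F m))"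
  hence ij: "i < M * s" "j < M * s" by auto
  show "block_diag M s F $$ (i, j) = ctrl_mat (M * s) (\<lambda>i. i div s) (\<lambda>m. 1\<^sub>m M \<otimes>\<^sub>m F m) $$ (i, j)"
    using ij lt_mult_div_mod[OF ij(1)] lt_mult_div_mod[OF ij(2)]
    by (simp add: block_diag_def ctrl_mat_def tensor_mat_index[OF one_carrier_mat assms ij])
qed auto

lemma unitary_block_diag:
  assumes "\<And>m. unitary_mat s (F m)"
  shows "unitary_mat (M * s) (block_diag M s F)"
proof -
  have c: "F m \<in> carrier_mat s s" for m using assms unitary_matD(1) by blast
  show ?thesis unfolding block_diag_ctrl_mat[of F, OF c]
    by (intro unitary_ctrl_mat unitary_mat_tensor assms unitary_mat_one preserves_tensor_one_left c)
qed

lemma preserves_block_diag: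
  assumes "\<And>m. preserves s lab (F m)"
  shows "preserves (M * s) (\<lambda>i. lab (i mod s)) (block_diag M s F)"
  unfolding preserves_def
proof (intro allI impI)
  fix i j assume ij: "i < M * s" "j < M * s" "block_diag M s F $$ (i, j) \<noteq> 0"
  hence "F (j div s) $$ (i mod s, j mod s) \<noteq> 0"
    by (simp add: block_diag_def split: if_splits)
  thus "lab (i mod s) = lab (j mod s)"
    using preservesD[OF assms lt_mult_div_mod(2)[OF ij(1)] lt_mult_div_mod(2)[OF ij(2)]] by blast
qed

lemma block_diag_mult:
  assumes F: "\<And>m. F m \<in> carrier_mat s s" and G: "\<And>m. G m \<in> carrier_mat s s"
  shows "block_diag M s F * block_diag M s G = block_diag M s (\<lambda>m. F m * G m)"
proof (rule eq_matI)
  fix i j assume "i < dim_row (block_diag M s (\<lambda>m. F m * G m))" "j < dim_col (block_diag M s (\<lambda>m. F m * G m))"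
  hence ij: "i < M * s" "j < M * s" by auto
  note i' = lt_mult_div_mod[OF ij(1)] and j' = lt_mult_div_mod[OF ij(2)]
  have "(block_diag M s F * block_diag M s G) $$ (i, j)
      = (\<Sum>l<M * s. block_diag M s F $$ (i, l) * block_diag M s G $$ (l, j))"
    using ij by (intro mult_mat_index_sum) auto
  also have "\<dots> = (\<Sum>a<M. \<Sum>b<s. if a = i div s then if i div s = j div s then
      F (j div s) $$ (i mod s, b) * G (j div s) $$ (b, j mod s) else 0 else 0)"
    unfolding sum_lessThan_mult using ij
    by (intro sum.cong refl) (auto simp: block_diag_def mult_lt_mult)
  also have "\<dots> = (\<Sum>a<M. if a = i div s then \<Sum>b<s. if i div s = j div s then
      F (j div s) $$ (i mod s, b) * G (j div s) $$ (b, j mod s) else 0 else 0)"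
    by (intro sum.cong refl) simp
  also have "\<dots> = (\<Sum>b<s. if i div s = j div s then
      F (j div s) $$ (i mod s, b) * G (j div s) $$ (b, j mod s) else 0)"
    using i'(1) by simp
  also have "\<dots> = block_diag M s (\<lambda>m. F m * G m) $$ (i, j)"
    using ij mult_mat_index_sum[OF F G i'(2) j'(2)] by (simp add: block_diag_def del: index_mult_mat)
  finally show "(block_diag M s F * block_diag M s G) $$ (i, j) = block_diag M s (\<lambda>m. F m * G m) $$ (i, j)" .
qed auto

text \<open>Calls are never controlled. In branches where \<open>P\<close> fails the row is loaded
  and unloaded all the same, and the control only replaces the gate in between by the
  identity.\<close>

lemma impl_block_diag:
  assumes "impl D d s m F" and D: "D dvd s"
  shows "impl D d (M * s) m (\<lambda>H. block_diag M s (\<lambda>i. if P i then F H else 1\<^sub>m s))"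
  using assms(1)
proof (induction rule: impl.induct)
  case (impl_gate G)
  thus ?case by (intro impl.impl_gate unitary_block_diag) auto
next
  case (impl_column G)
  \<comment> \<open>Since \<open>D\<close> divides \<open>s\<close>, reading the system index is
    unaffected by the added register.\<close>
  have mm: "i mod s mod D = i mod D" for i using D by (rule mod_mod_cancel)
  have "preserves (M * s) (\<lambda>i. i mod s mod D) (block_diag M s (\<lambda>i. if P i then G h else 1\<^sub>m s))" for h
    by (rule preserves_block_diag[of s "\<lambda>i. i mod D"]) (use impl_column preserves_one in auto)
  hence "impl D d (M * s) (4 * d) (\<lambda>H. ctrl_mat (M * s) (\<lambda>i. i mod D)
     (\<lambda>x. block_diag M s (\<lambda>i. if P i then G (\<lambda>y. if y < D then H $$ (x, y) else 0) else 1\<^sub>m s)))"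
    using impl_column by (intro impl.impl_column[of "M * s"
      "\<lambda>h. block_diag M s (\<lambda>i. if P i then G h else 1\<^sub>m s)"] unitary_block_diag) (auto simp: mm)
  moreover have "ctrl_mat (M * s) (\<lambda>i. i mod D)
     (\<lambda>x. block_diag M s (\<lambda>i. if P i then G' x else 1\<^sub>m s))
     = block_diag M s (\<lambda>i. if P i then ctrl_mat s (\<lambda>i. i mod D) G' else 1\<^sub>m s)" for G'
  proof (rule eq_matI)
    fix i j assume "i < dim_row (block_diag M s (\<lambda>i. if P i then ctrl_mat s (\<lambda>i. i mod D) G' else 1\<^sub>m s))"
       "j < dim_col (block_diag M s (\<lambda>i. if P i then ctrl_mat s (\<lambda>i. i mod D) G' else 1\<^sub>m s))"
    hence ij: "i < M * s" "j < M * s" by auto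
    thus "ctrl_mat (M * s) (\<lambda>i. i mod D) (\<lambda>x. block_diag M s (\<lambda>i. if P i then G' x else 1\<^sub>m s)) $$ (i, j)
       = block_diag M s (\<lambda>i. if P i then ctrl_mat s (\<lambda>i. i mod D) G' else 1\<^sub>m s) $$ (i, j)"
      using lt_mult_div_mod[OF ij(1)] lt_mult_div_mod[OF ij(2)]
      by (simp add: ctrl_mat_def block_diag_def mm)
  qed auto
  ultimately show ?case by simp
next
  case (impl_comp m F n F')
  have "block_diag M s (\<lambda>i. if P i then F H else 1\<^sub>m s) * block_diag M s (\<lambda>i. if P i then F' H else 1\<^sub>m s)
      = block_diag M s (\<lambda>i. if P i then F H * F' H else 1\<^sub>m s)" for H
    using unitary_matD(1)[OF impl_unitary[OF impl_comp.hyps(1)]] unitary_matD(1)[OF impl_unitary[OF impl_comp.hyps(2)]]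
    by (subst block_diag_mult) (auto intro!: arg_cong[of _ _ "block_diag M s"])
  thus ?case using impl.impl_comp[OF impl_comp.IH] by simp
qed

section \<open>Access to the rows of the Hamiltonian through the black box\<close>

text \<open>The transposition of 0 and \<open>v\<close>. It writes \<open>v\<close> into an empty
  register and, being an involution, erases it again.\<close>

definition swap_zero :: "nat \<Rightarrow> nat \<Rightarrow> nat" where
  "swap_zero v x = (if x = 0 then v else if x = v then 0 else x)"

lemma swap_zero_simps [simp]:
  "swap_zero v 0 = v" "swap_zero v v = 0" "swap_zero v (swap_zero v x) = x"
  by (auto simp: swap_zero_def)

lemma swap_zero_less: "v < n \<Longrightarrow> x < n \<Longrightarrow> swap_zero v x < n"
  by (auto simp: swap_zero_def)

lemma inj_on_swap_zero: "inj_on (swap_zero v) A"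
  by (metis inj_onI swap_zero_simps(3))

text \<open>A register of dimension \<open>c\<close> stores the answers to the queries \<open>f x 0, \<dots>, f x (d - 1)\<close>;
  the bijection \<open>cont\<close> lists the possible contents, where the answer \<open>(y, v)\<close> is encoded as
  \<open>y * length vals + v\<close>.\<close>

locale query_setup =
  fixes D d g :: nat and vals :: "complex list" and s c :: nat and cont :: "nat \<Rightarrow> nat \<Rightarrow> nat"
  assumes D: "0 < D" and g: "0 < g" and vals: "distinct vals" "0 \<in> set vals"
    and s: "D dvd s" and c: "0 < c"
    and cont: "bij_betw cont {..<c} ({..<d} \<rightarrow>\<^sub>E {..<D * length vals})"
    and cont_0: "cont 0 = (\<lambda>i\<in>{..<d}. 0)"
begin

abbreviation "L \<equiv> length vals"
abbreviation "q \<equiv> query_dim D d vals g"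
abbreviation "contents \<equiv> {..<d} \<rightarrow>\<^sub>E {..<D * L}"

text \<open>Index of the query basis state with inputs \<open>x\<close> and \<open>i\<close> and all
  other query registers at zero.\<close>

definition "addr x i = (x * (d * g) + i * g) * (D * L)"
definition "reg = inv_into {..<c} cont"
definition "upd i v z = reg ((cont z)(i := swap_zero v (cont z i)))"
text \<open>Code of the answer; the position of the matrix element is unique because
  \<open>vals\<close> is distinct.\<close>

definition "obs f x i = fst (f x i) * L + (THE v. v < L \<and> vals ! v = snd (f x i))"
definition "valid H f U \<longleftrightarrow> H \<in> carrier_mat D D \<and> hermitian_mat H \<and> sparse_mat d H
  \<and> elements_mat H \<subseteq> set vals \<and> black_box d H f \<and> oracle_unitary D d vals g f U"

text \<open>Prepares the query inputs from the system register; the transposition also clears them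
  afterwards.\<close>

definition "addr_gate i = ctrl_mat (q * (c * s)) (\<lambda>j. j mod D)
   (\<lambda>x. perm_mat q (swap_zero (addr x i)) \<otimes>\<^sub>m 1\<^sub>m (c * s))"
text \<open>The label is the content of the output registers, the last factors of the query space.
  They are only read, so a state in which they hold a definite value stays intact.\<close>

definition "copy_gate i = ctrl_mat (q * (c * s)) (\<lambda>j. j div (c * s) mod (D * L))
   (\<lambda>v. 1\<^sub>m q \<otimes>\<^sub>m (perm_mat c (upd i v) \<otimes>\<^sub>m 1\<^sub>m s))"
text \<open>Reassembles a row from the stored answers. Answers past the nonzero elements have
  position \<open>x\<close> and value 0, and add nothing there.\<close>

definition "row_of \<phi> y = (\<Sum>i<d. if \<phi> i div L = y then vals ! (\<phi> i mod L) else 0)"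
definition "row_gate G = ctrl_mat (q * (c * s)) (\<lambda>j. j mod (c * s) div s)
   (\<lambda>z. 1\<^sub>m q \<otimes>\<^sub>m (1\<^sub>m c \<otimes>\<^sub>m G (row_of (cont z))))"
definition "state z w = unit_vec q 0 \<otimes>\<^sub>v (unit_vec c z \<otimes>\<^sub>v w)"

lemma L_pos: "0 < L"
  using vals(2) by (cases vals) auto

lemma reg_cont: "z < c \<Longrightarrow> reg (cont z) = z"
  unfolding reg_def using cont by (auto simp: bij_betw_def inv_into_f_f)

lemma cont_reg: "\<phi> \<in> contents \<Longrightarrow> cont (reg \<phi>) = \<phi>"
  unfolding reg_def using cont by (intro f_inv_into_f) (auto simp: bij_betw_def)

lemma reg_less: "\<phi> \<in> contents \<Longrightarrow> reg \<phi> < c"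
  unfolding reg_def using cont inv_into_into[of \<phi> cont "{..<c}"] by (auto simp: bij_betw_def)

lemma cont_in: "z < c \<Longrightarrow> cont z \<in> contents"
  using cont by (auto simp: bij_betw_def)

lemma contents_upd: "\<phi> \<in> contents \<Longrightarrow> i < d \<Longrightarrow> v < D * L \<Longrightarrow> \<phi>(i := v) \<in> contents"
  by (auto simp: PiE_iff extensional_def)

lemma contents_less: "\<phi> \<in> contents \<Longrightarrow> i < d \<Longrightarrow> \<phi> i < D * L"
  by (auto simp: PiE_iff)

lemma contents_swap: "i < d \<Longrightarrow> v < D * L \<Longrightarrow> \<phi> \<in> contents \<Longrightarrow> \<phi>(i := swap_zero v (\<phi> i)) \<in> contents"
  by (rule contents_upd[OF _ _ swap_zero_less[OF _ contents_less]])

lemma upd_less: "i < d \<Longrightarrow> v < D * L \<Longrightarrow> z < c \<Longrightarrow> upd i v z < c"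
  unfolding upd_def by (intro reg_less contents_swap cont_in)

lemma upd_reg: "\<phi> \<in> contents \<Longrightarrow> upd i v (reg \<phi>) = reg (\<phi>(i := swap_zero v (\<phi> i)))"
  by (simp add: upd_def cont_reg)

lemma upd_upd:
  assumes "i < d" "v < D * L" "z < c"
  shows "upd i v (upd i v z) = z"
proof -
  let ?\<psi> = "(cont z)(i := swap_zero v (cont z i))"
  have "?\<psi> \<in> contents"
    using assms by (intro contents_swap cont_in)
  hence "upd i v (reg ?\<psi>) = reg (cont z)" by (simp add: upd_reg)
  thus ?thesis using assms(3) by (simp add: upd_def reg_cont)
qed

lemma addr_less: "x < D \<Longrightarrow> i < d \<Longrightarrow> addr x i < q"
proof -
  assume "x < D" "i < d"
  moreover from this have "i * g < d * g" using g by simp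
  ultimately have "x * (d * g) + i * g < D * (d * g)" by (intro mult_lt_mult)
  hence "addr x i < D * (d * g) * (D * L)"
    unfolding addr_def using D L_pos by (intro mult_strict_right_mono) auto
  thus ?thesis by (simp only: query_dim_def mult.assoc)
qed

lemma q_pos: "0 < d \<Longrightarrow> 0 < q"
  using D g L_pos by (simp add: query_dim_def)

lemma unitary_addr_gate:
  assumes i: "i < d"
  shows "unitary_mat (q * (c * s)) (addr_gate i)"
  unfolding addr_gate_def
proof (rule unitary_ctrl_mat)
  fix j
  have x: "j mod D < D" using D by simp
  show "unitary_mat (q * (c * s)) (perm_mat q (swap_zero (addr (j mod D) i)) \<otimes>\<^sub>m 1\<^sub>m (c * s))"
    by (intro unitary_mat_tensor unitary_mat_one unitary_perm_mat inj_on_swap_zero swap_zero_less addr_less x i)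
  have "preserves (q * (c * s)) (\<lambda>j. j mod (c * s) mod D) (perm_mat q (swap_zero (addr (j mod D) i)) \<otimes>\<^sub>m 1\<^sub>m (c * s))"
    by (rule preserves_tensor_one_right[where f = "\<lambda>j. j mod D"]) simp
  thus "preserves (q * (c * s)) (\<lambda>j. j mod D) (perm_mat q (swap_zero (addr (j mod D) i)) \<otimes>\<^sub>m 1\<^sub>m (c * s))"
    using s by (simp add: mod_mod_cancel)
qed

lemma unitary_copy_gate:
  assumes i: "i < d"
  shows "unitary_mat (q * (c * s)) (copy_gate i)"
  unfolding copy_gate_def
proof (rule unitary_ctrl_mat)
  fix j
  have v: "j div (c * s) mod (D * L) < D * L" using D L_pos by simp
  have "inj_on (upd i (j div (c * s) mod (D * L))) {..<c}"
    by (rule inj_on_inverseI[where g = "upd i (j div (c * s) mod (D * L))"]) (auto intro: upd_upd i v)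
  thus "unitary_mat (q * (c * s)) (1\<^sub>m q \<otimes>\<^sub>m (perm_mat c (upd i (j div (c * s) mod (D * L))) \<otimes>\<^sub>m 1\<^sub>m s))"
    by (intro unitary_mat_tensor unitary_mat_one unitary_perm_mat upd_less i v)
  show "preserves (q * (c * s)) (\<lambda>j. j div (c * s) mod (D * L))
      (1\<^sub>m q \<otimes>\<^sub>m (perm_mat c (upd i (j div (c * s) mod (D * L))) \<otimes>\<^sub>m 1\<^sub>m s))"
    by (rule preserves_tensor_one_left[where f = "\<lambda>j. j mod (D * L)"]) simp
qed

lemma unitary_row_gate:
  assumes G: "\<And>h. unitary_mat s (G h)"
  shows "unitary_mat (q * (c * s)) (row_gate G)"
  unfolding row_gate_def
proof (rule unitary_ctrl_mat)
  fix j
  have Gc: "G h \<in> carrier_mat s s" for h by (rule unitary_matD(1)[OF G])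
  show "unitary_mat (q * (c * s)) (1\<^sub>m q \<otimes>\<^sub>m (1\<^sub>m c \<otimes>\<^sub>m G (row_of (cont (j mod (c * s) div s)))))"
    by (intro unitary_mat_tensor unitary_mat_one G)
  show "preserves (q * (c * s)) (\<lambda>j. j mod (c * s) div s) (1\<^sub>m q \<otimes>\<^sub>m (1\<^sub>m c \<otimes>\<^sub>m G (row_of (cont (j mod (c * s) div s)))))"
    by (rule preserves_tensor_right[where lab = "\<lambda>j. j div s"])
      (auto intro!: preserves_tensor_one_left[where f = "\<lambda>j. j"] tensor_mat_carrier Gc)
qed

text \<open>The output registers end in one definite basis state, the unknown vector being confined
  to the input and scratch registers; the answer can therefore be copied as classical data.\<close>

lemma valid_answer:
  assumes v: "valid H f U" and x: "x < D" and i: "i < d"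
  shows "fst (f x i) < D" "obs f x i < D * L" "obs f x i div L = fst (f x i)" "vals ! (obs f x i mod L) = snd (f x i)"
    and "\<exists>\<phi> \<in> carrier_vec (D * d * g). U *\<^sub>v unit_vec q (addr x i) = \<phi> \<otimes>\<^sub>v unit_vec (D * L) (obs f x i)"
proof -
  have HD: "H \<in> carrier_mat D D" and bb: "black_box d H f" and orc: "oracle_unitary D d vals g f U"
    using v by (auto simp: valid_def)
  from bb x HD obtain ys where ys: "set ys = {y. y < D \<and> H $$ (y, x) \<noteq> 0}"
    "\<forall>i<d. f x i = (if i < length ys then (ys ! i, H $$ (x, ys ! i)) else (x, 0))"
    by (auto simp: black_box_def)
  show fD: "fst (f x i) < D"
    using ys i x nth_mem[of i ys] by auto
  from orc x i obtain \<phi> u where \<phi>: "\<phi> \<in> carrier_vec (D * d * g)" and u: "u < L" "vals ! u = snd (f x i)"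
    and eq: "U *\<^sub>v ((unit_vec D x \<otimes>\<^sub>v unit_vec d i \<otimes>\<^sub>v unit_vec g 0) \<otimes>\<^sub>v (unit_vec D 0 \<otimes>\<^sub>v unit_vec L 0))
          = \<phi> \<otimes>\<^sub>v (unit_vec D (fst (f x i)) \<otimes>\<^sub>v unit_vec L u)"
    unfolding oracle_unitary_def by blast
  have "(THE v. v < L \<and> vals ! v = snd (f x i)) = u"
  proof (rule the_equality)
    fix v assume "v < L \<and> vals ! v = snd (f x i)"
    thus "v = u" using u nth_eq_iff_index_eq[OF vals(1), of v u] by simp
  qed (use u in simp)
  hence obs: "obs f x i = fst (f x i) * L + u" by (simp add: obs_def)
  show "obs f x i < D * L" unfolding obs using fD u(1) by (rule mult_lt_mult)
  show "obs f x i div L = fst (f x i)" "vals ! (obs f x i mod L) = snd (f x i)"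
    unfolding obs using u by auto
  have "i * g < d * g" using i g by simp
  hence "(unit_vec D x \<otimes>\<^sub>v unit_vec d i \<otimes>\<^sub>v unit_vec g 0) \<otimes>\<^sub>v (unit_vec D 0 \<otimes>\<^sub>v unit_vec L 0)
      = unit_vec q (addr x i)"
    using D g L_pos x i mult_lt_mult[of x D "i * g" "d * g"]
    by (simp add: tensor_unit_vec query_dim_def addr_def mult.assoc)
  moreover have "unit_vec D (fst (f x i)) \<otimes>\<^sub>v unit_vec L u = unit_vec (D * L) (obs f x i)"
    unfolding obs using fD u(1) by (rule tensor_unit_vec)
  ultimately show "\<exists>\<phi> \<in> carrier_vec (D * d * g). U *\<^sub>v unit_vec q (addr x i) = \<phi> \<otimes>\<^sub>v unit_vec (D * L) (obs f x i)"
    using \<phi> eq by auto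
qed

text \<open>The black box lists the nonzero positions of column \<open>x\<close>; for hermitian
  \<open>H\<close> these are the nonzero positions of row \<open>x\<close>, and distinctness makes
  each element occur once in the sum.\<close>

lemma row_of_obs:
  assumes v: "valid H f U" and x: "x < D" and \<phi>: "\<And>i. i < d \<Longrightarrow> \<phi> i = obs f x i"
  shows "row_of \<phi> = (\<lambda>y. if y < D then H $$ (x, y) else 0)"
proof
  fix y
  have HD: "H \<in> carrier_mat D D" and herm: "hermitian_mat H" and bb: "black_box d H f"
    using v by (auto simp: valid_def)
  from bb x HD obtain ys where ys: "distinct ys" "set ys = {y. y < D \<and> H $$ (y, x) \<noteq> 0}" "length ys \<le> d"
    "\<forall>i<d. f x i = (if i < length ys then (ys ! i, H $$ (x, ys ! i)) else (x, 0))"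
    by (auto simp: black_box_def)
  have "row_of \<phi> y = (\<Sum>i<d. if fst (f x i) = y then snd (f x i) else 0)"
    unfolding row_of_def by (intro sum.cong refl) (simp add: \<phi> valid_answer[OF v x])
  also have "\<dots> = (\<Sum>i<d. if i < length ys \<and> ys ! i = y then H $$ (x, y) else 0)"
    using ys(4) by (intro sum.cong refl) auto
  also have "\<dots> = (if y \<in> set ys then H $$ (x, y) else 0)"
  proof (cases "y \<in> set ys")
    case True
    then obtain k where k: "k < length ys" "ys ! k = y" by (auto simp: in_set_conv_nth)
    have "i < length ys \<and> ys ! i = y \<longleftrightarrow> i = k" for i
      using k ys(1) by (auto simp: nth_eq_iff_index_eq)
    thus ?thesis using True k(1) ys(3) by simp
  next
    case False
    hence "\<not> (i < length ys \<and> ys ! i = y)" for i by (metis nth_mem)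
    hence "(\<Sum>i<d. if i < length ys \<and> ys ! i = y then H $$ (x, y) else 0) = 0"
      by (intro sum.neutral ballI if_not_P)
    thus ?thesis using False by simp
  qed
  also have "\<dots> = (if y < D then H $$ (x, y) else 0)"
  proof -
    have "H $$ (x, y) = 0" if "y < D" "y \<notin> set ys"
    proof -
      have "H $$ (y, x) = 0" using that ys(2) by blast
      thus ?thesis unfolding hermitian_index[OF herm HD x that(1), symmetric] by simp
    qed
    moreover have "y < D" if "y \<in> set ys" using that ys(2) by blast
    ultimately show ?thesis by (cases "y \<in> set ys"; cases "y < D") simp_all
  qed
  finally show "row_of \<phi> y = (if y < D then H $$ (x, y) else 0)" .
qed

section \<open>Loading and unloading a row\<close>

text \<open>Address, query, copy, query undone, address undone. Undoing the call removes the vector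
  it left behind, which depends on \<open>x\<close> and would otherwise stay entangled with the
  system.\<close>

definition "load i U = addr_gate i * ((call_mat U Call_U_dagger \<otimes>\<^sub>m 1\<^sub>m (c * s)) *
   (copy_gate i * ((call_mat U Call_U \<otimes>\<^sub>m 1\<^sub>m (c * s)) * addr_gate i)))"

lemma circuit_load:
  assumes "i < d"
  shows "circuit q (c * s) 2 (load i)"
proof -
  have "circuit q (c * s) (0 + (1 + (0 + (1 + 0)))) (load i)"
    unfolding load_def
    by (intro circuit_comp circuit_gate circuit_call unitary_addr_gate unitary_copy_gate assms)
  thus ?thesis by (simp add: numeral_2_eq_2)
qed

lemma valid_unitary: "valid H f U \<Longrightarrow> unitary_mat q U"
  by (simp add: valid_def oracle_unitary_def)

lemma supported_mod_D:
  assumes "u \<in> carrier_vec m" "w \<in> carrier_vec n" "supported (\<lambda>j. j mod D) x w" "D dvd n"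
  shows "supported (\<lambda>j. j mod D) x (u \<otimes>\<^sub>v w)"
  using supported_tensor_right[OF assms(1-3)] assms(4) by (simp add: mod_mod_cancel)

lemma state_carrier: "w \<in> carrier_vec s \<Longrightarrow> state z w \<in> carrier_vec (q * (c * s))"
  by (simp add: state_def)

lemma addr_gate_mult:
  assumes i: "i < d" and x: "x < D" and z: "z < q" and u: "u \<in> carrier_vec (c * s)" "supported (\<lambda>j. j mod D) x u"
  shows "addr_gate i *\<^sub>v (unit_vec q z \<otimes>\<^sub>v u) = unit_vec q (swap_zero (addr x i) z) \<otimes>\<^sub>v u"
proof -
  let ?P = "perm_mat q (swap_zero (addr x i))"
  have "addr_gate i *\<^sub>v (unit_vec q z \<otimes>\<^sub>v u) = (?P \<otimes>\<^sub>m 1\<^sub>m (c * s)) *\<^sub>v (unit_vec q z \<otimes>\<^sub>v u)"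
    unfolding addr_gate_def
    by (rule ctrl_mat_mult_vec[OF _ supported_mod_D[OF unit_vec_carrier u dvd_mult[OF s]]]) (use u in auto)
  also have "\<dots> = (?P *\<^sub>v unit_vec q z) \<otimes>\<^sub>v (1\<^sub>m (c * s) *\<^sub>v u)"
    by (rule tensor_mat_mult_vec[OF perm_mat_carrier one_carrier_mat unit_vec_carrier u(1)])
  also have "?P *\<^sub>v unit_vec q z = unit_vec q (swap_zero (addr x i) z)"
    by (intro perm_mat_mult_unit_vec z swap_zero_less addr_less x i)
  finally show ?thesis using u by simp
qed

lemma load_state:
  assumes v: "valid H f U" and x: "x < D" and i: "i < d" and z: "z < c"
    and w: "w \<in> carrier_vec s" "supported (\<lambda>j. j mod D) x w"
  shows "load i U *\<^sub>v state z w = state (upd i (obs f x i) z) w"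
proof -
  note U = unitary_matD[OF valid_unitary[OF v]]
  obtain \<phi> where \<phi>: "\<phi> \<in> carrier_vec (D * d * g)"
    and eq: "U *\<^sub>v unit_vec q (addr x i) = \<phi> \<otimes>\<^sub>v unit_vec (D * L) (obs f x i)"
    using valid_answer(5)[OF v x i] by blast
  let ?o = "obs f x i" let ?z' = "upd i ?o z" let ?N = "q * (c * s)"
  let ?e = "\<phi> \<otimes>\<^sub>v unit_vec (D * L) ?o"
  let ?u = "\<lambda>z. unit_vec c z \<otimes>\<^sub>v w"
  have o: "?o < D * L" by (rule valid_answer(2)[OF v x i])
  have q0: "0 < q" using q_pos i by auto
  have z': "?z' < c" by (rule upd_less[OF i o z])
  have u: "?u z \<in> carrier_vec (c * s)" "supported (\<lambda>j. j mod D) x (?u z)" for z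
    using w by (auto intro: supported_mod_D[OF unit_vec_carrier w s])
  have e: "?e \<in> carrier_vec q" unfolding query_dim_def using \<phi> by simp
  have 1: "addr_gate i *\<^sub>v state z w = unit_vec q (addr x i) \<otimes>\<^sub>v ?u z"
    unfolding state_def using addr_gate_mult[OF i x q0 u] by simp
  have 2: "(call_mat U Call_U \<otimes>\<^sub>m 1\<^sub>m (c * s)) *\<^sub>v (unit_vec q (addr x i) \<otimes>\<^sub>v ?u z) = ?e \<otimes>\<^sub>v ?u z"
    using tensor_mat_mult_vec[OF U(1) one_carrier_mat unit_vec_carrier u(1)] u(1) by (simp add: eq)
  have 3: "copy_gate i *\<^sub>v (?e \<otimes>\<^sub>v ?u z) = ?e \<otimes>\<^sub>v ?u ?z'"
  proof -
    let ?Q = "perm_mat c (upd i ?o) \<otimes>\<^sub>m 1\<^sub>m s"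
    have "supported (\<lambda>j. j mod (D * L)) ?o ?e"
      using supported_tensor_right[OF \<phi>, of "unit_vec (D * L) ?o" "D * L" "\<lambda>j. j" ?o]
        supported_unit_vec[of "\<lambda>j. j" ?o "D * L"] by simp
    hence "supported (\<lambda>j. j div (c * s) mod (D * L)) ?o (?e \<otimes>\<^sub>v ?u z)"
      by (rule supported_tensor_left[OF e u(1)])
    hence "copy_gate i *\<^sub>v (?e \<otimes>\<^sub>v ?u z) = (1\<^sub>m q \<otimes>\<^sub>m ?Q) *\<^sub>v (?e \<otimes>\<^sub>v ?u z)"
      unfolding copy_gate_def using e u(1) by (intro ctrl_mat_mult_vec) auto
    also have "\<dots> = (1\<^sub>m q *\<^sub>v ?e) \<otimes>\<^sub>v (?Q *\<^sub>v ?u z)"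
      by (rule tensor_mat_mult_vec[OF one_carrier_mat tensor_mat_carrier[OF perm_mat_carrier one_carrier_mat] e u(1)])
    also have "?Q *\<^sub>v ?u z = (perm_mat c (upd i ?o) *\<^sub>v unit_vec c z) \<otimes>\<^sub>v (1\<^sub>m s *\<^sub>v w)"
      by (rule tensor_mat_mult_vec[OF perm_mat_carrier one_carrier_mat unit_vec_carrier w(1)])
    also have "perm_mat c (upd i ?o) *\<^sub>v unit_vec c z = unit_vec c ?z'"
      by (rule perm_mat_mult_unit_vec) (fact z z')+
    finally show ?thesis using e w(1) by simp
  qed
  \<comment> \<open>Copying left the query part exactly as \<open>U\<close> produced it, so the
    adjoint returns it to the address state.\<close>
  have 4: "(call_mat U Call_U_dagger \<otimes>\<^sub>m 1\<^sub>m (c * s)) *\<^sub>v (?e \<otimes>\<^sub>v ?u ?z') = unit_vec q (addr x i) \<otimes>\<^sub>v ?u ?z'"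
  proof -
    have "mat_adjoint U *\<^sub>v ?e = (mat_adjoint U * U) *\<^sub>v unit_vec q (addr x i)"
      unfolding eq[symmetric] using U(1) by (intro assoc_mult_mat_vec[symmetric]) auto
    hence "mat_adjoint U *\<^sub>v ?e = unit_vec q (addr x i)" by (simp add: U(2))
    thus ?thesis
      using tensor_mat_mult_vec[OF mat_adjoint_carrier[OF U(1)] one_carrier_mat e u(1)] u(1) by simp
  qed
  have 5: "addr_gate i *\<^sub>v (unit_vec q (addr x i) \<otimes>\<^sub>v ?u ?z') = state ?z' w"
    unfolding state_def using addr_gate_mult[OF i x addr_less[OF x i] u] by simp
  have cA: "addr_gate i \<in> carrier_mat ?N ?N" "copy_gate i \<in> carrier_mat ?N ?N"
    by (simp_all add: addr_gate_def copy_gate_def)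
  have cU: "call_mat U k \<otimes>\<^sub>m 1\<^sub>m (c * s) \<in> carrier_mat ?N ?N" for k
    using U(1) by (cases k) simp_all
  have assoc: "(A * B) *\<^sub>v y = A *\<^sub>v (B *\<^sub>v y)"
    if "A \<in> carrier_mat ?N ?N" "B \<in> carrier_mat ?N ?N" "y \<in> carrier_vec ?N" for A B :: "complex mat" and y
    using that by (rule assoc_mult_mat_vec)
  show ?thesis unfolding load_def
    by (simp only: assoc[OF cA(1) mult_sq_carrier[OF cU mult_sq_carrier[OF cA(2) mult_sq_carrier[OF cU cA(1)]]] state_carrier[OF w(1)]]
      assoc[OF cU mult_sq_carrier[OF cA(2) mult_sq_carrier[OF cU cA(1)]] state_carrier[OF w(1)]]
      assoc[OF cA(2) mult_sq_carrier[OF cU cA(1)] state_carrier[OF w(1)]]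
      assoc[OF cU cA(1) state_carrier[OF w(1)]] 1 2 3 4 5)
qed

fun loads :: "nat \<Rightarrow> complex mat \<Rightarrow> complex mat" where
  "loads 0 U = 1\<^sub>m (q * (c * s))"
| "loads (Suc k) U = load k U * loads k U"

lemma circuit_loads: "k \<le> d \<Longrightarrow> circuit q (c * s) (2 * k) (loads k)"
proof (induction k)
  case 0
  have "loads 0 = (\<lambda>_. 1\<^sub>m (q * (c * s)))" by auto
  thus ?case using circuit_gate[of q "c * s" "1\<^sub>m (q * (c * s))"] by simp
next
  case (Suc k)
  have "loads (Suc k) = (\<lambda>U. load k U * loads k U)" by auto
  thus ?case using circuit_comp[OF circuit_load Suc.IH, of k] Suc.prems by simp
qed

text \<open>Stated for arbitrary contents so as to cover both passes: from zeros the transpositions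
  write the answers, and from the answers they restore the zeros. The second conjunct keeps the
  contents encodable along the induction.\<close>

lemma loads_state:
  assumes v: "valid H f U" and x: "x < D" and \<phi>: "\<phi> \<in> contents"
    and w: "w \<in> carrier_vec s" "supported (\<lambda>j. j mod D) x w"
  shows "k \<le> d \<Longrightarrow> loads k U *\<^sub>v state (reg \<phi>) w
      = state (reg (\<lambda>i. if i < k then swap_zero (obs f x i) (\<phi> i) else \<phi> i)) w
    \<and> (\<lambda>i. if i < k then swap_zero (obs f x i) (\<phi> i) else \<phi> i) \<in> contents"
proof (induction k)
  case 0
  thus ?case using \<phi> state_carrier[OF w(1)] by simp
next
  case (Suc k)
  let ?\<psi> = "\<lambda>k i. if i < k then swap_zero (obs f x i) (\<phi> i) else \<phi> i"
  have k: "k < d" using Suc.prems by simp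
  have IH: "loads k U *\<^sub>v state (reg \<phi>) w = state (reg (?\<psi> k)) w" "?\<psi> k \<in> contents"
    using Suc by auto
  have upd: "(?\<psi> k)(k := swap_zero (obs f x k) (?\<psi> k k)) = ?\<psi> (Suc k)"
    by (auto simp: less_Suc_eq)
  note o = valid_answer(2)[OF v x k]
  have "(?\<psi> k)(k := swap_zero (obs f x k) (?\<psi> k k)) \<in> contents"
    by (rule contents_swap[OF k o IH(2)])
  hence in': "?\<psi> (Suc k) \<in> contents" unfolding upd .
  have cl: "load k U \<in> carrier_mat (q * (c * s)) (q * (c * s))" "loads k U \<in> carrier_mat (q * (c * s)) (q * (c * s))"
    using circuit_unitary[OF circuit_load[OF k] valid_unitary[OF v]]
      circuit_unitary[OF circuit_loads valid_unitary[OF v]] k unitary_matD(1) by auto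
  have "loads (Suc k) U *\<^sub>v state (reg \<phi>) w = load k U *\<^sub>v (loads k U *\<^sub>v state (reg \<phi>) w)"
    using cl state_carrier[OF w(1)] by (simp add: assoc_mult_mat_vec[of _ "q * (c * s)" "q * (c * s)" _ "q * (c * s)"])
  also have "\<dots> = state (upd k (obs f x k) (reg (?\<psi> k))) w"
    unfolding IH(1) by (intro load_state[OF v x k _ w] reg_less IH(2))
  also have "upd k (obs f x k) (reg (?\<psi> k)) = reg (?\<psi> (Suc k))"
    unfolding upd_reg[OF IH(2)] upd ..
  finally show ?case using in' by blast
qed

lemma embed_mat_state:
  assumes w: "w \<in> carrier_vec s" and d: "0 < d"
  shows "embed_mat (q * (c * s)) s *\<^sub>v w = state 0 w"
proof -
  have "embed_mat (q * (c * s)) (c * s) * embed_mat (c * s) s = embed_mat (q * (c * s)) s"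
    using c q_pos[OF d] by (intro embed_mat_comp) auto
  moreover have "(embed_mat (q * (c * s)) (c * s) * embed_mat (c * s) s) *\<^sub>v w
      = embed_mat (q * (c * s)) (c * s) *\<^sub>v (embed_mat (c * s) s *\<^sub>v w)"
    by (rule assoc_mult_mat_vec[OF embed_mat_carrier embed_mat_carrier w])
  moreover have "embed_mat (c * s) s *\<^sub>v w = unit_vec c 0 \<otimes>\<^sub>v w" by (rule embed_mat_tensor[OF w c])
  moreover have "embed_mat (q * (c * s)) (c * s) *\<^sub>v (unit_vec c 0 \<otimes>\<^sub>v w) = state 0 w"
    unfolding state_def using w q_pos[OF d] by (intro embed_mat_tensor) auto
  ultimately show ?thesis by simp
qed

text \<open>Load, apply the gate selected by the contents, load again. As \<open>G\<close> preserves
  the system index, the second pass meets the same answers and clears the register.\<close>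

lemma column_state:
  assumes v: "valid H f U" and x: "x < D" and G: "\<And>h. unitary_mat s (G h)" "\<And>h. preserves s (\<lambda>i. i mod D) (G h)"
    and w: "w \<in> carrier_vec s" "supported (\<lambda>j. j mod D) x w"
  shows "(loads d U * (row_gate G * loads d U)) *\<^sub>v state 0 w
    = state 0 (G (\<lambda>y. if y < D then H $$ (x, y) else 0) *\<^sub>v w)"
proof -
  let ?h = "\<lambda>y. if y < D then H $$ (x, y) else 0" and ?N = "q * (c * s)"
  let ?z = "\<lambda>i\<in>{..<d}. 0 :: nat"
  define ob where "ob = (\<lambda>i\<in>{..<d}. obs f x i)"
  have Gc: "G h \<in> carrier_mat s s" for h by (rule unitary_matD(1)[OF G(1)])
  have z: "?z \<in> contents" "reg ?z = 0" using cont_in[OF c] reg_cont[OF c] by (simp_all add: cont_0)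
  have e1: "(\<lambda>i. if i < d then swap_zero (obs f x i) (?z i) else ?z i) = ob"
    and e2: "(\<lambda>i. if i < d then swap_zero (obs f x i) (ob i) else ob i) = ?z"
    by (auto simp: restrict_def ob_def)
  have 1: "loads d U *\<^sub>v state 0 w = state (reg ob) w" and o: "ob \<in> contents"
    using loads_state[OF v x z(1) w order_refl] unfolding e1 z(2) by auto
  have Gw: "G ?h *\<^sub>v w \<in> carrier_vec s" "supported (\<lambda>j. j mod D) x (G ?h *\<^sub>v w)"
    using Gc w G(2) by (auto intro: supported_mult_vec)
  have 2: "row_gate G *\<^sub>v state (reg ob) w = state (reg ob) (G ?h *\<^sub>v w)"
  proof -
    have row: "row_of (cont (reg ob)) = ?h"
      unfolding cont_reg[OF o] by (rule row_of_obs[OF v x]) (simp add: ob_def)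
    have "supported (\<lambda>i. i div s) (reg ob) (unit_vec c (reg ob) \<otimes>\<^sub>v w)"
      using supported_tensor_left[OF unit_vec_carrier w(1), of "\<lambda>i. i" "reg ob"]
        supported_unit_vec[of "\<lambda>i. i" "reg ob" c] by simp
    hence "supported (\<lambda>j. j mod (c * s) div s) (reg ob) (state (reg ob) w)"
      unfolding state_def using w(1)
        supported_tensor_right[of "unit_vec q 0" q "unit_vec c (reg ob) \<otimes>\<^sub>v w" "c * s" "\<lambda>i. i div s" "reg ob"]
      by simp
    hence "row_gate G *\<^sub>v state (reg ob) w = (1\<^sub>m q \<otimes>\<^sub>m (1\<^sub>m c \<otimes>\<^sub>m G (row_of (cont (reg ob))))) *\<^sub>v state (reg ob) w"
      unfolding row_gate_def using Gc by (intro ctrl_mat_mult_vec state_carrier w) auto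
    also have "\<dots> = (1\<^sub>m q *\<^sub>v unit_vec q 0) \<otimes>\<^sub>v ((1\<^sub>m c \<otimes>\<^sub>m G ?h) *\<^sub>v (unit_vec c (reg ob) \<otimes>\<^sub>v w))"
      unfolding row state_def
      by (rule tensor_mat_mult_vec[OF one_carrier_mat tensor_mat_carrier[OF one_carrier_mat Gc]
            unit_vec_carrier tensor_vec_carrier[OF unit_vec_carrier w(1)]])
    also have "(1\<^sub>m c \<otimes>\<^sub>m G ?h) *\<^sub>v (unit_vec c (reg ob) \<otimes>\<^sub>v w) = (1\<^sub>m c *\<^sub>v unit_vec c (reg ob)) \<otimes>\<^sub>v (G ?h *\<^sub>v w)"
      by (rule tensor_mat_mult_vec[OF one_carrier_mat Gc unit_vec_carrier w(1)])
    finally show ?thesis by (simp add: state_def)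
  qed
  have 3: "loads d U *\<^sub>v state (reg ob) (G ?h *\<^sub>v w) = state 0 (G ?h *\<^sub>v w)"
    using loads_state[OF v x o Gw order_refl] unfolding e2 z(2) by auto
  have cl: "loads d U \<in> carrier_mat ?N ?N" "row_gate G \<in> carrier_mat ?N ?N"
    using circuit_unitary[OF circuit_loads valid_unitary[OF v], of d] unitary_matD(1)
    by (auto simp: row_gate_def)
  note sw = state_carrier[OF w(1)]
  have "(loads d U * (row_gate G * loads d U)) *\<^sub>v state 0 w
      = loads d U *\<^sub>v ((row_gate G * loads d U) *\<^sub>v state 0 w)"
    by (rule assoc_mult_mat_vec[OF cl(1) mult_sq_carrier[OF cl(2,1)] sw])
  also have "(row_gate G * loads d U) *\<^sub>v state 0 w = row_gate G *\<^sub>v (loads d U *\<^sub>v state 0 w)"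
    by (rule assoc_mult_mat_vec[OF cl(2,1) sw])
  finally show ?thesis unfolding 1 2 3 .
qed

text \<open>The intertwining relation says that, started with query and loading registers at zero,
  the circuit acts as \<open>F H\<close> and returns them to zero. It is closed under products, and
  for a column operation it is checked on basis vectors, which have a definite system index. The
  circuit is chosen before \<open>H\<close>.\<close>

lemma impl_sound:
  assumes "impl D d s m F" and d: "0 < d"
  shows "\<exists>V. circuit q (c * s) m V \<and> (\<forall>H f U. valid H f U \<longrightarrow>
     V U * embed_mat (q * (c * s)) s = embed_mat (q * (c * s)) s * F H)"
  using assms(1)
proof (induction rule: impl.induct)
  case (impl_gate G)
  let ?V = "1\<^sub>m q \<otimes>\<^sub>m (1\<^sub>m c \<otimes>\<^sub>m G)"
  have Gc: "G \<in> carrier_mat s s" by (rule unitary_matD(1)[OF impl_gate])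
  have Vc: "?V \<in> carrier_mat (q * (c * s)) (q * (c * s))" using Gc by simp
  have "?V * embed_mat (q * (c * s)) s = embed_mat (q * (c * s)) s * G"
  proof (rule mat_eqI_unit_vec[of _ "q * (c * s)" s])
    fix j assume j: "j < s"
    have w: "unit_vec s j \<in> carrier_vec s" "G *\<^sub>v unit_vec s j \<in> carrier_vec s" using Gc by auto
    have "(?V * embed_mat (q * (c * s)) s) *\<^sub>v unit_vec s j = ?V *\<^sub>v state 0 (unit_vec s j)"
      unfolding embed_mat_state[OF w(1) d, symmetric] by (rule assoc_mult_mat_vec[OF Vc embed_mat_carrier w(1)])
    also have "\<dots> = (1\<^sub>m q *\<^sub>v unit_vec q 0) \<otimes>\<^sub>v ((1\<^sub>m c \<otimes>\<^sub>m G) *\<^sub>v (unit_vec c 0 \<otimes>\<^sub>v unit_vec s j))"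
      unfolding state_def
      by (rule tensor_mat_mult_vec[OF one_carrier_mat tensor_mat_carrier[OF one_carrier_mat Gc]
            unit_vec_carrier tensor_vec_carrier[OF unit_vec_carrier w(1)]])
    also have "(1\<^sub>m c \<otimes>\<^sub>m G) *\<^sub>v (unit_vec c 0 \<otimes>\<^sub>v unit_vec s j) = (1\<^sub>m c *\<^sub>v unit_vec c 0) \<otimes>\<^sub>v (G *\<^sub>v unit_vec s j)"
      by (rule tensor_mat_mult_vec[OF one_carrier_mat Gc unit_vec_carrier w(1)])
    also have "(1\<^sub>m q *\<^sub>v unit_vec q 0) \<otimes>\<^sub>v \<dots> = state 0 (G *\<^sub>v unit_vec s j)" by (simp add: state_def)
    also have "\<dots> = (embed_mat (q * (c * s)) s * G) *\<^sub>v unit_vec s j"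
      unfolding embed_mat_state[OF w(2) d, symmetric] by (rule assoc_mult_mat_vec[OF embed_mat_carrier Gc w(1), symmetric])
    finally show "(?V * embed_mat (q * (c * s)) s) *\<^sub>v unit_vec s j = (embed_mat (q * (c * s)) s * G) *\<^sub>v unit_vec s j" .
  qed (use Vc Gc in \<open>auto intro: mult_carrier_mat[OF _ embed_mat_carrier] mult_carrier_mat[OF embed_mat_carrier]\<close>)
  moreover have "circuit q (c * s) 0 (\<lambda>_. ?V)"
    by (intro circuit_gate unitary_mat_tensor unitary_mat_one impl_gate)
  ultimately show ?case by (intro exI[of _ "\<lambda>_. ?V"] conjI allI impI)
next
  case (impl_column G)
  let ?V = "\<lambda>U. loads d U * (row_gate G * loads d U)" and ?N = "q * (c * s)"
  let ?F = "\<lambda>H. ctrl_mat s (\<lambda>i. i mod D) (\<lambda>x. G (\<lambda>y. if y < D then H $$ (x, y) else 0))"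
  have "circuit q (c * s) (2 * d + (0 + 2 * d)) ?V"
    by (intro circuit_comp circuit_loads circuit_gate unitary_row_gate impl_column order_refl)
  moreover have "2 * d + (0 + 2 * d) = 4 * d" by simp
  ultimately have circ: "circuit q (c * s) (4 * d) ?V" by (simp only:)
  have "?V U * embed_mat ?N s = embed_mat ?N s * ?F H" if v: "valid H f U" for H f U
  proof (rule mat_eqI_unit_vec[of _ ?N s])
    have Vc: "?V U \<in> carrier_mat ?N ?N"
      using circuit_unitary[OF circ valid_unitary[OF v]] by (rule unitary_matD(1))
    show "?V U * embed_mat ?N s \<in> carrier_mat ?N s" by (rule mult_carrier_mat[OF Vc embed_mat_carrier])
    show "embed_mat ?N s * ?F H \<in> carrier_mat ?N s" by (rule mult_carrier_mat[OF embed_mat_carrier ctrl_mat_carrier])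
    fix j assume j: "j < s"
    let ?w = "unit_vec s j" let ?x = "j mod D"
    have x: "?x < D" using D by simp
    have w: "?w \<in> carrier_vec s" "supported (\<lambda>j. j mod D) ?x ?w" by (auto intro: supported_unit_vec[of "\<lambda>j. j mod D"])
    have Fw: "?F H *\<^sub>v ?w \<in> carrier_vec s" by simp
    have "(?V U * embed_mat ?N s) *\<^sub>v ?w = ?V U *\<^sub>v state 0 ?w"
      unfolding embed_mat_state[OF w(1) d, symmetric] by (rule assoc_mult_mat_vec[OF Vc embed_mat_carrier w(1)])
    also have "\<dots> = state 0 (G (\<lambda>y. if y < D then H $$ (?x, y) else 0) *\<^sub>v ?w)"
      by (rule column_state[OF v x impl_column w])
    also have "G (\<lambda>y. if y < D then H $$ (?x, y) else 0) *\<^sub>v ?w = ?F H *\<^sub>v ?w"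
      by (rule ctrl_mat_mult_vec[OF w unitary_matD(1)[OF impl_column(1)], symmetric])
    also have "state 0 (?F H *\<^sub>v ?w) = (embed_mat ?N s * ?F H) *\<^sub>v ?w"
      unfolding embed_mat_state[OF Fw d, symmetric]
      by (rule assoc_mult_mat_vec[OF embed_mat_carrier ctrl_mat_carrier w(1), symmetric])
    finally show "(?V U * embed_mat ?N s) *\<^sub>v ?w = (embed_mat ?N s * ?F H) *\<^sub>v ?w" .
  qed
  with circ show ?case by (intro exI[of _ ?V] conjI allI impI)
next
  case (impl_comp m F n F')
  let ?N = "q * (c * s)"
  let ?E = "embed_mat ?N s"
  obtain V where "circuit q (c * s) m V \<and> (\<forall>H f U. valid H f U \<longrightarrow> V U * ?E = ?E * F H)"
    using impl_comp.IH(1) by (rule exE)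
  hence V: "circuit q (c * s) m V" "\<And>H f U. valid H f U \<Longrightarrow> V U * ?E = ?E * F H" by simp_all
  obtain V' where "circuit q (c * s) n V' \<and> (\<forall>H f U. valid H f U \<longrightarrow> V' U * ?E = ?E * F' H)"
    using impl_comp.IH(2) by (rule exE)
  hence V': "circuit q (c * s) n V'" "\<And>H f U. valid H f U \<Longrightarrow> V' U * ?E = ?E * F' H" by simp_all
  have "(V U * V' U) * ?E = ?E * (F H * F' H)" if v: "valid H f U" for H f U
  proof -
    have Vc: "V U \<in> carrier_mat ?N ?N" "V' U \<in> carrier_mat ?N ?N"
      using circuit_unitary[OF V(1) valid_unitary[OF v]] circuit_unitary[OF V'(1) valid_unitary[OF v]]
      by (auto dest: unitary_matD(1))
    have Fc: "F H \<in> carrier_mat s s" "F' H \<in> carrier_mat s s"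
      using impl_unitary[OF impl_comp.hyps(1)] impl_unitary[OF impl_comp.hyps(2)] by (auto dest: unitary_matD(1))
    have "(V U * V' U) * ?E = V U * (V' U * ?E)"
      by (rule assoc_mult_mat[OF Vc embed_mat_carrier])
    also have "\<dots> = (V U * ?E) * F' H"
      unfolding V'(2)[OF v] by (rule assoc_mult_mat[OF Vc(1) embed_mat_carrier Fc(2), symmetric])
    also have "\<dots> = ?E * (F H * F' H)"
      unfolding V(2)[OF v] by (rule assoc_mult_mat[OF embed_mat_carrier Fc])
    finally show ?thesis .
  qed
  with circuit_comp[OF V(1) V'(1)] show ?case by (intro exI[of _ "\<lambda>U. V U * V' U"] conjI allI impI)
qed

end

section \<open>Block encoding of the Hamiltonian\<close>

text \<open>The default for vectors that are not normalised makes this unitary for every argument,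
  as column operations demand: the loading register also has contents that encode rows of no
  admissible Hamiltonian.\<close>

definition completion :: "complex vec \<Rightarrow> complex mat" where
  "completion u = (if vec_l2 u = 1
     then SOME V. unitary_mat (dim_vec u) V \<and> (\<forall>i<dim_vec u. V $$ (i, 0) = u $ i)
     else 1\<^sub>m (dim_vec u))"

lemma completion_spec:
  assumes "u \<in> carrier_vec n" "vec_l2 u = 1"
  shows "unitary_mat n (completion u) \<and> (\<forall>i<n. completion u $$ (i, 0) = u $ i)"
proof -
  obtain V where "unitary_mat n V" "\<And>i. i < n \<Longrightarrow> V $$ (i, 0) = u $ i"
    using unitary_completion[OF assms] by blast
  hence "\<exists>V. unitary_mat (dim_vec u) V \<and> (\<forall>i<dim_vec u. V $$ (i, 0) = u $ i)"
    using assms(1) by (intro exI[of _ V]) auto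
  from someI_ex[OF this] show ?thesis using assms by (simp add: completion_def)
qed

lemma unitary_mat_completion: "u \<in> carrier_vec n \<Longrightarrow> unitary_mat n (completion u)"
  by (cases "vec_l2 u = 1") (use completion_spec in blast, simp add: completion_def)

lemma completion_mult_unit_vec:
  assumes u: "u \<in> carrier_vec n" "vec_l2 u = 1" and n: "0 < n"
  shows "completion u *\<^sub>v unit_vec n 0 = u"
proof (rule eq_vecI)
  note c = completion_spec[OF u]
  fix i assume "i < dim_vec u"
  hence i: "i < n" using u by simp
  have "(completion u *\<^sub>v unit_vec n 0) $ i = (\<Sum>l<n. if l = 0 then completion u $$ (i, l) else 0)"
    unfolding mult_mat_vec_index_sum[OF unitary_matD(1)[OF conjunct1[OF c]] unit_vec_carrier i]
    by (intro sum.cong refl) auto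
  thus "(completion u *\<^sub>v unit_vec n 0) $ i = u $ i" using c i n by simp
qed (use unitary_matD(1)[OF conjunct1[OF completion_spec[OF u]]] u in auto)

text \<open>Basis states of the walk space are triples (flag, \<open>y\<close>, \<open>x\<close>) with index
  \<open>(flag * D + y) * D + x\<close>. The two preparations put their surplus amplitude on different flags,
  so that it does not contribute to the encoded block.\<close>

definition right_vec :: "nat \<Rightarrow> nat \<Rightarrow> (nat \<Rightarrow> complex) \<Rightarrow> complex vec" where
  "right_vec D d h = vec (3 * D) (\<lambda>i. if i < D then if h i = 0 then 0 else 1 / sqrt d
     else if i = D then sqrt (1 - card {y. y < D \<and> h y \<noteq> 0} / d) else 0)"

definition left_vec :: "nat \<Rightarrow> real \<Rightarrow> (nat \<Rightarrow> complex) \<Rightarrow> complex vec" where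
  "left_vec D \<nu> h = vec (3 * D) (\<lambda>i. if i < D then cnj (h i) / \<nu>
     else if i = 2 * D then sqrt (1 - (\<Sum>y<D. (cmod (h y))\<^sup>2) / \<nu>\<^sup>2) else 0)"

text \<open>Exchange of \<open>x\<close> and \<open>y\<close> with the flag kept.\<close>

definition swap_idx :: "nat \<Rightarrow> nat \<Rightarrow> nat" where
  "swap_idx D i = (i div D div D * D + i mod D) * D + i div D mod D"

definition prep :: "nat \<Rightarrow> ((nat \<Rightarrow> complex) \<Rightarrow> complex vec) \<Rightarrow> complex mat \<Rightarrow> complex mat" where
  "prep D vf H = ctrl_mat (3 * D * D) (\<lambda>i. i mod D)
     (\<lambda>x. completion (vf (\<lambda>y. if y < D then H $$ (x, y) else 0)) \<otimes>\<^sub>m 1\<^sub>m D)"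

text \<open>Its entry at system indices x and x', with flag and \<open>y\<close> at zero, is the
  overlap of the value state of x with the swapped pattern state of x'. The swap pairs the amplitude
  at x' of the former with the amplitude at x of the latter.\<close>

definition walk :: "nat \<Rightarrow> nat \<Rightarrow> real \<Rightarrow> complex mat \<Rightarrow> complex mat" where
  "walk D d \<nu> H = mat_adjoint (prep D (left_vec D \<nu>) H)
     * (perm_mat (3 * D * D) (swap_idx D) * prep D (right_vec D d) H)"

lemma right_vec_carrier [simp]: "right_vec D d h \<in> carrier_vec (3 * D)"
  by (simp add: right_vec_def)

lemma left_vec_carrier [simp]: "left_vec D \<nu> h \<in> carrier_vec (3 * D)"
  by (simp add: left_vec_def)

lemma swap_idx_add:
  assumes "y < D" "x < D"
  shows "swap_idx D ((l * D + y) * D + x) = (l * D + x) * D + y"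
  using assms by (simp add: swap_idx_def)

lemma index3_cases:
  assumes "i < m * D * (D :: nat)"
  obtains l y x where "l < m" "y < D" "x < D" "i = (l * D + y) * D + x"
proof -
  have D: "i div D < m * D" "i mod D < D" using lt_mult_div_mod[OF assms] .
  show ?thesis
    using that[of "i div D div D" "i div D mod D" "i mod D"] lt_mult_div_mod[OF D(1)] D(2) by simp
qed

lemma swap_idx_less:
  assumes "i < m * D * D" shows "swap_idx D i < m * D * D"
  using assms by (rule index3_cases) (simp add: swap_idx_add mult_lt_mult)

lemma swap_idx_swap_idx:
  assumes "i < m * D * D" shows "swap_idx D (swap_idx D i) = i"
  using assms by (rule index3_cases) (simp add: swap_idx_add)

lemma unitary_swap: "unitary_mat (3 * D * D) (perm_mat (3 * D * D) (swap_idx D))"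
  by (intro unitary_perm_mat swap_idx_less inj_on_inverseI[where g = "swap_idx D"] swap_idx_swap_idx) auto

lemma impl_prep:
  assumes "\<And>h. vf h \<in> carrier_vec (3 * D)"
  shows "impl D d (3 * D * D) (4 * d) (prep D vf)"
proof -
  have U: "unitary_mat (3 * D) (completion (vf h))" for h by (rule unitary_mat_completion[OF assms])
  have "preserves (3 * D * D) (\<lambda>i. i mod D) (completion (vf h) \<otimes>\<^sub>m 1\<^sub>m D)" for h
    by (rule preserves_tensor_one_right[where f = "\<lambda>i. i"]) (rule unitary_matD(1)[OF U])
  hence "impl D d (3 * D * D) (4 * d) (\<lambda>H. ctrl_mat (3 * D * D) (\<lambda>i. i mod D)
     (\<lambda>x. completion (vf (\<lambda>y. if y < D then H $$ (x, y) else 0)) \<otimes>\<^sub>m 1\<^sub>m D))"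
    using U by (intro impl_column[where G = "\<lambda>h. completion (vf h) \<otimes>\<^sub>m 1\<^sub>m D"] unitary_mat_tensor unitary_mat_one)
  thus ?thesis by (simp add: prep_def[abs_def])
qed

lemma impl_walk: "impl D d (3 * D * D) (8 * d) (walk D d \<nu>)"
proof -
  have "impl D d (3 * D * D) (4 * d + (0 + 4 * d)) (walk D d \<nu>)"
    unfolding walk_def[abs_def]
    by (intro impl_comp impl_adjoint impl_gate impl_prep unitary_swap) auto
  moreover have "4 * d + (0 + 4 * d) = 8 * d" by simp
  ultimately show ?thesis by (simp only:)
qed

lemma prep_mult:
  fixes vf H and D x :: nat
  defines "u \<equiv> vf (\<lambda>y. if y < D then H $$ (x, y) else 0)"
  assumes D: "0 < D" and x: "x < D" and u: "u \<in> carrier_vec (3 * D)" "vec_l2 u = 1"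
  shows "prep D vf H *\<^sub>v unit_vec (3 * D * D) x = u \<otimes>\<^sub>v unit_vec D x"
proof -
  have e: "unit_vec (3 * D * D) x = unit_vec (3 * D) 0 \<otimes>\<^sub>v unit_vec D x"
    using tensor_unit_vec[of 0 "3 * D" x D] x D by simp
  have c: "completion u \<in> carrier_mat (3 * D) (3 * D)"
    by (rule unitary_matD(1)[OF unitary_mat_completion[OF u(1)]])
  have sup: "supported (\<lambda>i. i mod D) x (unit_vec (3 * D * D) x)"
    using supported_unit_vec[of "\<lambda>i. i mod D" x "3 * D * D"] x by simp
  have "prep D vf H *\<^sub>v unit_vec (3 * D * D) x = (completion u \<otimes>\<^sub>m 1\<^sub>m D) *\<^sub>v unit_vec (3 * D * D) x"
    unfolding prep_def using ctrl_mat_mult_vec[OF unit_vec_carrier sup,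
        of "\<lambda>x. completion (vf (\<lambda>y. if y < D then H $$ (x, y) else 0)) \<otimes>\<^sub>m 1\<^sub>m D"] c
    by (simp add: u_def)
  also have "\<dots> = (completion u *\<^sub>v unit_vec (3 * D) 0) \<otimes>\<^sub>v (1\<^sub>m D *\<^sub>v unit_vec D x)"
    unfolding e by (rule tensor_mat_mult_vec[OF c one_carrier_mat unit_vec_carrier unit_vec_carrier])
  also have "completion u *\<^sub>v unit_vec (3 * D) 0 = u"
    using D by (intro completion_mult_unit_vec u) simp
  finally show ?thesis by simp
qed

lemma sum_three_blocks: "(\<Sum>i<3 * D. f i) = (\<Sum>y<D. f y) + (\<Sum>y<D. f (D + y)) + (\<Sum>y<D. f (2 * D + y))"
  for f :: "nat \<Rightarrow> 'a :: comm_monoid_add"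
  unfolding sum_lessThan_mult[of f 3 D] by (simp add: numeral_3_eq_3 mult_2 add.assoc)

text \<open>Sparsity makes the surplus under the square root nonnegative, so that it completes the
  norm to 1.\<close>

lemma vec_l2_right_vec:
  assumes d: "0 < d" and D: "0 < D" and card: "card {y. y < D \<and> h y \<noteq> 0} \<le> d"
  shows "vec_l2 (right_vec D d h) = 1"
proof -
  let ?c = "card {y. y < D \<and> h y \<noteq> 0}"
  have c1: "real ?c / d \<le> 1" using d card by simp
  have 1: "(\<Sum>y<D. (cmod (right_vec D d h $ y))\<^sup>2) = (\<Sum>y<D. if h y \<noteq> 0 then 1 / d else 0)"
    using d by (intro sum.cong refl) (auto simp: right_vec_def norm_divide power_divide)
  have 2: "\<dots> = ?c / d"
    using sum.inter_filter[of "{..<D}" "\<lambda>_. 1 / real d" "\<lambda>y. h y \<noteq> 0"] by simp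
  have 3: "(\<Sum>y<D. (cmod (right_vec D d h $ (D + y)))\<^sup>2) = (\<Sum>y<D. if y = 0 then 1 - ?c / d else 0)"
    using c1 by (intro sum.cong refl) (auto simp: right_vec_def simp flip: of_real_diff)
  have 4: "(\<Sum>y<D. (cmod (right_vec D d h $ (2 * D + y)))\<^sup>2) = 0"
    using D by (intro sum.neutral) (auto simp: right_vec_def)
  have "(vec_l2 (right_vec D d h))\<^sup>2 = 1"
    unfolding vec_l2_square carrier_vecD[OF right_vec_carrier] sum_three_blocks 1 2 3 4 using D by simp
  thus ?thesis using vec_l2_nonneg[of "right_vec D d h"] by (auto simp: power2_eq_1_iff)
qed

lemma vec_l2_left_vec:
  assumes \<nu>: "0 < \<nu>" and D: "0 < D" and bound: "(\<Sum>y<D. (cmod (h y))\<^sup>2) \<le> \<nu>\<^sup>2"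
  shows "vec_l2 (left_vec D \<nu> h) = 1"
proof -
  let ?c = "\<Sum>y<D. (cmod (h y))\<^sup>2"
  have c1: "?c / \<nu>\<^sup>2 \<le> 1" using \<nu> bound by simp
  have 1: "(\<Sum>y<D. (cmod (left_vec D \<nu> h $ y))\<^sup>2) = ?c / \<nu>\<^sup>2"
    unfolding sum_divide_distrib using \<nu> by (intro sum.cong refl) (auto simp: left_vec_def norm_divide power_divide)
  have 2: "(\<Sum>y<D. (cmod (left_vec D \<nu> h $ (D + y)))\<^sup>2) = 0"
    by (intro sum.neutral) (auto simp: left_vec_def)
  have 3: "(\<Sum>y<D. (cmod (left_vec D \<nu> h $ (2 * D + y)))\<^sup>2) = (\<Sum>y<D. if y = 0 then 1 - ?c / \<nu>\<^sup>2 else 0)"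
    using c1 by (intro sum.cong refl) (auto simp: left_vec_def simp flip: of_real_diff)
  have "(vec_l2 (left_vec D \<nu> h))\<^sup>2 = 1"
    unfolding vec_l2_square carrier_vecD[OF left_vec_carrier] sum_three_blocks 1 2 3 using D by simp
  thus ?thesis using vec_l2_nonneg[of "left_vec D \<nu> h"] by (auto simp: power2_eq_1_iff)
qed

lemma perm_mat_index_involution:
  assumes \<sigma>: "\<And>i. i < n \<Longrightarrow> \<sigma> i < n" "\<And>i. i < n \<Longrightarrow> \<sigma> (\<sigma> i) = i" and v: "v \<in> carrier_vec n" and i: "i < n"
  shows "(perm_mat n \<sigma> *\<^sub>v v) $ i = v $ \<sigma> i"
proof -
  have "(perm_mat n \<sigma> *\<^sub>v v) $ i = (\<Sum>j<n. if j = \<sigma> i then v $ j else 0)"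
    unfolding mult_mat_vec_index_sum[OF perm_mat_carrier v i]
    using i \<sigma> by (intro sum.cong refl) (auto simp: perm_mat_def)
  thus ?thesis using \<sigma>(1)[OF i] by simp
qed

lemma cscalar_prod_sum:
  "w \<in> carrier_vec n \<Longrightarrow> v \<bullet>c w = (\<Sum>i<n. v $ i * cnj (w $ i))"
  by (auto simp: scalar_prod_def atLeast0LessThan)

lemma mat_index_cscalar_prod:
  fixes A :: "complex mat"
  assumes A: "A \<in> carrier_mat n n" and ij: "i < n" "j < n"
  shows "A $$ (i, j) = (A *\<^sub>v unit_vec n j) \<bullet>c unit_vec n i"
proof -
  have Aj: "A *\<^sub>v unit_vec n j \<in> carrier_vec n" using A by simp
  have "(A *\<^sub>v unit_vec n j) \<bullet>c unit_vec n i = (\<Sum>l<n. if l = i then (A *\<^sub>v unit_vec n j) $ l else 0)"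
  proof -
    have "(A *\<^sub>v unit_vec n j) \<bullet>c unit_vec n i
        = (\<Sum>l<n. (A *\<^sub>v unit_vec n j) $ l * cnj (unit_vec n i $ l))"
      by (simp add: scalar_prod_def atLeast0LessThan del: index_mult_mat_vec index_unit_vec(1,2))
    also have "\<dots> = (\<Sum>l<n. if l = i then (A *\<^sub>v unit_vec n j) $ l else 0)"
      using ij by (intro sum.cong refl) (simp del: index_mult_mat_vec)
    finally show ?thesis .
  qed
  also have "\<dots> = (A *\<^sub>v unit_vec n j) $ i" using ij by (simp del: index_mult_mat_vec)
  also have "\<dots> = (\<Sum>l<n. if l = j then A $$ (i, l) else 0)"
    unfolding mult_mat_vec_index_sum[OF A unit_vec_carrier ij(1)] by (intro sum.cong refl) (auto simp: unit_vec_def)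
  also have "\<dots> = A $$ (i, j)" using ij by simp
  finally show ?thesis by simp
qed

text \<open>The swapped overlap is a sum of one product for each flag. For flags 1 and 2 one factor
  vanishes; flag 0 gives 1 / sqrt d times the matrix element over \<nu> on the pattern, and off the
  pattern both sides are 0.\<close>

lemma walk_block:
  assumes H: "H \<in> carrier_mat D D" "hermitian_mat H" "sparse_mat d H" and \<nu>: "op_norm H = \<nu>" "0 < \<nu>"
    and d: "0 < d" and x: "x < D" "x' < D"
  shows "walk D d \<nu> H $$ (x, x') = H $$ (x, x') / (sqrt d * \<nu>)"
proof -
  let ?n = "3 * D * D"
  let ?h = "\<lambda>x y. if y < D then H $$ (x, y) else 0"
  have D: "0 < D" using x by simp
  have xn: "z < ?n" if "z < D" for z using that mult_lt_mult[of 0 "3 * D" z D] D by simp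
  have Hs: "cnj (H $$ (j, i)) = H $$ (i, j)" if "i < D" "j < D" for i j
    by (rule hermitian_index[OF H(2,1) that])
  have sets: "{y. y < D \<and> ?h z y \<noteq> 0} = {y. y < dim_row H \<and> H $$ (y, z) \<noteq> 0}" if "z < D" for z
    using Hs[OF that] H(1) by (auto simp flip: Hs[OF that])
  have r1: "vec_l2 (right_vec D d (?h z)) = 1" if "z < D" for z
  proof (rule vec_l2_right_vec[OF d D])
    show "card {y. y < D \<and> ?h z y \<noteq> 0} \<le> d"
      using H(1,3) that unfolding sets[OF that] by (simp add: sparse_mat_def)
  qed
  \<comment> \<open>By hermiticity row \<open>z\<close> has the norm of column \<open>z\<close>,
    which is the image of a unit vector under \<open>H\<close>; so \<nu> itself normalises the
    values.\<close>
  have l1: "vec_l2 (left_vec D \<nu> (?h z)) = 1" if z: "z < D" for z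
  proof (rule vec_l2_left_vec[OF \<nu>(2) D])
    have Hz: "(H *\<^sub>v unit_vec D z) $ y = H $$ (y, z)" if "y < D" for y
      unfolding mult_mat_vec_index_sum[OF H(1) unit_vec_carrier that] using z
      by (simp add: unit_vec_def if_distrib cong: if_cong)
    have "(\<Sum>y<D. (cmod (?h z y))\<^sup>2) = (\<Sum>y<D. (cmod ((H *\<^sub>v unit_vec D z) $ y))\<^sup>2)"
    proof (intro sum.cong refl)
      fix y assume "y \<in> {..<D}"
      hence y: "y < D" by simp
      have "cmod (H $$ (z, y)) = cmod (H $$ (y, z))" using arg_cong[OF Hs[OF y z], of cmod] by simp
      thus "(cmod (?h z y))\<^sup>2 = (cmod ((H *\<^sub>v unit_vec D z) $ y))\<^sup>2" using y by (simp add: Hz del: index_mult_mat_vec)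
    qed
    also have "\<dots> = (vec_l2 (H *\<^sub>v unit_vec D z))\<^sup>2" using H(1) by (simp add: vec_l2_square)
    also have "\<dots> \<le> \<nu>\<^sup>2"
      using vec_l2_mult_le_op_norm[OF H(1), of "unit_vec D z"] z \<nu> by (intro power_mono) auto
    finally show "(\<Sum>y<D. (cmod (?h z y))\<^sup>2) \<le> \<nu>\<^sup>2" .
  qed
  let ?R = "prep D (right_vec D d) H" and ?Lp = "prep D (left_vec D \<nu>) H" and ?P = "perm_mat ?n (swap_idx D)"
  let ?a = "right_vec D d (?h x')" and ?b = "left_vec D \<nu> (?h x)"
  have cR: "?R \<in> carrier_mat ?n ?n" "?Lp \<in> carrier_mat ?n ?n" "?P \<in> carrier_mat ?n ?n" by (simp_all add: prep_def)
  have Rx: "?R *\<^sub>v unit_vec ?n x' = ?a \<otimes>\<^sub>v unit_vec D x'"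
    using prep_mult[of D x' "right_vec D d" H] D x(2) r1 by simp
  have Lx: "?Lp *\<^sub>v unit_vec ?n x = ?b \<otimes>\<^sub>v unit_vec D x"
    using prep_mult[of D x "left_vec D \<nu>" H] D x(1) l1 by simp
  have v: "?a \<otimes>\<^sub>v unit_vec D x' \<in> carrier_vec ?n" "?b \<otimes>\<^sub>v unit_vec D x \<in> carrier_vec ?n"
    using tensor_vec_carrier[OF right_vec_carrier unit_vec_carrier] tensor_vec_carrier[OF left_vec_carrier unit_vec_carrier]
    by auto
  have Wc: "walk D d \<nu> H \<in> carrier_mat ?n ?n" using cR by (simp add: walk_def)
  have "walk D d \<nu> H *\<^sub>v unit_vec ?n x' = mat_adjoint ?Lp *\<^sub>v ((?P * ?R) *\<^sub>v unit_vec ?n x')"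
    unfolding walk_def using cR by (intro assoc_mult_mat_vec[of _ ?n ?n _ ?n]) auto
  also have "(?P * ?R) *\<^sub>v unit_vec ?n x' = ?P *\<^sub>v (?a \<otimes>\<^sub>v unit_vec D x')"
    unfolding Rx[symmetric] using cR by (intro assoc_mult_mat_vec[of _ ?n ?n _ ?n]) auto
  finally have "walk D d \<nu> H $$ (x, x') = (mat_adjoint ?Lp *\<^sub>v (?P *\<^sub>v (?a \<otimes>\<^sub>v unit_vec D x'))) \<bullet>c unit_vec ?n x"
    using mat_index_cscalar_prod[OF Wc xn[OF x(1)] xn[OF x(2)]] by simp
  also have "\<dots> = (?P *\<^sub>v (?a \<otimes>\<^sub>v unit_vec D x')) \<bullet>c (mat_adjoint (mat_adjoint ?Lp) *\<^sub>v unit_vec ?n x)"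
    using cR v by (intro cscalar_prod_adjoint[of _ ?n ?n]) auto
  also have "\<dots> = (\<Sum>i<?n. (?a \<otimes>\<^sub>v unit_vec D x') $ swap_idx D i * cnj ((?b \<otimes>\<^sub>v unit_vec D x) $ i))"
  proof -
    have "(?P *\<^sub>v (?a \<otimes>\<^sub>v unit_vec D x')) $ i = (?a \<otimes>\<^sub>v unit_vec D x') $ swap_idx D i" if "i < ?n" for i
      by (rule perm_mat_index_involution[OF _ _ v(1) that]) (rule swap_idx_less swap_idx_swap_idx, assumption)+
    thus ?thesis unfolding mat_adjoint_adjoint Lx cscalar_prod_sum[OF v(2)]
      by (intro sum.cong refl) (simp only: lessThan_iff)
  qed
  also have "\<dots> = (\<Sum>l<3. \<Sum>y<D. \<Sum>z<D. (?a \<otimes>\<^sub>v unit_vec D x') $ ((l * D + z) * D + y)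
      * cnj ((?b \<otimes>\<^sub>v unit_vec D x) $ ((l * D + y) * D + z)))"
    unfolding sum_lessThan_mult by (intro sum.cong refl) (simp add: swap_idx_add)
  also have "\<dots> = (\<Sum>l<3. \<Sum>y<D. \<Sum>z<D. if z = x then if y = x' then ?a $ (l * D + x) * cnj (?b $ (l * D + x')) else 0 else 0)"
    using x by (intro sum.cong refl) (auto simp: tensor_vec_index_add[OF right_vec_carrier unit_vec_carrier mult_lt_mult]
        tensor_vec_index_add[OF left_vec_carrier unit_vec_carrier mult_lt_mult])
  also have "\<dots> = (\<Sum>l<3. ?a $ (l * D + x) * cnj (?b $ (l * D + x')))"
    using x by simp
  also have "\<dots> = ?a $ x * cnj (?b $ x')"
    using x by (simp add: numeral_3_eq_3 right_vec_def left_vec_def)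
  also have "\<dots> = H $$ (x, x') / (sqrt d * \<nu>)"
    using x Hs[OF x] by (simp add: right_vec_def left_vec_def) (auto simp flip: Hs[OF x])
  finally show ?thesis .
qed

section \<open>Walk steps, linear combinations and amplification\<close>

lemma smult_mat_mult_vec:
  fixes A :: "complex mat"
  assumes "A \<in> carrier_mat m n" "v \<in> carrier_vec n"
  shows "(c \<cdot>\<^sub>m A) *\<^sub>v v = c \<cdot>\<^sub>v (A *\<^sub>v v)"
  using assms by (intro eq_vecI) (auto simp: smult_scalar_prod_distrib[of _ n])

text \<open>The component with every register but the system at zero; it acts as the adjoint of
  \<open>embed_mat\<close>.\<close>

definition top_vec :: "nat \<Rightarrow> complex vec \<Rightarrow> complex vec" where
  "top_vec D v = vec D (\<lambda>i. v $ i)"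

lemma top_vec_carrier [simp]: "top_vec D v \<in> carrier_vec D"
  by (simp add: top_vec_def)

lemma top_vec_embed:
  assumes "w \<in> carrier_vec D" "D \<le> n"
  shows "top_vec D (embed_mat n D *\<^sub>v w) = w"
  using assms by (intro eq_vecI) (auto simp: top_vec_def embed_mat_mult_vec[OF assms(1)])

lemma top_vec_minus:
  "v \<in> carrier_vec n \<Longrightarrow> w \<in> carrier_vec n \<Longrightarrow> D \<le> n \<Longrightarrow> top_vec D (v - w) = top_vec D v - top_vec D w"
  by (intro eq_vecI) (auto simp: top_vec_def)

lemma top_vec_smult:
  "v \<in> carrier_vec n \<Longrightarrow> D \<le> n \<Longrightarrow> top_vec D (c \<cdot>\<^sub>v v) = c \<cdot>\<^sub>v top_vec D v"
  by (intro eq_vecI) (auto simp: top_vec_def)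

definition top_block :: "nat \<Rightarrow> complex mat \<Rightarrow> complex mat" where
  "top_block D A = mat D D (\<lambda>ij. A $$ ij)"

lemma top_block_carrier [simp]: "top_block D A \<in> carrier_mat D D"
  by (simp add: top_block_def)

lemma top_vec_mult_embed:
  assumes A: "A \<in> carrier_mat n n" and w: "w \<in> carrier_vec D" and D: "D \<le> n"
  shows "top_vec D (A *\<^sub>v (embed_mat n D *\<^sub>v w)) = top_block D A *\<^sub>v w"
proof (rule eq_vecI)
  fix i assume "i < dim_vec (top_block D A *\<^sub>v w)"
  hence i: "i < D" by (simp add: top_block_def)
  hence "i < n" using D by simp
  have E: "embed_mat n D *\<^sub>v w \<in> carrier_vec n" using w by (intro mult_mat_vec_carrier[OF embed_mat_carrier])
  have sub: "{..<n} \<inter> {..<D} = {..<D}" using D by auto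
  have "(A *\<^sub>v (embed_mat n D *\<^sub>v w)) $ i = (\<Sum>j<n. if j \<in> {..<D} then A $$ (i, j) * w $ j else 0)"
    unfolding mult_mat_vec_index_sum[OF A E \<open>i < n\<close>]
    by (intro sum.cong refl) (auto simp: embed_mat_mult_vec[OF w])
  also have "\<dots> = (\<Sum>j<D. A $$ (i, j) * w $ j)"
    by (subst sum.inter_restrict[symmetric]) (simp_all only: finite_lessThan sub)
  finally show "top_vec D (A *\<^sub>v (embed_mat n D *\<^sub>v w)) $ i = (top_block D A *\<^sub>v w) $ i"
    unfolding mult_mat_vec_index_sum[OF top_block_carrier w i]
    using i by (simp add: top_vec_def top_block_def del: index_mult_mat_vec)
qed (simp add: top_vec_def top_block_def)

lemma top_block_adjoint:
  assumes "A \<in> carrier_mat n n" "D \<le> n"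
  shows "top_block D (mat_adjoint A) = mat_adjoint (top_block D A)"
  using assms by (intro eq_matI) (auto simp: top_block_def)

text \<open>The reflection 2 P - 1, with P the projection onto the subspace where every register but
  the system is at zero.\<close>

definition refl_mat :: "nat \<Rightarrow> nat \<Rightarrow> complex mat" where
  "refl_mat n D = diag_of n (\<lambda>i. if i < D then 1 else - 1)"

lemma refl_mat_carrier [simp]: "refl_mat n D \<in> carrier_mat n n"
  by (simp add: refl_mat_def)

lemma diag_of_mult_vec:
  assumes "v \<in> carrier_vec n"
  shows "diag_of n f *\<^sub>v v = vec n (\<lambda>i. f i * v $ i)"
proof (rule eq_vecI)
  fix i assume "i < dim_vec (vec n (\<lambda>i. f i * v $ i))"
  hence i: "i < n" by simp
  have "(diag_of n f *\<^sub>v v) $ i = (\<Sum>j<n. if j = i then f i * v $ j else 0)"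
    unfolding mult_mat_vec_index_sum[OF diag_of_carrier assms i]
    using i by (intro sum.cong refl) (auto simp: diag_of_def)
  thus "(diag_of n f *\<^sub>v v) $ i = vec n (\<lambda>i. f i * v $ i) $ i" using i by simp
qed simp

lemma unitary_diag_of:
  assumes "\<And>i. i < n \<Longrightarrow> cmod (f i) = 1"
  shows "unitary_mat n (diag_of n f)"
proof -
  have "spec_mat n (1\<^sub>m n) f = diag_of n f"
    using left_mult_one_mat[OF diag_of_carrier] right_mult_one_mat[OF diag_of_carrier]
    by (simp add: spec_mat_def)
  moreover have "unitary_mat n (spec_mat n (1\<^sub>m n) f)"
    by (rule unitary_spec_mat[OF unitary_mat_one assms])
  ultimately show ?thesis by simp
qed

lemma unitary_refl_mat: "unitary_mat n (refl_mat n D)"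
  unfolding refl_mat_def by (intro unitary_diag_of) auto

lemma refl_mat_mult_vec:
  assumes v: "v \<in> carrier_vec n" and D: "D \<le> n"
  shows "refl_mat n D *\<^sub>v v = 2 \<cdot>\<^sub>v (embed_mat n D *\<^sub>v top_vec D v) - v"
  unfolding refl_mat_def diag_of_mult_vec[OF v] embed_mat_mult_vec[OF top_vec_carrier]
  using v by (intro eq_vecI) (auto simp: top_vec_def)

lemma top_vec_refl_mat:
  assumes v: "v \<in> carrier_vec n" and D: "D \<le> n"
  shows "top_vec D (refl_mat n D *\<^sub>v v) = top_vec D v"
  unfolding refl_mat_def diag_of_mult_vec[OF v]
  using v D by (intro eq_vecI) (auto simp: top_vec_def)

lemma refl_mat_embed:
  assumes w: "w \<in> carrier_vec D"
  shows "refl_mat n D *\<^sub>v (embed_mat n D *\<^sub>v w) = embed_mat n D *\<^sub>v w"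
proof -
  have E: "embed_mat n D *\<^sub>v w \<in> carrier_vec n" using w by (intro mult_mat_vec_carrier[OF embed_mat_carrier])
  show ?thesis unfolding refl_mat_def diag_of_mult_vec[OF E] unfolding embed_mat_mult_vec[OF w]
    by (intro eq_vecI) auto
qed

fun cheb :: "nat \<Rightarrow> real \<Rightarrow> real" where
  "cheb 0 x = 1"
| "cheb (Suc 0) x = x"
| "cheb (Suc (Suc n)) x = 2 * x * cheb (Suc n) x - cheb n x"

text \<open>Alternation with the adjoint makes each step begin the inverse of the previous one, so
  any unitary with a hermitian block can be used, not only a self-inverse one.\<close>

fun walk_steps :: "nat \<Rightarrow> nat \<Rightarrow> complex mat \<Rightarrow> nat \<Rightarrow> complex mat" where
  "walk_steps n D W 0 = 1\<^sub>m n"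
| "walk_steps n D W (Suc l) = ((if even l then W else mat_adjoint W) * refl_mat n D) * walk_steps n D W l"

lemma unitary_walk_steps: "unitary_mat n W \<Longrightarrow> unitary_mat n (walk_steps n D W l)"
  by (induction l) (auto intro!: unitary_mat_mult unitary_refl_mat unitary_mat_adjoint)

text \<open>Let V_l be the unitary of step l, s_l the state before it, t_l the top component of s_l
  and X the block. As V_(l+1) inverts V_l, V_(l+1) s_(l+1) = R s_l. Hence s_(l+2) = V_(l+1) (2 P -
  1) s_(l+1) = 2 V_(l+1) P s_(l+1) - R s_l, with top component 2 X t_(l+1) - t_l: the Chebyshev
  recurrence.\<close>

lemma top_vec_walk_steps:
  assumes W: "unitary_mat n W" and D: "D \<le> n" and U: "unitary_mat D U"
    and blk: "top_block D W = spec_mat D U (\<lambda>i. complex_of_real (x i))" and w: "w \<in> carrier_vec D"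
  shows "top_vec D (walk_steps n D W l *\<^sub>v (embed_mat n D *\<^sub>v w))
    = spec_mat D U (\<lambda>i. complex_of_real (cheb l (x i))) *\<^sub>v w"
proof -
  let ?E = "embed_mat n D" and ?R = "refl_mat n D"
  define X where "X = spec_mat D U (\<lambda>i. complex_of_real (x i))"
  define V where "V = (\<lambda>l :: nat. if even l then W else mat_adjoint W)"
  define s where "s = (\<lambda>l. walk_steps n D W l *\<^sub>v (?E *\<^sub>v w))"
  note UD = unitary_matD[OF U]
  have Xc: "X \<in> carrier_mat D D" using UD by (simp add: X_def)
  have Vc: "V l \<in> carrier_mat n n" for l using unitary_matD(1)[OF W] by (simp add: V_def)
  have VV: "V (Suc l) * V l = 1\<^sub>m n" for l using unitary_matD[OF W] by (simp add: V_def)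
  \<comment> \<open>X has real eigenvalues, so \<open>W\<close> and its adjoint have the same
    block.\<close>
  have blkV: "top_block D (V l) = X" for l
    using unitary_matD(1)[OF W] UD(1) D by (simp add: V_def X_def blk top_block_adjoint spec_mat_adjoint)
  have E: "?E *\<^sub>v z \<in> carrier_vec n" if "z \<in> carrier_vec D" for z
    using that by (intro mult_mat_vec_carrier[OF embed_mat_carrier])
  have Sc: "walk_steps n D W l \<in> carrier_mat n n" for l by (rule unitary_matD(1)[OF unitary_walk_steps[OF W]])
  have sc: "s l \<in> carrier_vec n" for l unfolding s_def by (rule mult_sq_vec_carrier[OF Sc E[OF w]])
  have sS: "s (Suc l) = V l *\<^sub>v (?R *\<^sub>v s l)" for l
  proof -
    have "s (Suc l) = ((V l * ?R) * walk_steps n D W l) *\<^sub>v (?E *\<^sub>v w)" by (simp add: s_def V_def)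
    also have "\<dots> = (V l * ?R) *\<^sub>v s l"
      unfolding s_def by (rule assoc_mult_mat_vec[OF mult_sq_carrier[OF Vc refl_mat_carrier] Sc E[OF w]])
    also have "\<dots> = V l *\<^sub>v (?R *\<^sub>v s l)" by (rule assoc_mult_mat_vec[OF Vc refl_mat_carrier sc])
    finally show ?thesis .
  qed
  have Rs: "?R *\<^sub>v s l \<in> carrier_vec n" for l by (rule mult_sq_vec_carrier[OF refl_mat_carrier sc])
  have undo: "V (Suc l) *\<^sub>v s (Suc l) = ?R *\<^sub>v s l" for l
  proof -
    have "V (Suc l) *\<^sub>v s (Suc l) = (V (Suc l) * V l) *\<^sub>v (?R *\<^sub>v s l)"
      unfolding sS[of l] by (rule assoc_mult_mat_vec[OF Vc Vc Rs, symmetric])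
    thus ?thesis using Rs by (simp add: VV)
  qed
  let ?t = "\<lambda>l. top_vec D (s l)"
  have step: "?t (Suc (Suc l)) = 2 \<cdot>\<^sub>v (X *\<^sub>v ?t (Suc l)) - ?t l" for l
  proof -
    have Et: "?E *\<^sub>v ?t (Suc l) \<in> carrier_vec n" by (rule E) simp
    have VEt: "V (Suc l) *\<^sub>v (?E *\<^sub>v ?t (Suc l)) \<in> carrier_vec n" by (rule mult_sq_vec_carrier[OF Vc Et])
    have "s (Suc (Suc l)) = V (Suc l) *\<^sub>v (2 \<cdot>\<^sub>v (?E *\<^sub>v ?t (Suc l)) - s (Suc l))"
      unfolding sS[of "Suc l"] refl_mat_mult_vec[OF sc D] ..
    also have "\<dots> = V (Suc l) *\<^sub>v (2 \<cdot>\<^sub>v (?E *\<^sub>v ?t (Suc l))) - V (Suc l) *\<^sub>v s (Suc l)"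
      by (rule mult_minus_distrib_mat_vec[OF Vc _ sc]) (use Et in simp)
    also have "\<dots> = 2 \<cdot>\<^sub>v (V (Suc l) *\<^sub>v (?E *\<^sub>v ?t (Suc l))) - ?R *\<^sub>v s l"
      unfolding undo mult_mat_vec[OF Vc Et] ..
    finally have "?t (Suc (Suc l)) = top_vec D (2 \<cdot>\<^sub>v (V (Suc l) *\<^sub>v (?E *\<^sub>v ?t (Suc l)))) - top_vec D (?R *\<^sub>v s l)"
      using top_vec_minus[OF _ Rs D] VEt by simp
    thus ?thesis
      unfolding top_vec_refl_mat[OF sc D] top_vec_smult[OF VEt D] top_vec_mult_embed[OF Vc top_vec_carrier D] blkV .
  qed
  have t0: "?t 0 = w" using top_vec_embed[OF w D] E[OF w] by (simp add: s_def)
  have t1: "?t (Suc 0) = X *\<^sub>v w"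
  proof -
    have "s 0 = ?E *\<^sub>v w" using E[OF w] by (simp add: s_def)
    hence "s (Suc 0) = V 0 *\<^sub>v (?E *\<^sub>v w)" by (simp add: sS refl_mat_embed[OF w])
    thus ?thesis by (simp add: top_vec_mult_embed[OF Vc w D] blkV)
  qed
  \<comment> \<open>Two consecutive values are carried along, as the recurrence has depth
    two.\<close>
  have "?t l = spec_mat D U (\<lambda>i. complex_of_real (cheb l (x i))) *\<^sub>v w \<and>
      ?t (Suc l) = spec_mat D U (\<lambda>i. complex_of_real (cheb (Suc l) (x i))) *\<^sub>v w"
  proof (induction l)
    case 0
    show ?case using w by (simp add: t0 t1 X_def spec_mat_one[OF U])
  next
    case (Suc l)
    let ?C = "\<lambda>l. spec_mat D U (\<lambda>i. complex_of_real (cheb l (x i)))"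
    have Cc: "?C l \<in> carrier_mat D D" for l using UD by simp
    have "?t (Suc (Suc l)) = 2 \<cdot>\<^sub>v (X *\<^sub>v (?C (Suc l) *\<^sub>v w)) - ?C l *\<^sub>v w"
      unfolding step using Suc by simp
    also have "X *\<^sub>v (?C (Suc l) *\<^sub>v w) = (X * ?C (Suc l)) *\<^sub>v w"
      by (rule assoc_mult_mat_vec[OF Xc Cc w, symmetric])
    also have "X * ?C (Suc l) = spec_mat D U (\<lambda>i. complex_of_real (x i) * complex_of_real (cheb (Suc l) (x i)))"
      unfolding X_def by (rule spec_mat_mult[OF U])
    also have "2 \<cdot>\<^sub>v (\<dots> *\<^sub>v w) = (2 \<cdot>\<^sub>m \<dots>) *\<^sub>v w"
      using w UD by (intro smult_mat_mult_vec[symmetric, of _ D D]) auto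
    also have "2 \<cdot>\<^sub>m spec_mat D U (\<lambda>i. complex_of_real (x i) * complex_of_real (cheb (Suc l) (x i)))
       = spec_mat D U (\<lambda>i. 2 * (complex_of_real (x i) * complex_of_real (cheb (Suc l) (x i))))"
      using UD by (intro spec_mat_smult)
    also have "\<dots> *\<^sub>v w - ?C l *\<^sub>v w = (\<dots> - ?C l) *\<^sub>v w"
      using w UD by (intro minus_mult_distrib_mat_vec[symmetric, of _ D D]) auto
    also have "\<dots> = ?C (Suc (Suc l)) *\<^sub>v w"
      using UD by (simp add: spec_mat_minus mult.assoc)
    finally show ?case using Suc by simp
  qed
  thus ?thesis by (simp add: s_def)
qed

text \<open>Each new step is shared by all branches with \<open>k < m\<close> and controlled on that
  condition, so the calls are those of the longest branch and not the sum over the branches.\<close>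

lemma impl_block_walk:
  assumes W: "impl D d n c W" and D: "D dvd n"
  shows "impl D d (M * n) (k * c) (\<lambda>H. block_diag M n (\<lambda>m. walk_steps n D (W H) (min m k)))"
proof (induction k)
  case 0
  have "impl D d (M * n) 0 (\<lambda>_. block_diag M n (\<lambda>m. 1\<^sub>m n))"
    by (intro impl_gate unitary_block_diag unitary_mat_one)
  thus ?case by simp
next
  case (Suc k)
  let ?V = "\<lambda>H. (if even k then W H else mat_adjoint (W H)) * refl_mat n D"
  have "impl D d n c (\<lambda>H. if even k then W H else mat_adjoint (W H))"
    using W impl_adjoint[OF W] by (cases "even k") simp_all
  from impl_comp[OF this impl_gate[OF unitary_refl_mat[of n D]]]
  have V: "impl D d n c ?V" by simp
  have Vc: "?V H \<in> carrier_mat n n" for H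
    by (rule unitary_matD(1)[OF impl_unitary[OF V, of H]])
  have Sc: "walk_steps n D (W H) l \<in> carrier_mat n n" for H l
    by (rule unitary_matD(1)[OF unitary_walk_steps[OF impl_unitary[OF W]]])
  have "block_diag M n (\<lambda>m. if k < m then ?V H else 1\<^sub>m n) * block_diag M n (\<lambda>m. walk_steps n D (W H) (min m k))
     = block_diag M n (\<lambda>m. walk_steps n D (W H) (min m (Suc k)))" for H
  proof -
    have "block_diag M n (\<lambda>m. if k < m then ?V H else 1\<^sub>m n) * block_diag M n (\<lambda>m. walk_steps n D (W H) (min m k))
      = block_diag M n (\<lambda>m. (if k < m then ?V H else 1\<^sub>m n) * walk_steps n D (W H) (min m k))"
      by (rule block_diag_mult) (use Vc Sc in auto)
    also have "(\<lambda>m. (if k < m then ?V H else 1\<^sub>m n) * walk_steps n D (W H) (min m k))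
       = (\<lambda>m. walk_steps n D (W H) (min m (Suc k)))"
    proof
      fix m
      show "(if k < m then ?V H else 1\<^sub>m n) * walk_steps n D (W H) (min m k) = walk_steps n D (W H) (min m (Suc k))"
      proof (cases "k < m")
        case True
        hence "min m k = k" "min m (Suc k) = Suc k" by auto
        thus ?thesis using True by simp
      next
        case False
        hence "min m k = m" "min m (Suc k) = m" by auto
        thus ?thesis using False left_mult_one_mat[OF Sc] by simp
      qed
    qed
    finally show ?thesis .
  qed
  moreover have "impl D d (M * n) (c + k * c) (\<lambda>H. block_diag M n (\<lambda>m. if k < m then ?V H else 1\<^sub>m n)
      * block_diag M n (\<lambda>m. walk_steps n D (W H) (min m k)))"
    by (intro impl_comp Suc.IH impl_block_diag[OF V D])
  ultimately show ?case by simp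
qed

section \<open>Linear combinations of unitaries\<close>

text \<open>Two preparation vectors are used because the coefficients
  \<open>cnj (w $ m) * u $ m\<close> are complex, and because surplus weight of one vector can be
  put where the other vanishes.\<close>

definition lcu :: "nat \<Rightarrow> nat \<Rightarrow> complex vec \<Rightarrow> complex vec \<Rightarrow> (nat \<Rightarrow> complex mat) \<Rightarrow> complex mat" where
  "lcu M n u w F = mat_adjoint (completion w \<otimes>\<^sub>m 1\<^sub>m n) * (block_diag M n F * (completion u \<otimes>\<^sub>m 1\<^sub>m n))"

lemma embed_mat_mult_tensor:
  assumes D: "D \<le> n" and M: "0 < M" and v: "v \<in> carrier_vec D"
  shows "embed_mat (M * n) D *\<^sub>v v = unit_vec M 0 \<otimes>\<^sub>v (embed_mat n D *\<^sub>v v)"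
proof -
  have E: "embed_mat n D *\<^sub>v v \<in> carrier_vec n" using v by (rule mult_mat_vec_carrier[OF embed_mat_carrier])
  have "embed_mat (M * n) D = embed_mat (M * n) n * embed_mat n D"
    using D M by (intro embed_mat_comp[symmetric]) auto
  hence "embed_mat (M * n) D *\<^sub>v v = embed_mat (M * n) n *\<^sub>v (embed_mat n D *\<^sub>v v)"
    by (simp add: assoc_mult_mat_vec[OF embed_mat_carrier embed_mat_carrier v])
  thus ?thesis using embed_mat_tensor[OF E M] by simp
qed

lemma block_diag_mult_tensor:
  assumes F: "\<And>m. F m \<in> carrier_mat n n" and u: "u \<in> carrier_vec M" and e: "e \<in> carrier_vec n"
    and i: "m < M" "i < n"
  shows "(block_diag M n F *\<^sub>v (u \<otimes>\<^sub>v e)) $ (m * n + i) = u $ m * (F m *\<^sub>v e) $ i"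
proof -
  have "(block_diag M n F *\<^sub>v (u \<otimes>\<^sub>v e)) $ (m * n + i)
      = (\<Sum>a<M. \<Sum>b<n. block_diag M n F $$ (m * n + i, a * n + b) * (u \<otimes>\<^sub>v e) $ (a * n + b))"
    using mult_mat_vec_index_sum[OF block_diag_carrier tensor_vec_carrier[OF u e] mult_lt_mult[OF i]]
    unfolding sum_lessThan_mult .
  also have "\<dots> = (\<Sum>a<M. \<Sum>b<n. if a = m then u $ m * (F m $$ (i, b) * e $ b) else 0)"
    using i by (intro sum.cong refl) (auto simp: block_diag_def mult_lt_mult tensor_vec_index_add[OF u e])
  also have "\<dots> = (\<Sum>a<M. if a = m then \<Sum>b<n. u $ m * (F m $$ (i, b) * e $ b) else 0)"
    by (intro sum.cong refl) simp
  also have "\<dots> = u $ m * (\<Sum>b<n. F m $$ (i, b) * e $ b)"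
    using i(1) by (simp add: sum_distrib_left)
  finally show ?thesis unfolding mult_mat_vec_index_sum[OF F e i(2)] .
qed

text \<open>The adjoint preparation is moved to the other side of the scalar product, where it turns
  the zero state of the selecting register into \<open>w\<close>; each branch then meets its own
  coefficient.\<close>

lemma top_vec_lcu:
  assumes F: "\<And>m. F m \<in> carrier_mat n n" and D: "D \<le> n" and M: "0 < M"
    and u: "u \<in> carrier_vec M" "vec_l2 u = 1" and w: "w \<in> carrier_vec M" "vec_l2 w = 1"
    and v: "v \<in> carrier_vec D" and i: "i < D"
  shows "top_vec D (lcu M n u w F *\<^sub>v (embed_mat (M * n) D *\<^sub>v v)) $ i
    = (\<Sum>m<M. cnj (w $ m) * u $ m * top_vec D (F m *\<^sub>v (embed_mat n D *\<^sub>v v)) $ i)"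
proof -
  let ?e = "embed_mat n D *\<^sub>v v" and ?N = "M * n"
  let ?B = "\<lambda>u. completion u \<otimes>\<^sub>m 1\<^sub>m n"
  have e: "?e \<in> carrier_vec n" using v by (rule mult_mat_vec_carrier[OF embed_mat_carrier])
  have i': "i < n" using i D by simp
  have iN: "i < ?N" using mult_lt_mult[OF M i'] by simp
  have Bc: "?B z \<in> carrier_mat ?N ?N" if "z \<in> carrier_vec M" for z
    by (rule tensor_mat_carrier[OF unitary_matD(1)[OF unitary_mat_completion[OF that]] one_carrier_mat])
  have Be: "?B z *\<^sub>v (unit_vec M 0 \<otimes>\<^sub>v y) = z \<otimes>\<^sub>v y"
    if "z \<in> carrier_vec M" "vec_l2 z = 1" "y \<in> carrier_vec n" for z y
    using tensor_mat_mult_vec[OF unitary_matD(1)[OF unitary_mat_completion[OF that(1)]] one_carrier_mat unit_vec_carrier that(3)]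
      completion_mult_unit_vec[OF that(1,2) M] that(3) by simp
  have ue: "u \<otimes>\<^sub>v ?e \<in> carrier_vec ?N" by (rule tensor_vec_carrier[OF u(1) e])
  let ?y = "block_diag M n F *\<^sub>v (u \<otimes>\<^sub>v ?e)"
  have y: "?y \<in> carrier_vec ?N" by (rule mult_sq_vec_carrier[OF block_diag_carrier ue])
  have z: "unit_vec M 0 \<otimes>\<^sub>v ?e \<in> carrier_vec ?N" using e by simp
  have "lcu M n u w F *\<^sub>v (embed_mat ?N D *\<^sub>v v)
      = mat_adjoint (?B w) *\<^sub>v ((block_diag M n F * ?B u) *\<^sub>v (unit_vec M 0 \<otimes>\<^sub>v ?e))"
    unfolding lcu_def embed_mat_mult_tensor[OF D M v]
    by (rule assoc_mult_mat_vec[OF mat_adjoint_carrier[OF Bc[OF w(1)]] mult_sq_carrier[OF block_diag_carrier Bc[OF u(1)]] z])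
  also have "(block_diag M n F * ?B u) *\<^sub>v (unit_vec M 0 \<otimes>\<^sub>v ?e) = ?y"
    unfolding assoc_mult_mat_vec[OF block_diag_carrier Bc[OF u(1)] z] Be[OF u e] ..
  finally have 1: "lcu M n u w F *\<^sub>v (embed_mat ?N D *\<^sub>v v) = mat_adjoint (?B w) *\<^sub>v ?y" .
  have a: "mat_adjoint (?B w) *\<^sub>v ?y \<in> carrier_vec ?N"
    by (rule mult_sq_vec_carrier[OF mat_adjoint_carrier[OF Bc[OF w(1)]] y])
  have uN: "unit_vec ?N i = unit_vec M 0 \<otimes>\<^sub>v unit_vec n i" using tensor_unit_vec[OF M i'] by simp
  have wi: "w \<otimes>\<^sub>v unit_vec n i \<in> carrier_vec ?N" by (rule tensor_vec_carrier[OF w(1) unit_vec_carrier])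
  have "(mat_adjoint (?B w) *\<^sub>v ?y) $ i = (\<Sum>j<?N. if j = i then (mat_adjoint (?B w) *\<^sub>v ?y) $ j else 0)"
    using iN by (simp del: index_mult_mat_vec)
  also have "\<dots> = (mat_adjoint (?B w) *\<^sub>v ?y) \<bullet>c unit_vec ?N i"
    unfolding cscalar_prod_sum[OF unit_vec_carrier]
    using iN by (intro sum.cong refl) (simp del: index_mult_mat_vec)
  also have "\<dots> = ?y \<bullet>c (mat_adjoint (mat_adjoint (?B w)) *\<^sub>v unit_vec ?N i)"
    by (rule cscalar_prod_adjoint[OF mat_adjoint_carrier[OF Bc[OF w(1)]] y unit_vec_carrier])
  also have "\<dots> = ?y \<bullet>c (w \<otimes>\<^sub>v unit_vec n i)"
    unfolding mat_adjoint_adjoint uN Be[OF w unit_vec_carrier] ..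
  also have "\<dots> = (\<Sum>m<M. \<Sum>j<n. if j = i then cnj (w $ m) * u $ m * (F m *\<^sub>v ?e) $ j else 0)"
    unfolding cscalar_prod_sum[OF wi] sum_lessThan_mult using i'
    by (intro sum.cong refl) (simp add: block_diag_mult_tensor[OF F u(1) e] tensor_vec_index_add[OF w(1) unit_vec_carrier]
        del: index_mult_mat_vec)
  also have "\<dots> = (\<Sum>m<M. cnj (w $ m) * u $ m * (F m *\<^sub>v ?e) $ i)"
    using i' by (simp del: index_mult_mat_vec)
  finally show ?thesis unfolding 1 using i by (simp add: top_vec_def del: index_mult_mat_vec)
qed

lemma unitary_lcu:
  assumes "\<And>m. unitary_mat n (F m)" "u \<in> carrier_vec M" "w \<in> carrier_vec M"
  shows "unitary_mat (M * n) (lcu M n u w F)"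
  unfolding lcu_def using assms
  by (intro unitary_mat_mult unitary_mat_adjoint unitary_mat_tensor unitary_mat_completion unitary_mat_one unitary_block_diag)

lemma impl_lcu:
  assumes "impl D d (M * n) c (\<lambda>H. block_diag M n (F H))" "u \<in> carrier_vec M" "w \<in> carrier_vec M"
  shows "impl D d (M * n) c (\<lambda>H. lcu M n u w (F H))"
proof -
  have g: "unitary_mat (M * n) (completion z \<otimes>\<^sub>m 1\<^sub>m n)" if "z \<in> carrier_vec M" for z
    using that by (intro unitary_mat_tensor unitary_mat_completion unitary_mat_one)
  have "impl D d (M * n) (0 + (c + 0)) (\<lambda>H. lcu M n u w (F H))"
    unfolding lcu_def
    by (intro impl_comp impl_gate[OF unitary_mat_adjoint[OF g]] impl_gate[OF g] assms)
  thus ?thesis by simp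
qed

section \<open>Oblivious amplitude amplification\<close>

text \<open>The usual product -A R A' R A with A' the adjoint of \<open>A\<close>; the minus sign is
  carried by the middle diagonal, which is -R.\<close>

definition amplify :: "nat \<Rightarrow> nat \<Rightarrow> complex mat \<Rightarrow> complex mat" where
  "amplify N D A = A * (diag_of N (\<lambda>i. if i < D then - 1 else 1) * (mat_adjoint A * (refl_mat N D * A)))"

lemma impl_amplify:
  assumes "impl D d N c A" shows "impl D d N (3 * c) (\<lambda>H. amplify N D (A H))"
proof -
  have "impl D d N (c + (0 + (c + (0 + c)))) (\<lambda>H. amplify N D (A H))"
    unfolding amplify_def
    by (intro impl_comp impl_adjoint assms impl_gate unitary_refl_mat unitary_diag_of) auto
  moreover have "c + (0 + (c + (0 + c))) = 3 * c" by simp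
  ultimately show ?thesis by (simp only:)
qed

text \<open>Oblivious amplitude amplification: one round of amplification turns the amplitude \<open>1/2\<close>
  into \<open>1\<close>, exactly if \<open>M\<close> is unitary.\<close>

lemma amplify_embed:
  assumes A: "unitary_mat N A" and D: "D \<le> N" and M: "M \<in> carrier_mat D D"
    and blk: "\<And>v. v \<in> carrier_vec D \<Longrightarrow> top_vec D (A *\<^sub>v (embed_mat N D *\<^sub>v v)) = (1 / 2) \<cdot>\<^sub>v (M *\<^sub>v v)"
    and v: "v \<in> carrier_vec D"
  shows "amplify N D A *\<^sub>v (embed_mat N D *\<^sub>v v) = embed_mat N D *\<^sub>v (M *\<^sub>v v)
    + A *\<^sub>v (embed_mat N D *\<^sub>v (v - mat_adjoint M *\<^sub>v (M *\<^sub>v v)))"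
proof -
  let ?E = "embed_mat N D" and ?Rn = "diag_of N (\<lambda>i. if i < D then - 1 else 1)" and ?R = "refl_mat N D"
  note AD = unitary_matD[OF A]
  have Ac: "mat_adjoint A \<in> carrier_mat N N" using AD by simp
  have E: "?E *\<^sub>v z \<in> carrier_vec N" if "z \<in> carrier_vec D" for z
    using that by (rule mult_mat_vec_carrier[OF embed_mat_carrier])
  have Rnc: "?Rn \<in> carrier_mat N N" by simp
  have Rn: "?Rn *\<^sub>v z = z - 2 \<cdot>\<^sub>v (?E *\<^sub>v top_vec D z)" if "z \<in> carrier_vec N" for z
    unfolding diag_of_mult_vec[OF that] embed_mat_mult_vec[OF top_vec_carrier]
    using that by (intro eq_vecI) (auto simp: top_vec_def)
  have Mv: "M *\<^sub>v v \<in> carrier_vec D" using M v by simp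
  have MMv: "mat_adjoint M *\<^sub>v (M *\<^sub>v v) \<in> carrier_vec D" using mat_adjoint_carrier[OF M] Mv by simp
  have block: "top_block D A = (1 / 2) \<cdot>\<^sub>m M"
  proof (rule mat_eqI_unit_vec[of _ D D])
    fix j assume "j < D"
    show "top_block D A *\<^sub>v unit_vec D j = ((1 / 2) \<cdot>\<^sub>m M) *\<^sub>v unit_vec D j"
      using blk[OF unit_vec_carrier] top_vec_mult_embed[OF AD(1) unit_vec_carrier D]
        smult_mat_mult_vec[OF M unit_vec_carrier] by metis
  qed (use M in auto)
  have adj: "top_vec D (mat_adjoint A *\<^sub>v (?E *\<^sub>v z)) = (1 / 2) \<cdot>\<^sub>v (mat_adjoint M *\<^sub>v z)" if z: "z \<in> carrier_vec D" for z
  proof -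
    have "mat_adjoint ((1 / 2) \<cdot>\<^sub>m M) = (1 / 2) \<cdot>\<^sub>m mat_adjoint M" by (simp add: mat_adjoint_smult)
    thus ?thesis
      using smult_mat_mult_vec[OF mat_adjoint_carrier[OF M] z]
      by (simp add: top_vec_mult_embed[OF Ac z D] top_block_adjoint[OF AD(1) D] block)
  qed
  define y where "y = A *\<^sub>v (?E *\<^sub>v v)"
  have y: "y \<in> carrier_vec N" unfolding y_def by (rule mult_sq_vec_carrier[OF AD(1) E[OF v]])
  have Ay: "mat_adjoint A *\<^sub>v y = ?E *\<^sub>v v"
  proof -
    have "mat_adjoint A *\<^sub>v y = (mat_adjoint A * A) *\<^sub>v (?E *\<^sub>v v)"
      unfolding y_def by (rule assoc_mult_mat_vec[OF Ac AD(1) E[OF v], symmetric])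
    thus ?thesis unfolding AD(2) using E[OF v] by simp
  qed
  have "?R *\<^sub>v y = 2 \<cdot>\<^sub>v (?E *\<^sub>v ((1 / 2) \<cdot>\<^sub>v (M *\<^sub>v v))) - y"
    unfolding refl_mat_mult_vec[OF y D] unfolding y_def blk[OF v] ..
  also have "?E *\<^sub>v ((1 / 2) \<cdot>\<^sub>v (M *\<^sub>v v)) = (1 / 2) \<cdot>\<^sub>v (?E *\<^sub>v (M *\<^sub>v v))"
    by (rule mult_mat_vec[OF embed_mat_carrier Mv])
  finally have Ry: "?R *\<^sub>v y = ?E *\<^sub>v (M *\<^sub>v v) - y" by (simp add: smult_smult_assoc)
  define z where "z = mat_adjoint A *\<^sub>v (?E *\<^sub>v (M *\<^sub>v v)) - ?E *\<^sub>v v"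
  have AEM: "mat_adjoint A *\<^sub>v (?E *\<^sub>v (M *\<^sub>v v)) \<in> carrier_vec N"
    by (rule mult_sq_vec_carrier[OF Ac E[OF Mv]])
  have z: "z \<in> carrier_vec N" unfolding z_def using AEM E[OF v] by simp
  \<comment> \<open>The top component of \<open>y\<close> is half of \<open>M *\<^sub>v v\<close>,
    so the reflection yields the embedded \<open>M *\<^sub>v v\<close> minus \<open>y\<close>, and
    the adjoint of \<open>A\<close> turns \<open>y\<close> back into the embedded
    \<open>v\<close>.\<close>
  have ARy: "mat_adjoint A *\<^sub>v (?R *\<^sub>v y) = z"
    unfolding Ry z_def Ay[symmetric] by (rule mult_minus_distrib_mat_vec[OF Ac E[OF Mv] y])
  have tz: "top_vec D z = (1 / 2) \<cdot>\<^sub>v (mat_adjoint M *\<^sub>v (M *\<^sub>v v)) - v"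
    unfolding z_def top_vec_minus[OF AEM E[OF v] D] adj[OF Mv] top_vec_embed[OF v D] ..
  \<comment> \<open>Subtracting twice the top component of \<open>z\<close> replaces -v by v - M'M
    v, with M' the adjoint of \<open>M\<close>. This measures how far \<open>M\<close> is from an
    isometry and is the only error term.\<close>
  have "?Rn *\<^sub>v z = mat_adjoint A *\<^sub>v (?E *\<^sub>v (M *\<^sub>v v)) + ?E *\<^sub>v (v - mat_adjoint M *\<^sub>v (M *\<^sub>v v))"
  proof -
    let ?m = "mat_adjoint M *\<^sub>v (M *\<^sub>v v)"
    have d: "(1 / 2) \<cdot>\<^sub>v ?m - v \<in> carrier_vec D" "v - ?m \<in> carrier_vec D" using v MMv by auto
    note cs = carrier_vecD[OF AEM] carrier_vecD[OF v] carrier_vecD[OF MMv]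
    show ?thesis unfolding Rn[OF z] tz embed_mat_mult_vec[OF d(1)] embed_mat_mult_vec[OF d(2)]
      unfolding z_def embed_mat_mult_vec[OF v]
      using cs by (intro eq_vecI) (auto simp del: index_mult_mat_vec dim_mult_mat_vec)
  qed
  note RnZ = this
  have A1: "?R * A \<in> carrier_mat N N" "mat_adjoint A * (?R * A) \<in> carrier_mat N N"
    "?Rn * (mat_adjoint A * (?R * A)) \<in> carrier_mat N N"
    using AD(1) Ac by auto
  have "amplify N D A *\<^sub>v (?E *\<^sub>v v) = A *\<^sub>v (?Rn *\<^sub>v (mat_adjoint A *\<^sub>v (?R *\<^sub>v y)))"
    unfolding amplify_def y_def
    by (simp only: assoc_mult_mat_vec[OF AD(1) A1(3) E[OF v]] assoc_mult_mat_vec[OF Rnc A1(2) E[OF v]]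
       assoc_mult_mat_vec[OF Ac A1(1) E[OF v]] assoc_mult_mat_vec[OF refl_mat_carrier AD(1) E[OF v]])
  also have "\<dots> = A *\<^sub>v (mat_adjoint A *\<^sub>v (?E *\<^sub>v (M *\<^sub>v v)))
      + A *\<^sub>v (?E *\<^sub>v (v - mat_adjoint M *\<^sub>v (M *\<^sub>v v)))"
    unfolding ARy RnZ by (rule mult_add_distrib_mat_vec[OF AD(1) AEM]) (use E v MMv in simp)
  also have "A *\<^sub>v (mat_adjoint A *\<^sub>v (?E *\<^sub>v (M *\<^sub>v v))) = (A * mat_adjoint A) *\<^sub>v (?E *\<^sub>v (M *\<^sub>v v))"
    by (rule assoc_mult_mat_vec[OF AD(1) Ac E[OF Mv], symmetric])
  also have "\<dots> = ?E *\<^sub>v (M *\<^sub>v v)" unfolding AD(3) using E[OF Mv] by simp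
  finally show ?thesis .
qed

section \<open>Chebyshev expansions of the exponential\<close>

text \<open>The weight \<open>a\<close> bounds the factor by which a linear combination of unitaries
  has to attenuate the function, so it is tracked along with the expansion.\<close>

definition cheb_comb :: "nat \<Rightarrow> real \<Rightarrow> (real \<Rightarrow> complex) \<Rightarrow> bool" where
  "cheb_comb K a f \<longleftrightarrow> (\<exists>c. (\<Sum>m\<le>K. cmod (c m)) \<le> a \<and>
     (\<forall>x. f x = (\<Sum>m\<le>K. c m * complex_of_real (cheb m x))))"

lemma cheb_comb_cheb: "m \<le> K \<Longrightarrow> cheb_comb K 1 (\<lambda>x. complex_of_real (cheb m x))"
  unfolding cheb_comb_def
  by (rule exI[of _ "\<lambda>l. if l = m then 1 else 0"]) (simp add: if_distrib[of cmod] if_distrib[of "\<lambda>z. z * _"] cong: if_cong)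

lemma cheb_comb_sum:
  assumes "finite I" "\<And>i. i \<in> I \<Longrightarrow> cheb_comb K 1 (g i)"
  shows "cheb_comb K (\<Sum>i\<in>I. cmod (b i)) (\<lambda>x. \<Sum>i\<in>I. b i * g i x)"
proof -
  have "\<exists>c. \<forall>i\<in>I. (\<Sum>m\<le>K. cmod (c i m)) \<le> 1 \<and> (\<forall>x. g i x = (\<Sum>m\<le>K. c i m * complex_of_real (cheb m x)))"
    by (rule bchoice) (use assms(2) in \<open>auto simp: cheb_comb_def\<close>)
  then obtain c where "\<forall>i\<in>I. (\<Sum>m\<le>K. cmod (c i m)) \<le> 1 \<and> (\<forall>x. g i x = (\<Sum>m\<le>K. c i m * complex_of_real (cheb m x)))"
    by (rule exE)
  hence c: "\<And>i. i \<in> I \<Longrightarrow> (\<Sum>m\<le>K. cmod (c i m)) \<le> 1"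
    "\<And>i x. i \<in> I \<Longrightarrow> g i x = (\<Sum>m\<le>K. c i m * complex_of_real (cheb m x))" by simp_all
  have "(\<Sum>m\<le>K. cmod (\<Sum>i\<in>I. b i * c i m)) \<le> (\<Sum>m\<le>K. \<Sum>i\<in>I. cmod (b i) * cmod (c i m))"
    by (intro sum_mono order_trans[OF norm_sum]) (simp add: norm_mult)
  also have "\<dots> = (\<Sum>i\<in>I. cmod (b i) * (\<Sum>m\<le>K. cmod (c i m)))"
    by (subst sum.swap) (simp add: sum_distrib_left)
  also have "\<dots> \<le> (\<Sum>i\<in>I. cmod (b i) * 1)" by (intro sum_mono mult_left_mono c) auto
  finally have 1: "(\<Sum>m\<le>K. cmod (\<Sum>i\<in>I. b i * c i m)) \<le> (\<Sum>i\<in>I. cmod (b i))" by simp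
  have 2: "(\<Sum>i\<in>I. b i * g i x) = (\<Sum>m\<le>K. (\<Sum>i\<in>I. b i * c i m) * complex_of_real (cheb m x))" for x
  proof -
    have "(\<Sum>i\<in>I. b i * g i x) = (\<Sum>i\<in>I. \<Sum>m\<le>K. b i * c i m * complex_of_real (cheb m x))"
      by (intro sum.cong refl) (simp add: c(2) sum_distrib_left mult.assoc)
    thus ?thesis by (subst (asm) sum.swap) (simp add: sum_distrib_right)
  qed
  show ?thesis unfolding cheb_comb_def
    by (rule exI[of _ "\<lambda>m. \<Sum>i\<in>I. b i * c i m"]) (use 1 2 in simp)
qed

text \<open>x T_m = (T_(m-1) + T_(m+1)) / 2, the three-term recurrence read backwards;
  multiplication by x does not raise the weight.\<close>

lemma cheb_comb_times_cheb:
  assumes "m \<le> K"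
  shows "cheb_comb (Suc K) 1 (\<lambda>x. complex_of_real x * complex_of_real (cheb m x))"
proof (cases m)
  case 0
  thus ?thesis using cheb_comb_cheb[of "Suc 0" "Suc K"] by simp
next
  case (Suc l)
  have e: "complex_of_real x * complex_of_real (cheb m x)
      = (\<Sum>i\<in>{l, Suc m}. (1 / 2) * complex_of_real (cheb i x))" for x
    by (simp add: Suc field_simps)
  have "cheb_comb (Suc K) (\<Sum>i\<in>{l, Suc m}. cmod (1 / 2)) (\<lambda>x. \<Sum>i\<in>{l, Suc m}. (1 / 2) * complex_of_real (cheb i x))"
    by (rule cheb_comb_sum) (use assms Suc in \<open>auto intro: cheb_comb_cheb\<close>)
  moreover have "(\<Sum>i\<in>{l, Suc m}. cmod (1 / 2)) = 1" by (simp add: Suc norm_divide)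
  ultimately show ?thesis by (simp only: e)
qed

lemma cheb_comb_mono: "cheb_comb K a f \<Longrightarrow> a \<le> b \<Longrightarrow> cheb_comb K b f"
  unfolding cheb_comb_def by (meson order_trans)

lemma cheb_comb_Suc: "cheb_comb K a f \<Longrightarrow> cheb_comb (Suc K) a f"
proof -
  assume "cheb_comb K a f"
  then obtain c where c: "(\<Sum>m\<le>K. cmod (c m)) \<le> a" "\<And>x. f x = (\<Sum>m\<le>K. c m * complex_of_real (cheb m x))"
    unfolding cheb_comb_def by blast
  show ?thesis unfolding cheb_comb_def
    by (rule exI[of _ "\<lambda>m. if m \<le> K then c m else 0"]) (use c in auto)
qed

lemma cheb_comb_power: "cheb_comb K 1 (\<lambda>x. complex_of_real x ^ K)"
proof (induction K)
  case 0
  thus ?case using cheb_comb_cheb[of 0 0] by simp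
next
  case (Suc K)
  then obtain c where c: "(\<Sum>m\<le>K. cmod (c m)) \<le> 1"
    "\<And>x. complex_of_real x ^ K = (\<Sum>m\<le>K. c m * complex_of_real (cheb m x))"
    unfolding cheb_comb_def by blast
  have "cheb_comb (Suc K) (\<Sum>m\<in>{..K}. cmod (c m)) (\<lambda>x. \<Sum>m\<in>{..K}. c m * (complex_of_real x * complex_of_real (cheb m x)))"
    by (rule cheb_comb_sum) (auto intro: cheb_comb_times_cheb)
  moreover have "(\<Sum>m\<in>{..K}. c m * (complex_of_real x * complex_of_real (cheb m x))) = complex_of_real x ^ Suc K" for x
    by (simp add: c(2) sum_distrib_left mult_ac)
  ultimately show ?case using c(1) by (auto intro: cheb_comb_mono)
qed

lemma cheb_comb_power_le: "l \<le> K \<Longrightarrow> cheb_comb K 1 (\<lambda>x. complex_of_real x ^ l)"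
proof (induction K)
  case 0
  thus ?case using cheb_comb_power[of 0] by simp
next
  case (Suc K)
  show ?case
  proof (cases "l = Suc K")
    case True
    thus ?thesis using cheb_comb_power[of "Suc K"] by (simp only:)
  next
    case False
    thus ?thesis using Suc by (intro cheb_comb_Suc) auto
  qed
qed

definition taylor :: "real \<Rightarrow> nat \<Rightarrow> real \<Rightarrow> complex" where
  "taylor s K x = (\<Sum>l\<le>K. (- \<i> * complex_of_real (s * x)) ^ l / fact l)"

text \<open>Every monomial has weight at most 1, so the total weight is at most the sum of s^l / l!,
  which stays below 2 at every degree when s \<le> 1 / 2.\<close>

lemma cheb_comb_taylor:
  assumes s: "0 \<le> s" "s \<le> 1 / 2"
  shows "cheb_comb K 2 (taylor s K)"
proof -
  let ?b = "\<lambda>l. (- \<i> * complex_of_real s) ^ l / fact l"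
  have 1: "cheb_comb K (\<Sum>l\<in>{..K}. cmod (?b l)) (\<lambda>x. \<Sum>l\<in>{..K}. ?b l * complex_of_real x ^ l)"
    by (rule cheb_comb_sum) (auto intro: cheb_comb_power_le)
  have 2: "(\<lambda>x. \<Sum>l\<in>{..K}. ?b l * complex_of_real x ^ l) = taylor s K"
  proof
    fix x
    have "- \<i> * complex_of_real (s * x) = (- \<i> * complex_of_real s) * complex_of_real x" by simp
    thus "(\<Sum>l\<in>{..K}. ?b l * complex_of_real x ^ l) = taylor s K x"
      unfolding taylor_def by (simp only: power_mult_distrib times_divide_eq_left)
  qed
  have 3: "(\<Sum>l\<in>{..K}. cmod (?b l)) \<le> 2"
  proof -
    have "(\<Sum>l\<in>{..K}. cmod (?b l)) \<le> (\<Sum>l\<le>K. (1 / 2) ^ l)"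
    proof (rule sum_mono)
      fix l
      have "cmod (?b l) = s ^ l / fact l" using s by (simp add: norm_divide norm_power norm_mult)
      also have "\<dots> \<le> (1 / 2) ^ l / 1" using s by (intro frac_le power_mono) auto
      finally show "cmod (?b l) \<le> (1 / 2) ^ l" by simp
    qed
    also have "\<dots> = 2 - (1 / 2) ^ K" by (induction K) auto
    also have "\<dots> \<le> (2 :: real)" by simp
    finally show ?thesis .
  qed
  show ?thesis by (rule cheb_comb_mono[OF 1[unfolded 2] 3])
qed

text \<open>The omitted term of index K + 1 + l is at most 2^-(K+1) 2^-l, and the geometric series
  doubles its first term.\<close>

lemma exp_taylor_tail:
  assumes z: "cmod z \<le> 1 / 2"
  shows "cmod ((\<Sum>l\<le>K. z ^ l / fact l) - exp z) \<le> (1 / 2) ^ K"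
proof -
  let ?f = "\<lambda>l. z ^ l / fact l"
  have f: "?f sums exp z"
    using exp_converges[of z] by (simp add: scaleR_conv_of_real divide_inverse mult.commute)
  have le: "cmod (?f (l + Suc K)) \<le> (1 / 2) ^ Suc K * (1 / 2) ^ l" for l
  proof -
    have "cmod (?f (l + Suc K)) = cmod z ^ (l + Suc K) / fact (l + Suc K)"
      by (simp only: norm_divide norm_power norm_fact)
    also have "\<dots> \<le> (1 / 2) ^ (l + Suc K) / 1"
      by (intro frac_le power_mono z) (simp_all add: fact_ge_1 del: fact_Suc)
    also have "\<dots> = (1 / 2) ^ Suc K * (1 / 2) ^ l" by (simp only: power_add mult.commute div_by_1)
    finally show ?thesis .
  qed
  have geo: "(\<lambda>l. (1 / 2) ^ Suc K * (1 / 2) ^ l) sums ((1 / 2) ^ Suc K * (1 / (1 - 1 / 2)) :: real)"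
    by (intro sums_mult geometric_sums) simp
  have "exp z = (\<Sum>l. ?f (l + Suc K)) + (\<Sum>l<Suc K. ?f l)"
    unfolding sums_unique[OF f] by (rule suminf_split_initial_segment[OF sums_summable[OF f]])
  hence "exp z - (\<Sum>l\<le>K. ?f l) = (\<Sum>l. ?f (l + Suc K))"
    by (simp only: lessThan_Suc_atMost add_diff_cancel_right')
  hence "cmod (exp z - (\<Sum>l\<le>K. ?f l)) = cmod (\<Sum>l. ?f (l + Suc K))" by (rule arg_cong)
  also have "\<dots> \<le> (\<Sum>l. (1 / 2) ^ Suc K * (1 / 2) ^ l)"
    by (rule norm_suminf_le[OF le sums_summable[OF geo]])
  also have "\<dots> = (1 / 2) ^ K" unfolding sums_unique[OF geo, symmetric] by simp
  finally show ?thesis by (simp only: norm_minus_commute)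
qed

lemma taylor_error:
  assumes s: "0 \<le> s" "s \<le> 1 / 2" and x: "\<bar>x\<bar> \<le> 1"
  shows "cmod (taylor s K x - exp (- \<i> * complex_of_real (s * x))) \<le> (1 / 2) ^ K"
  unfolding taylor_def
proof (rule exp_taylor_tail)
  show "cmod (- \<i> * complex_of_real (s * x)) \<le> 1 / 2"
    using s x mult_mono[of "\<bar>s\<bar>" "1 / 2" "\<bar>x\<bar>" 1] by (simp add: norm_mult abs_mult)
qed

lemma sum_lessThan_add_3:
  "(\<Sum>m<K + 3. f m) = (\<Sum>m\<le>K. f m) + f (K + 1) + f (K + 2)" for f :: "nat \<Rightarrow> 'a :: comm_monoid_add"
  by (simp add: numeral_3_eq_3 lessThan_Suc_atMost)

text \<open>Each coefficient is halved; both vectors get the square root of its absolute value and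
  \<open>w\<close> also its phase. The padding sits at index K + 1 in \<open>u\<close> and at K + 2
  in \<open>w\<close>, so it normalises both without entering the combination, and the factor is
  exactly 1/2 even if the weight is below 2.\<close>

lemma lcu_vectors:
  assumes s: "0 \<le> s" "s \<le> 1 / 2"
  obtains u w where "u \<in> carrier_vec (K + 3)" "vec_l2 u = 1" "w \<in> carrier_vec (K + 3)" "vec_l2 w = 1"
    "\<And>x. (\<Sum>m<K + 3. cnj (w $ m) * u $ m * complex_of_real (cheb (min m K) x)) = taylor s K x / 2"
proof -
  obtain c where c: "(\<Sum>m\<le>K. cmod (c m)) \<le> 2" "\<And>x. taylor s K x = (\<Sum>m\<le>K. c m * complex_of_real (cheb m x))"
    using cheb_comb_taylor[OF s, of K] unfolding cheb_comb_def by blast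
  define b where "b = (\<lambda>m. sqrt (cmod (c m) / 2))"
  define e where "e = sqrt (1 - (\<Sum>m\<le>K. cmod (c m)) / 2)"
  define u where "u = vec (K + 3) (\<lambda>m. if m \<le> K then complex_of_real (b m) else if m = K + 1 then complex_of_real e else 0)"
  define w where "w = vec (K + 3) (\<lambda>m. if m \<le> K then cnj (sgn (c m)) * complex_of_real (b m)
    else if m = K + 2 then complex_of_real e else 0)"
  note split = sum_lessThan_add_3
  have b2: "(b m)\<^sup>2 = cmod (c m) / 2" for m by (simp add: b_def)
  have e2: "e\<^sup>2 = 1 - (\<Sum>m\<le>K. cmod (c m)) / 2" using c(1) by (simp add: e_def)
  have "(vec_l2 u)\<^sup>2 = (\<Sum>m\<le>K. (b m)\<^sup>2) + e\<^sup>2"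
  proof -
    have "dim_vec u = K + 3" by (simp add: u_def)
    thus ?thesis unfolding vec_l2_square by (simp only: split) (simp add: u_def b_def e_def c)
  qed
  also have "\<dots> = 1" unfolding b2 e2 by (simp add: sum_divide_distrib)
  finally have u1: "vec_l2 u = 1" using vec_l2_nonneg[of u] by (auto simp: power2_eq_1_iff)
  have "(vec_l2 w)\<^sup>2 = (\<Sum>m\<le>K. (b m)\<^sup>2) + e\<^sup>2"
  proof -
    have "cmod (cnj (sgn (c m)) * complex_of_real (b m)) = b m" for m
      by (cases "c m = 0") (auto simp: norm_mult norm_sgn b_def)
    moreover have "dim_vec w = K + 3" by (simp add: w_def)
    ultimately show ?thesis unfolding vec_l2_square by (simp only: split) (simp add: w_def)
  qed
  also have "\<dots> = 1" unfolding b2 e2 by (simp add: sum_divide_distrib)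
  finally have w1: "vec_l2 w = 1" using vec_l2_nonneg[of w] by (auto simp: power2_eq_1_iff)
  have prod: "cnj (w $ m) * u $ m = c m / 2" if "m \<le> K" for m
  proof -
    have "cnj (w $ m) * u $ m = sgn (c m) * complex_of_real ((b m)\<^sup>2)"
      using that by (simp add: u_def w_def power2_eq_square)
    also have "\<dots> = c m / 2" unfolding b2 by (cases "c m = 0") (auto simp: sgn_div_norm scaleR_conv_of_real)
    finally show ?thesis .
  qed
  have "(\<Sum>m<K + 3. cnj (w $ m) * u $ m * complex_of_real (cheb (min m K) x)) = taylor s K x / 2" for x
  proof -
    have "(\<Sum>m\<le>K. cnj (w $ m) * u $ m * complex_of_real (cheb (min m K) x)) = (\<Sum>m\<le>K. c m * complex_of_real (cheb m x) / 2)"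
      by (intro sum.cong refl) (simp add: prod min_def)
    thus ?thesis unfolding split c(2) sum_divide_distrib by (simp add: u_def w_def)
  qed
  thus ?thesis using u1 w1 by (intro that[of u w]) (auto simp: u_def w_def)
qed

section \<open>Exponential and eigenvalue bounds\<close>

text \<open>Every entry is a finite sum, over the eigenbasis, of scalar exponential series, so the
  entrywise series of \<open>mat_exp\<close> converges to the claimed value.\<close>

lemma mat_exp_spec_mat:
  assumes U: "unitary_mat n U"
  shows "mat_exp (z \<cdot>\<^sub>m spec_mat n U f) = spec_mat n U (\<lambda>i. exp (z * f i))"
proof (rule eq_matI)
  note D = unitary_matD[OF U]
  fix i j assume "i < dim_row (spec_mat n U (\<lambda>i. exp (z * f i)))" "j < dim_col (spec_mat n U (\<lambda>i. exp (z * f i)))"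
  hence ij: "i < n" "j < n" using D by auto
  have p: "(z \<cdot>\<^sub>m spec_mat n U f) ^\<^sub>m l = spec_mat n U (\<lambda>i. (z * f i) ^ l)" for l
    unfolding spec_mat_smult[OF D(1)] by (rule spec_mat_power[OF U])
  have "(\<lambda>l. U $$ (i, k) * ((z * f k) ^ l / fact l) * cnj (U $$ (j, k))) sums
     (U $$ (i, k) * exp (z * f k) * cnj (U $$ (j, k)))" for k
    using exp_converges[of "z * f k"]
    by (intro sums_mult sums_mult2) (simp add: scaleR_conv_of_real divide_inverse mult.commute)
  hence "(\<lambda>l. \<Sum>k<n. U $$ (i, k) * ((z * f k) ^ l / fact l) * cnj (U $$ (j, k))) sums
     (\<Sum>k<n. U $$ (i, k) * exp (z * f k) * cnj (U $$ (j, k)))"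
    by (rule sums_sum)
  moreover have "(\<Sum>k<n. U $$ (i, k) * ((z * f k) ^ l / fact l) * cnj (U $$ (j, k)))
      = ((z \<cdot>\<^sub>m spec_mat n U f) ^\<^sub>m l) $$ (i, j) / fact l" for l
    unfolding p spec_mat_index[OF D(1) ij] by (simp add: sum_divide_distrib)
  ultimately have "(\<lambda>l. ((z \<cdot>\<^sub>m spec_mat n U f) ^\<^sub>m l) $$ (i, j) / fact l) sums spec_mat n U (\<lambda>i. exp (z * f i)) $$ (i, j)"
    unfolding spec_mat_index[OF D(1) ij] by simp
  hence "(\<Sum>l. ((z \<cdot>\<^sub>m spec_mat n U f) ^\<^sub>m l) $$ (i, j) / fact l) = spec_mat n U (\<lambda>i. exp (z * f i)) $$ (i, j)"
    by (rule sums_unique[symmetric])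
  thus "mat_exp (z \<cdot>\<^sub>m spec_mat n U f) $$ (i, j) = spec_mat n U (\<lambda>i. exp (z * f i)) $$ (i, j)"
    using ij D(1) by (simp add: mat_exp_def)
qed (use unitary_matD(1)[OF U] in \<open>auto simp: mat_exp_def\<close>)

text \<open>The eigenvalue is the quadratic form at a unit eigenvector, to which Cauchy-Schwarz
  applies.\<close>

lemma eigenvalue_le_op_norm:
  assumes U: "unitary_mat n U" and i: "i < n"
  shows "\<bar>l i\<bar> \<le> op_norm (spec_mat n U (\<lambda>i. complex_of_real (l i)))"
proof -
  let ?H = "spec_mat n U (\<lambda>i. complex_of_real (l i))"
  note D = unitary_matD[OF U]
  have c: "col U i \<in> carrier_vec n" using D by auto
  have Hc: "?H \<in> carrier_mat n n" using D by simp
  have "col U i = U *\<^sub>v unit_vec n i"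
    using D(1) i by (intro eq_vecI) (auto simp: mult_mat_vec_index_sum[of U n n] unit_vec_def if_distrib simp del: index_mult_mat_vec cong: if_cong)
  hence n1: "vec_l2 (col U i) = 1" using unitary_mat_preserves_vec_l2[OF U unit_vec_carrier] i by simp
  have "\<bar>l i\<bar> = cmod ((?H *\<^sub>v col U i) \<bullet>c col U i)" by (simp add: cscalar_prod_spec_mat_col[OF U i])
  also have "\<dots> \<le> vec_l2 (?H *\<^sub>v col U i) * vec_l2 (col U i)"
    by (rule cmod_cscalar_prod_le[OF mult_sq_vec_carrier[OF Hc c] c])
  also have "\<dots> \<le> op_norm ?H" using vec_l2_mult_le_op_norm[OF Hc c] by (simp add: n1)
  finally show ?thesis .
qed

lemma vec_l2_embed:
  assumes v: "v \<in> carrier_vec r" and r: "r \<le> n"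
  shows "vec_l2 (embed_mat n r *\<^sub>v v) = vec_l2 v"
proof -
  have "{..<n} \<inter> {..<r} = {..<r}" using r by auto
  hence "(\<Sum>i<n. if i \<in> {..<r} then (cmod (v $ i))\<^sup>2 else 0) = (\<Sum>i<r. (cmod (v $ i))\<^sup>2)"
    by (subst sum.inter_restrict[symmetric]) simp_all
  moreover have "(\<Sum>i<n. (cmod ((embed_mat n r *\<^sub>v v) $ i))\<^sup>2) = (\<Sum>i<n. if i \<in> {..<r} then (cmod (v $ i))\<^sup>2 else 0)"
    unfolding embed_mat_mult_vec[OF v] by (intro sum.cong refl) auto
  ultimately show ?thesis using v by (simp add: vec_l2_def del: index_mult_mat_vec)
qed

section \<open>The simulation\<close>

text \<open>One time step. The factors next to the system are K + 3 branches, three flags and the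
  register \<open>y\<close>.\<close>

definition segment :: "nat \<Rightarrow> nat \<Rightarrow> real \<Rightarrow> nat \<Rightarrow> complex vec \<Rightarrow> complex vec \<Rightarrow> complex mat \<Rightarrow> complex mat" where
  "segment D d \<nu> K u w H = amplify ((K + 3) * (3 * D * D)) D
     (lcu (K + 3) (3 * D * D) u w (\<lambda>m. walk_steps (3 * D * D) D (walk D d \<nu> H) (min m K)))"

text \<open>K walk steps of \<open>8 * d\<close> calls each, used three times by the
  amplification.\<close>

lemma impl_segment:
  assumes "u \<in> carrier_vec (K + 3)" "w \<in> carrier_vec (K + 3)"
  shows "impl D d ((K + 3) * (3 * D * D)) (3 * (K * (8 * d))) (segment D d \<nu> K u w)"
  unfolding segment_def[abs_def]
  by (intro impl_amplify impl_lcu impl_block_walk impl_walk assms) simp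

lemma impl_pow:
  assumes F: "impl D d n c F"
  shows "impl D d n (r * c) (\<lambda>H. F H ^\<^sub>m r)"
proof (induction r)
  case 0
  have "dim_row (F H) = n" for H using unitary_matD(1)[OF impl_unitary[OF F]] by auto
  thus ?case using impl_gate[OF unitary_mat_one[of n], of D d] by simp
next
  case (Suc r)
  have "impl D d n (r * c + c) (\<lambda>H. F H ^\<^sub>m r * F H)" by (intro impl_comp Suc F)
  thus ?case by (simp add: add.commute)
qed

lemma unitary_pow_mat: "unitary_mat n A \<Longrightarrow> unitary_mat n (A ^\<^sub>m r)"
proof (induction r)
  case 0
  thus ?case using unitary_matD(1)[OF 0] by auto
next
  case (Suc r)
  thus ?case by (simp add: unitary_mat_mult)
qed

text \<open>Amplification returns the polynomial \<open>?M\<close> plus a defect. On every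
  eigenvalue the polynomial differs from the exponential by at most \<eta> = 2^-K, and the defect is
  at most 3 \<eta>, which gives 4 \<eta>. The rescaled eigenvalues lie in [-1, 1] because |l| \<le>
  \<nu> \<le> sqrt d * \<nu>.\<close>

lemma segment_error:
  assumes H: "H \<in> carrier_mat D D" "hermitian_mat H" "sparse_mat d H" and \<nu>: "op_norm H = \<nu>" "0 < \<nu>"
    and D: "0 < D" and d: "0 < d" and s: "0 \<le> s" "s \<le> 1 / 2"
    and u: "u \<in> carrier_vec (K + 3)" "vec_l2 u = 1" and w: "w \<in> carrier_vec (K + 3)" "vec_l2 w = 1"
    and uw: "\<And>x. (\<Sum>m<K + 3. cnj (w $ m) * u $ m * complex_of_real (cheb (min m K) x)) = taylor s K x / 2"
  shows "\<exists>U x. unitary_mat D U \<and> H = spec_mat D U (\<lambda>i. complex_of_real (sqrt d * \<nu> * x i)) \<and>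
    (\<forall>v \<in> carrier_vec D. vec_l2 (segment D d \<nu> K u w H *\<^sub>v (embed_mat ((K + 3) * (3 * D * D)) D *\<^sub>v v)
       - embed_mat ((K + 3) * (3 * D * D)) D *\<^sub>v (spec_mat D U (\<lambda>i. exp (- \<i> * complex_of_real (s * x i))) *\<^sub>v v))
      \<le> 4 * (1 / 2) ^ K * vec_l2 v)"
proof -
  obtain U l where U: "unitary_mat D U" and Hl: "H = spec_mat D U (\<lambda>i. complex_of_real (l i))"
    using hermitian_spectral[OF H(1,2)] by blast
  note UD = unitary_matD[OF U]
  define x where "x = (\<lambda>i. l i / (sqrt d * \<nu>))"
  have sd: "1 \<le> sqrt (real d)" using d by simp
  have lx: "l i = sqrt d * \<nu> * x i" for i using \<nu> d by (simp add: x_def)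
  have x1: "\<bar>x i\<bar> \<le> 1" if "i < D" for i
  proof -
    have "\<bar>l i\<bar> \<le> \<nu>" using eigenvalue_le_op_norm[OF U that, of l] Hl \<nu> by simp
    also have "\<nu> \<le> sqrt d * \<nu>" using sd \<nu> by simp
    finally show ?thesis using \<nu> d by (simp add: x_def abs_divide abs_mult)
  qed
  let ?n = "3 * D * D" and ?N = "(K + 3) * (3 * D * D)"
  let ?W = "walk D d \<nu> H" and ?E = "embed_mat ?N D"
  let ?F = "\<lambda>m. walk_steps ?n D ?W (min m K)"
  let ?p = "\<lambda>i. taylor s K (x i)" and ?e = "\<lambda>i. exp (- \<i> * complex_of_real (s * x i))"
  let ?M = "spec_mat D U ?p" and ?G = "spec_mat D U ?e"
  have W: "unitary_mat ?n ?W" by (rule impl_unitary[OF impl_walk])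
  have Dn: "D \<le> ?n" using D by simp
  have DN: "D \<le> ?N" using D by simp
  have blk: "top_block D ?W = spec_mat D U (\<lambda>i. complex_of_real (x i))"
  proof (rule eq_matI)
    fix i j assume "i < dim_row (spec_mat D U (\<lambda>i. complex_of_real (x i)))" "j < dim_col (spec_mat D U (\<lambda>i. complex_of_real (x i)))"
    hence ij: "i < D" "j < D" using UD by auto
    have "top_block D ?W $$ (i, j) = H $$ (i, j) / (sqrt d * \<nu>)"
      using walk_block[OF H \<nu> d ij] ij by (simp add: top_block_def)
    also have "\<dots> = (\<Sum>k<D. U $$ (i, k) * complex_of_real (l k) * cnj (U $$ (j, k)) / (sqrt d * \<nu>))"
      unfolding Hl spec_mat_index[OF UD(1) ij] by (rule sum_divide_distrib)
    also have "\<dots> = spec_mat D U (\<lambda>i. complex_of_real (x i)) $$ (i, j)"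
      unfolding spec_mat_index[OF UD(1) ij] by (intro sum.cong refl) (simp add: x_def)
    finally show "top_block D ?W $$ (i, j) = spec_mat D U (\<lambda>i. complex_of_real (x i)) $$ (i, j)" .
  qed (use UD in \<open>auto simp: top_block_def\<close>)
  have Fu: "unitary_mat ?n (?F m)" for m by (rule unitary_walk_steps[OF W])
  let ?A = "lcu (K + 3) ?n u w ?F"
  have A: "unitary_mat ?N ?A" by (rule unitary_lcu[OF Fu u(1) w(1)])
  have Mc: "?M \<in> carrier_mat D D" "?G \<in> carrier_mat D D" using UD by simp_all
  have half: "top_vec D (?A *\<^sub>v (?E *\<^sub>v v)) = (1 / 2) \<cdot>\<^sub>v (?M *\<^sub>v v)" if v: "v \<in> carrier_vec D" for v
  proof (rule eq_vecI)
    fix i assume "i < dim_vec ((1 / 2) \<cdot>\<^sub>v (?M *\<^sub>v v))"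
    hence i: "i < D" using Mc(1) UD(1) by simp
    let ?C = "\<lambda>m. spec_mat D U (\<lambda>i. complex_of_real (cheb (min m K) (x i)))"
    have Cc: "?C m \<in> carrier_mat D D" for m using UD by simp
    have "top_vec D (?A *\<^sub>v (?E *\<^sub>v v)) $ i
        = (\<Sum>m<K + 3. cnj (w $ m) * u $ m * top_vec D (?F m *\<^sub>v (embed_mat ?n D *\<^sub>v v)) $ i)"
      by (rule top_vec_lcu[OF unitary_matD(1)[OF Fu] Dn _ u w v i]) simp
    also have "\<dots> = (\<Sum>m<K + 3. cnj (w $ m) * u $ m * (\<Sum>j<D. ?C m $$ (i, j) * v $ j))"
      unfolding top_vec_walk_steps[OF W Dn U blk v] mult_mat_vec_index_sum[OF Cc v i] ..
    also have "\<dots> = (\<Sum>m<K + 3. \<Sum>j<D. \<Sum>k<D. cnj (w $ m) * u $ m * complex_of_real (cheb (min m K) (x k))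
        * (U $$ (i, k) * cnj (U $$ (j, k)) * v $ j))"
      using i by (intro sum.cong refl) (simp add: spec_mat_index[OF UD(1)] sum_distrib_left sum_distrib_right mult_ac)
    also have "\<dots> = (\<Sum>j<D. \<Sum>m<K + 3. \<Sum>k<D. cnj (w $ m) * u $ m * complex_of_real (cheb (min m K) (x k))
        * (U $$ (i, k) * cnj (U $$ (j, k)) * v $ j))"
      by (rule sum.swap)
    also have "\<dots> = (\<Sum>j<D. \<Sum>k<D. \<Sum>m<K + 3. cnj (w $ m) * u $ m * complex_of_real (cheb (min m K) (x k))
        * (U $$ (i, k) * cnj (U $$ (j, k)) * v $ j))"
      by (intro sum.cong refl sum.swap)
    \<comment> \<open>With the sum over branches innermost, the scalar identity \<open>uw\<close>
      applies to each eigenvalue.\<close>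
    also have "\<dots> = (\<Sum>j<D. \<Sum>k<D. taylor s K (x k) / 2 * (U $$ (i, k) * cnj (U $$ (j, k)) * v $ j))"
      by (simp only: sum_distrib_right[symmetric] uw)
    also have "\<dots> = (1 / 2) * (\<Sum>j<D. ?M $$ (i, j) * v $ j)"
      using i by (simp add: spec_mat_index[OF UD(1)] sum_distrib_left sum_distrib_right mult_ac)
    also have "\<dots> = ((1 / 2) \<cdot>\<^sub>v (?M *\<^sub>v v)) $ i"
      unfolding mult_mat_vec_index_sum[OF Mc(1) v i, symmetric] using i UD(1) by (simp del: index_mult_mat_vec)
    finally show "top_vec D (?A *\<^sub>v (?E *\<^sub>v v)) $ i = ((1 / 2) \<cdot>\<^sub>v (?M *\<^sub>v v)) $ i" .
  qed (use UD(1) in \<open>simp add: top_vec_def\<close>)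
  let ?\<eta> = "(1 / 2 :: real) ^ K"
  have pe: "cmod (?p i - ?e i) \<le> ?\<eta>" if "i < D" for i by (rule taylor_error[OF s x1[OF that]])
  have e1: "cmod (?e i) = 1" for i by simp
  have "vec_l2 (segment D d \<nu> K u w H *\<^sub>v (?E *\<^sub>v v) - ?E *\<^sub>v (?G *\<^sub>v v)) \<le> 4 * ?\<eta> * vec_l2 v"
    if v: "v \<in> carrier_vec D" for v
  proof -
    let ?r = "v - mat_adjoint ?M *\<^sub>v (?M *\<^sub>v v)"
    have Mv: "?M *\<^sub>v v \<in> carrier_vec D" "?G *\<^sub>v v \<in> carrier_vec D" using Mc v by simp_all
    have adjM: "mat_adjoint ?M = spec_mat D U (\<lambda>i. cnj (?p i))" by (rule spec_mat_adjoint[OF UD(1)])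
    have r: "?r \<in> carrier_vec D" using v Mv(1) mult_sq_vec_carrier[OF mat_adjoint_carrier[OF Mc(1)] Mv(1)] by simp
    have E: "?E *\<^sub>v z \<in> carrier_vec ?N" if "z \<in> carrier_vec D" for z
      using that by (rule mult_mat_vec_carrier[OF embed_mat_carrier])
    have AEr: "?A *\<^sub>v (?E *\<^sub>v ?r) \<in> carrier_vec ?N"
      by (rule mult_sq_vec_carrier[OF unitary_matD(1)[OF A] E[OF r]])
    have "segment D d \<nu> K u w H *\<^sub>v (?E *\<^sub>v v) = ?E *\<^sub>v (?M *\<^sub>v v) + ?A *\<^sub>v (?E *\<^sub>v ?r)"
      unfolding segment_def by (rule amplify_embed[OF A DN Mc(1) half v])
    hence "segment D d \<nu> K u w H *\<^sub>v (?E *\<^sub>v v) - ?E *\<^sub>v (?G *\<^sub>v v)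
        = (?E *\<^sub>v (?M *\<^sub>v v) - ?E *\<^sub>v (?G *\<^sub>v v)) + ?A *\<^sub>v (?E *\<^sub>v ?r)"
      using E[OF Mv(1)] E[OF Mv(2)] AEr
      by (intro eq_vecI) (auto simp del: index_mult_mat_vec dim_mult_mat_vec)
    also have "?E *\<^sub>v (?M *\<^sub>v v) - ?E *\<^sub>v (?G *\<^sub>v v) = ?E *\<^sub>v (?M *\<^sub>v v - ?G *\<^sub>v v)"
      by (rule mult_minus_distrib_mat_vec[OF embed_mat_carrier Mv, symmetric])
    also have "?M *\<^sub>v v - ?G *\<^sub>v v = (?M - ?G) *\<^sub>v v"
      by (rule minus_mult_distrib_mat_vec[OF Mc v, symmetric])
    also have "?M - ?G = spec_mat D U (\<lambda>i. ?p i - ?e i)" by (rule spec_mat_minus[OF UD(1)])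
    finally have eq: "segment D d \<nu> K u w H *\<^sub>v (?E *\<^sub>v v) - ?E *\<^sub>v (?G *\<^sub>v v)
        = ?E *\<^sub>v (spec_mat D U (\<lambda>i. ?p i - ?e i) *\<^sub>v v) + ?A *\<^sub>v (?E *\<^sub>v ?r)" .
    have dc: "spec_mat D U (\<lambda>i. ?p i - ?e i) *\<^sub>v v \<in> carrier_vec D" using UD(1) v by simp
    have n1: "vec_l2 (?E *\<^sub>v (spec_mat D U (\<lambda>i. ?p i - ?e i) *\<^sub>v v)) \<le> ?\<eta> * vec_l2 v"
      unfolding vec_l2_embed[OF dc DN] by (rule vec_l2_spec_mat_le[OF U v pe]) simp_all
    have rr: "?r = spec_mat D U (\<lambda>i. 1 - cnj (?p i) * ?p i) *\<^sub>v v"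
    proof -
      have "mat_adjoint ?M *\<^sub>v (?M *\<^sub>v v) = (mat_adjoint ?M * ?M) *\<^sub>v v"
        by (rule assoc_mult_mat_vec[OF mat_adjoint_carrier[OF Mc(1)] Mc(1) v, symmetric])
      also have "mat_adjoint ?M * ?M = spec_mat D U (\<lambda>i. cnj (?p i) * ?p i)"
        unfolding adjM by (rule spec_mat_mult[OF U])
      finally have 1: "mat_adjoint ?M *\<^sub>v (?M *\<^sub>v v) = spec_mat D U (\<lambda>i. cnj (?p i) * ?p i) *\<^sub>v v" .
      have "spec_mat D U (\<lambda>_. 1) *\<^sub>v v = v" using v by (simp add: spec_mat_one[OF U])
      hence "?r = spec_mat D U (\<lambda>_. 1) *\<^sub>v v - spec_mat D U (\<lambda>i. cnj (?p i) * ?p i) *\<^sub>v v"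
        unfolding 1 by simp
      also have "\<dots> = (spec_mat D U (\<lambda>_. 1) - spec_mat D U (\<lambda>i. cnj (?p i) * ?p i)) *\<^sub>v v"
        by (rule minus_mult_distrib_mat_vec[symmetric, of _ D D]) (use UD(1) v in simp_all)
      finally show ?thesis unfolding spec_mat_minus[OF UD(1)] .
    qed
    \<comment> \<open>|p|^2 - 1 = (|p| - 1) (|p| + 1), where |p| \<le> 1 + \<eta> \<le> 2 bounds the
      second factor by 3.\<close>
    have bound: "cmod (1 - cnj (?p i) * ?p i) \<le> 3 * ?\<eta>" if "i < D" for i
    proof -
      have "\<bar>cmod (?p i) - 1\<bar> \<le> ?\<eta>" using norm_triangle_ineq3[of "?p i" "?e i"] pe[OF that] e1[of i] by linarith
      moreover have "?\<eta> \<le> 1" by (simp add: power_le_one)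
      moreover have "cmod (1 - cnj (?p i) * ?p i) = \<bar>1 - (cmod (?p i))\<^sup>2\<bar>"
      proof -
        have "cnj (?p i) * ?p i = complex_of_real ((cmod (?p i))\<^sup>2)"
          unfolding complex_norm_square by (rule mult.commute)
        hence "1 - cnj (?p i) * ?p i = complex_of_real (1 - (cmod (?p i))\<^sup>2)" by simp
        thus ?thesis by (simp only: norm_of_real)
      qed
      moreover have "\<bar>1 - (cmod (?p i))\<^sup>2\<bar> = \<bar>cmod (?p i) - 1\<bar> * (cmod (?p i) + 1)"
      proof -
        have "1 - (cmod (?p i))\<^sup>2 = - ((cmod (?p i) - 1) * (cmod (?p i) + 1))"
          by (simp add: power2_eq_square algebra_simps)
        thus ?thesis by (simp only: abs_minus_cancel abs_mult) simp
      qed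
      moreover have "\<bar>cmod (?p i) - 1\<bar> * (cmod (?p i) + 1) \<le> ?\<eta> * 3"
        using calculation(1,2) by (intro mult_mono) auto
      ultimately show ?thesis by simp
    qed
    have "vec_l2 (?A *\<^sub>v (?E *\<^sub>v ?r)) = vec_l2 ?r"
      unfolding unitary_mat_preserves_vec_l2[OF A E[OF r]] by (rule vec_l2_embed[OF r DN])
    also have "\<dots> \<le> 3 * ?\<eta> * vec_l2 v"
      unfolding rr by (rule vec_l2_spec_mat_le[OF U v bound]) simp_all
    finally have n2: "vec_l2 (?A *\<^sub>v (?E *\<^sub>v ?r)) \<le> 3 * ?\<eta> * vec_l2 v" .
    have four: "4 * ?\<eta> * vec_l2 v = ?\<eta> * vec_l2 v + 3 * ?\<eta> * vec_l2 v" by simp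
    show ?thesis unfolding eq four
      by (rule order_trans[OF vec_l2_triangle[OF E[OF dc] AEr] add_mono[OF n1 n2]])
  qed
  moreover have "H = spec_mat D U (\<lambda>i. complex_of_real (sqrt d * \<nu> * x i))"
    unfolding lx[symmetric] by (rule Hl)
  ultimately show ?thesis using U by (intro exI conjI ballI)
qed

section \<open>Repetition of segments and the final reduced state\<close>

text \<open>The first application is replaced by \<open>G\<close> at cost \<eta>, which the
  remaining unitary power does not enlarge; the rest is the induction hypothesis at
  \<open>G *\<^sub>v v\<close>, a vector of the same norm. Errors therefore add up linearly.\<close>

lemma iterate_error:
  assumes Q: "unitary_mat N Q" and G: "unitary_mat D G" and D: "D \<le> N"
    and err: "\<And>v. v \<in> carrier_vec D \<Longrightarrow>
      vec_l2 (Q *\<^sub>v (embed_mat N D *\<^sub>v v) - embed_mat N D *\<^sub>v (G *\<^sub>v v)) \<le> \<eta> * vec_l2 v"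
    and v: "v \<in> carrier_vec D"
  shows "vec_l2 (Q ^\<^sub>m r *\<^sub>v (embed_mat N D *\<^sub>v v) - embed_mat N D *\<^sub>v (G ^\<^sub>m r *\<^sub>v v)) \<le> r * \<eta> * vec_l2 v"
  using v
proof (induction r arbitrary: v)
  case 0
  have "dim_row Q = N" "dim_row G = D" using unitary_matD(1)[OF Q] unitary_matD(1)[OF G] by auto
  moreover have "embed_mat N D *\<^sub>v v \<in> carrier_vec N" using 0 by (rule mult_mat_vec_carrier[OF embed_mat_carrier])
  ultimately show ?case using 0 by (simp add: minus_cancel_vec)
next
  case (Suc r)
  let ?E = "embed_mat N D"
  note Qc = unitary_matD(1)[OF Q] and Gc = unitary_matD(1)[OF G]
  note Qr = unitary_pow_mat[OF Q, of r] and Gr = unitary_pow_mat[OF G, of r]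
  have E: "?E *\<^sub>v z \<in> carrier_vec N" if "z \<in> carrier_vec D" for z
    using that by (rule mult_mat_vec_carrier[OF embed_mat_carrier])
  have Gv: "G *\<^sub>v v \<in> carrier_vec D" using Gc Suc.prems by simp
  have QEv: "Q *\<^sub>v (?E *\<^sub>v v) \<in> carrier_vec N" by (rule mult_sq_vec_carrier[OF Qc E[OF Suc.prems]])
  have 1: "Q ^\<^sub>m Suc r *\<^sub>v (?E *\<^sub>v v) = Q ^\<^sub>m r *\<^sub>v (Q *\<^sub>v (?E *\<^sub>v v))"
    unfolding pow_mat.simps by (rule assoc_mult_mat_vec[OF unitary_matD(1)[OF Qr] Qc E[OF Suc.prems]])
  have 2: "G ^\<^sub>m Suc r *\<^sub>v v = G ^\<^sub>m r *\<^sub>v (G *\<^sub>v v)"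
    unfolding pow_mat.simps by (rule assoc_mult_mat_vec[OF unitary_matD(1)[OF Gr] Gc Suc.prems])
  have c: "Q ^\<^sub>m r *\<^sub>v (Q *\<^sub>v (?E *\<^sub>v v)) \<in> carrier_vec N" "Q ^\<^sub>m r *\<^sub>v (?E *\<^sub>v (G *\<^sub>v v)) \<in> carrier_vec N"
    "?E *\<^sub>v (G ^\<^sub>m r *\<^sub>v (G *\<^sub>v v)) \<in> carrier_vec N"
    by (intro mult_sq_vec_carrier[OF unitary_matD(1)[OF Qr]] QEv E Gv mult_sq_vec_carrier[OF unitary_matD(1)[OF Gr]])+
  have "vec_l2 (Q ^\<^sub>m r *\<^sub>v (Q *\<^sub>v (?E *\<^sub>v v)) - Q ^\<^sub>m r *\<^sub>v (?E *\<^sub>v (G *\<^sub>v v)))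
      = vec_l2 (Q ^\<^sub>m r *\<^sub>v (Q *\<^sub>v (?E *\<^sub>v v) - ?E *\<^sub>v (G *\<^sub>v v)))"
    by (subst mult_minus_distrib_mat_vec[OF unitary_matD(1)[OF Qr] QEv E[OF Gv]]) (rule refl)
  also have "\<dots> = vec_l2 (Q *\<^sub>v (?E *\<^sub>v v) - ?E *\<^sub>v (G *\<^sub>v v))"
    using QEv E[OF Gv] by (intro unitary_mat_preserves_vec_l2[OF Qr]) simp
  also have "\<dots> \<le> \<eta> * vec_l2 v" by (rule err[OF Suc.prems])
  finally have "vec_l2 (Q ^\<^sub>m r *\<^sub>v (Q *\<^sub>v (?E *\<^sub>v v)) - Q ^\<^sub>m r *\<^sub>v (?E *\<^sub>v (G *\<^sub>v v))) \<le> \<eta> * vec_l2 v" .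
  moreover have "vec_l2 (Q ^\<^sub>m r *\<^sub>v (?E *\<^sub>v (G *\<^sub>v v)) - ?E *\<^sub>v (G ^\<^sub>m r *\<^sub>v (G *\<^sub>v v))) \<le> r * \<eta> * vec_l2 v"
    using Suc.IH[OF Gv] unfolding unitary_mat_preserves_vec_l2[OF G Suc.prems] .
  ultimately show ?case
    unfolding 1 2 using vec_l2_triangle_minus[OF c] by (simp add: algebra_simps)
qed

text \<open>Preparing the ancillas becomes conjugation by an isometry, so the simulated state is the
  reduced state of a single isometry applied to \<rho>.\<close>

lemma zero_state_tensor:
  assumes \<rho>: "\<rho> \<in> carrier_mat D D" and e: "0 < e"
  shows "zero_state e \<otimes>\<^sub>m \<rho> = evolve (embed_mat (e * D) D) \<rho>"
proof (rule eq_matI)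
  let ?E = "embed_mat (e * D) D"
  have zc: "zero_state e \<in> carrier_mat e e" by (simp add: zero_state_def)
  have Er: "?E * \<rho> \<in> carrier_mat (e * D) D" by (rule mult_carrier_mat[OF embed_mat_carrier \<rho>])
  fix i j assume "i < dim_row (evolve ?E \<rho>)" "j < dim_col (evolve ?E \<rho>)"
  hence ij: "i < e * D" "j < e * D" by (auto simp: evolve_def)
  hence D: "0 < D" by (cases D) auto
  have Eri: "(?E * \<rho>) $$ (i, k) = (if i < D then \<rho> $$ (i, k) else 0)" if "k < D" for k
  proof -
    have "(?E * \<rho>) $$ (i, k) = (\<Sum>l<D. if l = i then \<rho> $$ (l, k) else 0)"
      unfolding mult_mat_index_sum[OF embed_mat_carrier \<rho> ij(1) that]
      using ij by (intro sum.cong refl) (auto simp: embed_mat_def)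
    thus ?thesis by simp
  qed
  have "evolve ?E \<rho> $$ (i, j) = (\<Sum>k<D. (?E * \<rho>) $$ (i, k) * mat_adjoint ?E $$ (k, j))"
    unfolding evolve_def by (rule mult_mat_index_sum[OF Er mat_adjoint_carrier[OF embed_mat_carrier] ij])
  also have "\<dots> = (\<Sum>k<D. if k = j then if i < D then \<rho> $$ (i, k) else 0 else 0)"
  proof (intro sum.cong refl)
    fix k assume "k \<in> {..<D}"
    hence k: "k < D" by simp
    have "mat_adjoint ?E $$ (k, j) = (if k = j then 1 else 0)" using k ij by (simp add: embed_mat_def)
    thus "(?E * \<rho>) $$ (i, k) * mat_adjoint ?E $$ (k, j) = (if k = j then if i < D then \<rho> $$ (i, k) else 0 else 0)"
      by (simp only: Eri[OF k]) simp
  qed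
  also have "\<dots> = (if i < D \<and> j < D then \<rho> $$ (i, j) else 0)" by simp
  also have "\<dots> = (zero_state e \<otimes>\<^sub>m \<rho>) $$ (i, j)"
    unfolding tensor_mat_index[OF zc \<rho> ij] using ij D lt_mult_div_mod[OF ij(1)] lt_mult_div_mod[OF ij(2)]
    by (auto simp: zero_state_def div_eq_0_iff)
  finally show "(zero_state e \<otimes>\<^sub>m \<rho>) $$ (i, j) = evolve ?E \<rho> $$ (i, j)" ..
qed (use \<rho> in \<open>auto simp: evolve_def zero_state_def\<close>)

lemma evolve_evolve:
  assumes V: "V \<in> carrier_mat m m" and E: "E \<in> carrier_mat m n" and \<rho>: "\<rho> \<in> carrier_mat n n"
  shows "evolve V (evolve E \<rho>) = evolve (V * E) \<rho>"
proof -
  note c = mat_adjoint_carrier[OF V] mat_adjoint_carrier[OF E] mult_carrier_mat[OF E \<rho>]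
  have "evolve V (evolve E \<rho>) = V * (E * \<rho>) * mat_adjoint E * mat_adjoint V"
    unfolding evolve_def by (subst assoc_mult_mat[OF V c(3) c(2)]) (rule refl)
  also have "\<dots> = V * (E * \<rho>) * (mat_adjoint E * mat_adjoint V)"
    by (rule assoc_mult_mat[OF mult_carrier_mat[OF V c(3)] c(2,1)])
  also have "V * (E * \<rho>) = V * E * \<rho>" by (rule assoc_mult_mat[OF V E \<rho>, symmetric])
  also have "mat_adjoint E * mat_adjoint V = mat_adjoint (V * E)" by (rule mat_adjoint_mult[OF V E, symmetric])
  finally show ?thesis by (simp add: evolve_def)
qed

lemma simulated_state_embed:
  assumes V: "run (a * D) U W\<^sub>0 steps \<in> carrier_mat (q * a * D) (q * a * D)" and \<rho>: "\<rho> \<in> carrier_mat D D"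
    and qa: "0 < q * a"
  shows "simulated_state q a D U W\<^sub>0 steps \<rho>
    = trace_out (q * a) D (evolve (run (a * D) U W\<^sub>0 steps * embed_mat (q * a * D) D) \<rho>)"
  unfolding simulated_state_def zero_state_tensor[OF \<rho> qa] evolve_evolve[OF V embed_mat_carrier \<rho>] ..

text \<open>Composition with a transposition moves \<open>x\<close> to index 0. This lets the
  initial zero state stand for the empty loading register.\<close>

lemma enumeration_exists:
  assumes A: "finite A" and x: "x \<in> A"
  obtains f where "bij_betw f {..<card A} A" "f 0 = x"
proof -
  obtain h where h: "bij_betw h {0..<card A} A" using ex_bij_betw_nat_finite[OF A] by blast
  have "0 < card A" using A x by (auto simp: card_gt_0_iff)
  have "x \<in> h ` {0..<card A}" using h x by (simp add: bij_betw_def)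
  then obtain k where "x = h k" "k \<in> {0..<card A}" by (rule imageE)
  hence k: "k < card A" "h k = x" by simp_all
  have "bij_betw (swap_zero k) {..<card A} {..<card A}"
    using k \<open>0 < card A\<close> by (intro bij_betwI[where g = "swap_zero k"]) (auto intro: swap_zero_less)
  from bij_betw_trans[OF this h[unfolded atLeast0LessThan]]
  have "bij_betw (h \<circ> swap_zero k) {..<card A} A" .
  moreover have "(h \<circ> swap_zero k) 0 = x" using k by simp
  ultimately show ?thesis by (rule that)
qed

lemma spec_mat_exp_unitary:
  assumes U: "unitary_mat D U"
  shows "unitary_mat D (spec_mat D U (\<lambda>i. exp (- \<i> * complex_of_real (f i))))"
  by (rule unitary_spec_mat[OF U]) simp

text \<open>The quantities used by the program, namely \<nu> = \<tau> / t, the degree, the number of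
  segments and the coefficient vectors, are determined by the parameters, so one program serves all
  admissible Hamiltonians.\<close>

lemma simulates_segments:
  assumes D: "0 < D" and d: "0 < d" and g: "0 < g" and vals: "distinct vals" "0 \<in> set vals"
    and t: "0 < t" and \<tau>: "0 < \<tau>" and \<epsilon>: "0 < \<epsilon>" "\<epsilon> < 1"
    and r: "0 < r" "sqrt d * \<tau> / r \<le> 1 / 2" and K: "r * (4 * (1 / 2) ^ K) \<le> \<epsilon> / 2"
  shows "\<exists>a W\<^sub>0 steps. simulates D d vals g t \<tau> \<epsilon> a W\<^sub>0 steps \<and> length steps = r * (3 * (K * (8 * d)))"
proof -
  \<comment> \<open>A segment evolves for time t / r, and H t / r = s X with X = H / (sqrt d *
    \<nu>).\<close>
  define s where "s = sqrt d * \<tau> / r"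
  define \<nu> where "\<nu> = \<tau> / t"
  have \<nu>: "0 < \<nu>" using \<tau> t by (simp add: \<nu>_def)
  have sb: "0 \<le> s" "s \<le> 1 / 2" using r \<tau> by (auto simp: s_def)
  obtain u w where u: "u \<in> carrier_vec (K + 3)" "vec_l2 u = 1" and w: "w \<in> carrier_vec (K + 3)" "vec_l2 w = 1"
    and uw: "\<And>x. (\<Sum>m<K + 3. cnj (w $ m) * u $ m * complex_of_real (cheb (min m K) x)) = taylor s K x / 2"
    using lcu_vectors[OF sb, of K] by blast
  let ?N = "(K + 3) * (3 * D * D)"
  let ?contents = "{..<d} \<rightarrow>\<^sub>E {..<D * length vals}"
  have L: "0 < length vals" using vals(2) by (cases vals) auto
  have fin: "finite ?contents" by (intro finite_PiE) auto
  have z: "(\<lambda>i\<in>{..<d}. 0) \<in> ?contents" using D L by auto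
  obtain cont where cont: "bij_betw cont {..<card ?contents} ?contents" "cont 0 = (\<lambda>i\<in>{..<d}. 0)"
    using enumeration_exists[OF fin z] by blast
  define c where "c = card ?contents"
  have c: "0 < c" unfolding c_def card_gt_0_iff using fin z by blast
  interpret query_setup D d g vals ?N c cont
    using D g vals c cont by unfold_locales (auto simp: c_def)
  let ?a = "c * ((K + 3) * (3 * D))"
  have aD: "?a * D = c * ?N" by (simp add: mult.assoc)
  have qaD: "q * ?a * D = q * (c * ?N)" by (simp add: mult.assoc)
  let ?T = "q * (c * ?N)"
  let ?Q = "\<lambda>H. segment D d \<nu> K u w H ^\<^sub>m r"
  have imp: "impl D d ?N (r * (3 * (K * (8 * d)))) ?Q"
    by (intro impl_pow impl_segment u(1) w(1))
  obtain V where "circuit q (c * ?N) (r * (3 * (K * (8 * d)))) V \<and>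
     (\<forall>H f U. valid H f U \<longrightarrow> V U * embed_mat ?T ?N = embed_mat ?T ?N * ?Q H)"
    using impl_sound[OF imp d] by (rule exE)
  hence circ: "circuit q (c * ?N) (r * (3 * (K * (8 * d)))) V"
    and V: "\<And>H f U. valid H f U \<Longrightarrow> V U * embed_mat ?T ?N = embed_mat ?T ?N * ?Q H" by simp_all
  from circ obtain W\<^sub>0 steps where len: "length steps = r * (3 * (K * (8 * d)))"
    and W: "unitary_mat ?T W\<^sub>0" "\<forall>(c, W) \<in> set steps. unitary_mat ?T W"
    and run: "\<forall>U. unitary_mat q U \<longrightarrow> V U = run (c * ?N) U W\<^sub>0 steps"
    unfolding circuit_def by (elim exE conjE)
  have apos: "0 < ?a" using c D by simp
  have qpos: "0 < q" by (rule q_pos[OF d])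
  have DN: "D \<le> ?N" using D by simp
  have NT: "?N \<le> ?T" using qpos c by simp
  have "trace_dist (simulated_state q ?a D U W\<^sub>0 steps \<rho>) (evolve (mat_exp ((- \<i> * complex_of_real t) \<cdot>\<^sub>m H)) \<rho>) \<le> \<epsilon>"
    if v: "valid H f U" and nrm: "op_norm H * t = \<tau>" and \<rho>: "density_mat D \<rho>" for H f U \<rho>
  proof -
    have H: "H \<in> carrier_mat D D" "hermitian_mat H" "sparse_mat d H" using v by (auto simp: valid_def)
    have on: "op_norm H = \<nu>" using nrm t by (auto simp: \<nu>_def)
    obtain U' where "\<exists>x. unitary_mat D U' \<and> H = spec_mat D U' (\<lambda>i. complex_of_real (sqrt d * \<nu> * x i)) \<and>
      (\<forall>v \<in> carrier_vec D. vec_l2 (segment D d \<nu> K u w H *\<^sub>v (embed_mat ?N D *\<^sub>v v)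
         - embed_mat ?N D *\<^sub>v (spec_mat D U' (\<lambda>i. exp (- \<i> * complex_of_real (s * x i))) *\<^sub>v v))
        \<le> 4 * (1 / 2) ^ K * vec_l2 v)"
      using segment_error[OF H on \<nu> D d sb u w uw] by (rule exE)
    then obtain x where x: "unitary_mat D U' \<and> H = spec_mat D U' (\<lambda>i. complex_of_real (sqrt d * \<nu> * x i)) \<and>
      (\<forall>v \<in> carrier_vec D. vec_l2 (segment D d \<nu> K u w H *\<^sub>v (embed_mat ?N D *\<^sub>v v)
         - embed_mat ?N D *\<^sub>v (spec_mat D U' (\<lambda>i. exp (- \<i> * complex_of_real (s * x i))) *\<^sub>v v))
        \<le> 4 * (1 / 2) ^ K * vec_l2 v)"
      by (rule exE)
    hence U': "unitary_mat D U'" and Hx: "H = spec_mat D U' (\<lambda>i. complex_of_real (sqrt d * \<nu> * x i))"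
      by simp_all
    let ?G = "spec_mat D U' (\<lambda>i. exp (- \<i> * complex_of_real (s * x i)))"
    have G: "unitary_mat D ?G" by (rule spec_mat_exp_unitary[OF U'])
    have err1: "vec_l2 (segment D d \<nu> K u w H *\<^sub>v (embed_mat ?N D *\<^sub>v z) - embed_mat ?N D *\<^sub>v (?G *\<^sub>v z))
        \<le> 4 * (1 / 2) ^ K * vec_l2 z" if "z \<in> carrier_vec D" for z
      using x that by (elim conjE bspec)
    have seg: "unitary_mat ?N (segment D d \<nu> K u w H)" by (rule impl_unitary[OF impl_segment[OF u(1) w(1)]])
    let ?X = "mat_exp ((- \<i> * complex_of_real t) \<cdot>\<^sub>m H)"
    have Xe: "?X = ?G ^\<^sub>m r"
    proof -
      have "?X = spec_mat D U' (\<lambda>i. exp (- \<i> * complex_of_real t * complex_of_real (sqrt d * \<nu> * x i)))"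
        unfolding Hx by (rule mat_exp_spec_mat[OF U'])
      also have "\<dots> = spec_mat D U' (\<lambda>i. exp (- \<i> * complex_of_real (s * x i)) ^ r)"
      proof (rule spec_mat_cong)
        fix i
        have "sqrt d * \<nu> * x i * t = real r * (s * x i)"
          using r(1) t by (simp add: s_def \<nu>_def)
        hence "complex_of_real (sqrt d * \<nu> * x i) * complex_of_real t = of_nat r * complex_of_real (s * x i)"
          by (metis of_real_mult of_real_of_nat_eq)
        hence "- \<i> * complex_of_real t * complex_of_real (sqrt d * \<nu> * x i) = of_nat r * (- \<i> * complex_of_real (s * x i))"
          by (metis mult.assoc mult.commute)
        thus "exp (- \<i> * complex_of_real t * complex_of_real (sqrt d * \<nu> * x i)) = exp (- \<i> * complex_of_real (s * x i)) ^ r"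
          by (simp only: exp_of_nat_mult)
      qed
      finally show ?thesis unfolding spec_mat_power[OF U'] .
    qed
    have Xu: "unitary_mat D ?X" unfolding Xe by (rule unitary_pow_mat[OF G])
    have Uq: "unitary_mat q U" by (rule valid_unitary[OF v])
    let ?V = "run (c * ?N) U W\<^sub>0 steps"
    have Vu: "unitary_mat ?T ?V" by (rule unitary_run[OF Uq W])
    note Vc = unitary_matD(1)[OF Vu]
    let ?F = "?V * embed_mat ?T D"
    have Fc: "?F \<in> carrier_mat ?T D" by (rule mult_carrier_mat[OF Vc embed_mat_carrier])
    have Fv: "?F *\<^sub>v z = ?V *\<^sub>v (embed_mat ?T D *\<^sub>v z)" if "z \<in> carrier_vec D" for z
      by (rule assoc_mult_mat_vec[OF Vc embed_mat_carrier that])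
    have ET: "embed_mat ?T D *\<^sub>v z \<in> carrier_vec ?T" "embed_mat ?N D *\<^sub>v z \<in> carrier_vec ?N"
      if "z \<in> carrier_vec D" for z
      using that by (auto intro: mult_mat_vec_carrier[OF embed_mat_carrier])
    have Fi: "vec_l2 (?F *\<^sub>v z) = vec_l2 z" if "z \<in> carrier_vec D" for z
      unfolding Fv[OF that] unitary_mat_preserves_vec_l2[OF Vu ET(1)[OF that]]
      using that DN NT by (intro vec_l2_embed) auto
    have split: "embed_mat ?T D *\<^sub>v z = embed_mat ?T ?N *\<^sub>v (embed_mat ?N D *\<^sub>v z)" if "z \<in> carrier_vec D" for z
      unfolding embed_mat_comp[OF DN NT, symmetric] by (rule assoc_mult_mat_vec[OF embed_mat_carrier embed_mat_carrier that])
    note Qc = unitary_matD(1)[OF unitary_pow_mat[OF seg, of r]]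
    have Fz: "?F *\<^sub>v z = embed_mat ?T ?N *\<^sub>v (?Q H *\<^sub>v (embed_mat ?N D *\<^sub>v z))" if z: "z \<in> carrier_vec D" for z
    proof -
      have "?F *\<^sub>v z = ?V *\<^sub>v (embed_mat ?T ?N *\<^sub>v (embed_mat ?N D *\<^sub>v z))"
        unfolding Fv[OF z] split[OF z] ..
      also have "\<dots> = (?V * embed_mat ?T ?N) *\<^sub>v (embed_mat ?N D *\<^sub>v z)"
        by (rule assoc_mult_mat_vec[OF Vc embed_mat_carrier ET(2)[OF z], symmetric])
      also have "?V * embed_mat ?T ?N = embed_mat ?T ?N * ?Q H"
        using V[OF v] run Uq by simp
      also have "\<dots> *\<^sub>v (embed_mat ?N D *\<^sub>v z) = embed_mat ?T ?N *\<^sub>v (?Q H *\<^sub>v (embed_mat ?N D *\<^sub>v z))"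
        by (rule assoc_mult_mat_vec[OF embed_mat_carrier Qc ET(2)[OF z]])
      finally show ?thesis .
    qed
    have err: "vec_l2 (?F *\<^sub>v z - vec ?T (\<lambda>i. if i < D then (?X *\<^sub>v z) $ i else 0)) \<le> \<epsilon> / 2 * vec_l2 z"
      if z: "z \<in> carrier_vec D" for z
    proof -
      have Xz: "?X *\<^sub>v z \<in> carrier_vec D" by (rule mult_sq_vec_carrier[OF unitary_matD(1)[OF Xu] z])
      have QE: "?Q H *\<^sub>v (embed_mat ?N D *\<^sub>v z) \<in> carrier_vec ?N" by (rule mult_sq_vec_carrier[OF Qc ET(2)[OF z]])
      have "?F *\<^sub>v z - vec ?T (\<lambda>i. if i < D then (?X *\<^sub>v z) $ i else 0)
          = embed_mat ?T ?N *\<^sub>v (?Q H *\<^sub>v (embed_mat ?N D *\<^sub>v z)) - embed_mat ?T ?N *\<^sub>v (embed_mat ?N D *\<^sub>v (?X *\<^sub>v z))"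
        unfolding Fz[OF z] embed_mat_mult_vec[OF Xz, symmetric] split[OF Xz] ..
      also have "\<dots> = embed_mat ?T ?N *\<^sub>v (?Q H *\<^sub>v (embed_mat ?N D *\<^sub>v z) - embed_mat ?N D *\<^sub>v (?X *\<^sub>v z))"
        by (rule mult_minus_distrib_mat_vec[OF embed_mat_carrier QE ET(2)[OF Xz], symmetric])
      finally have "vec_l2 (?F *\<^sub>v z - vec ?T (\<lambda>i. if i < D then (?X *\<^sub>v z) $ i else 0))
          = vec_l2 (?Q H *\<^sub>v (embed_mat ?N D *\<^sub>v z) - embed_mat ?N D *\<^sub>v (?X *\<^sub>v z))"
        using vec_l2_embed[OF _ NT] QE ET(2)[OF Xz] by simp
      also have "\<dots> \<le> r * (4 * (1 / 2) ^ K) * vec_l2 z"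
        unfolding Xe by (rule iterate_error[OF seg G DN err1 z])
      also have "\<dots> \<le> \<epsilon> / 2 * vec_l2 z" by (rule mult_right_mono[OF K vec_l2_nonneg])
      finally show ?thesis .
    qed
    have \<rho>c: "\<rho> \<in> carrier_mat D D" using \<rho> by (simp add: density_mat_def)
    have sim: "simulated_state q ?a D U W\<^sub>0 steps \<rho> = trace_out (q * ?a) D (evolve ?F \<rho>)"
      using simulated_state_embed[of ?a D U W\<^sub>0 steps q \<rho>] Vc \<rho>c qpos apos unfolding aD qaD by simp
    have "trace_dist (trace_out (q * ?a) D (evolve ?F \<rho>)) (evolve ?X \<rho>) \<le> \<epsilon> / 2 + (\<epsilon> / 2)\<^sup>2 / 2"
    proof (rule trace_dist_trace_out_le)
      show "?F \<in> carrier_mat (q * ?a * D) D" unfolding qaD by (rule Fc)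
      show "?X \<in> carrier_mat D D" by (rule unitary_matD(1)[OF Xu])
      show "vec_l2 (?X *\<^sub>v z) = vec_l2 z" if "z \<in> carrier_vec D" for z
        by (rule unitary_mat_preserves_vec_l2[OF Xu that])
      show "0 < q * ?a" using qpos apos by simp
      show "vec_l2 (?F *\<^sub>v z - vec (q * ?a * D) (\<lambda>i. if i < D then (?X *\<^sub>v z) $ i else 0)) \<le> \<epsilon> / 2 * vec_l2 z"
        if "z \<in> carrier_vec D" for z unfolding qaD by (rule err[OF that])
    qed (use Fi \<rho> \<epsilon> in auto)
    \<comment> \<open>The vector error \<epsilon> / 2 gives the distance \<epsilon> / 2 +
      \<epsilon>^2 / 8, which is below \<epsilon> as \<epsilon> < 1.\<close>
    also have "\<dots> \<le> \<epsilon>"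
    proof -
      have "\<epsilon> * \<epsilon> \<le> \<epsilon> * 1" using \<epsilon> by (intro mult_left_mono) auto
      moreover have "(\<epsilon> / 2)\<^sup>2 / 2 = \<epsilon> * \<epsilon> / 8" by (simp add: power2_eq_square)
      ultimately show ?thesis using \<epsilon> by linarith
    qed
    finally show ?thesis unfolding sim .
  qed
  hence "simulates D d vals g t \<tau> \<epsilon> ?a W\<^sub>0 steps"
    using W apos unfolding simulates_def qaD valid_def by blast
  thus ?thesis using len by blast
qed

section \<open>The number of calls\<close>

text \<open>The distance of the two states is at most 1, so a program without calls is already
  accurate enough.\<close>

lemma simulates_trivial:
  assumes D: "0 < D" and d: "0 < d" and g: "0 < g" and vals: "0 \<in> set vals" and \<epsilon>: "1 \<le> \<epsilon>"
  shows "simulates D d vals g t \<tau> \<epsilon> 1 (1\<^sub>m (query_dim D d vals g * 1 * D)) []"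
proof -
  let ?q = "query_dim D d vals g"
  have "0 < length vals" using vals by (cases vals) auto
  hence q: "0 < ?q" using D d g by (simp add: query_dim_def)
  have "trace_dist (simulated_state ?q 1 D U (1\<^sub>m (?q * 1 * D)) [] \<rho>) (evolve (mat_exp ((- \<i> * complex_of_real t) \<cdot>\<^sub>m H)) \<rho>) \<le> \<epsilon>"
    if H: "H \<in> carrier_mat D D" "hermitian_mat H" and \<rho>: "density_mat D \<rho>" for H U \<rho>
  proof -
    obtain V l where V: "unitary_mat D V" and l: "H = spec_mat D V (\<lambda>i. complex_of_real (l i))"
      using hermitian_spectral[OF H] by blast
    let ?X = "mat_exp ((- \<i> * complex_of_real t) \<cdot>\<^sub>m H)"
    have X: "unitary_mat D ?X"
      unfolding l mat_exp_spec_mat[OF V]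
      by (rule unitary_spec_mat[OF V]) (simp flip: of_real_mult)
    have \<rho>c: "\<rho> \<in> carrier_mat D D" using \<rho> by (simp add: density_mat_def)
    let ?E = "embed_mat (?q * 1 * D) D"
    have "simulated_state ?q 1 D U (1\<^sub>m (?q * 1 * D)) [] \<rho>
        = trace_out (?q * 1) D (evolve (run (1 * D) U (1\<^sub>m (?q * 1 * D)) [] * ?E) \<rho>)"
      by (rule simulated_state_embed[OF _ \<rho>c]) (use q in simp_all)
    also have "run (1 * D) U (1\<^sub>m (?q * 1 * D)) [] * ?E = ?E"
      by (simp add: left_mult_one_mat[OF embed_mat_carrier])
    finally have sim: "simulated_state ?q 1 D U (1\<^sub>m (?q * 1 * D)) [] \<rho> = trace_out (?q * 1) D (evolve ?E \<rho>)" .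
    have "trace_dist (trace_out (?q * 1) D (evolve ?E \<rho>)) (evolve ?X \<rho>) \<le> 1"
    proof (rule trace_dist_trace_out_le_1[OF embed_mat_carrier unitary_matD(1)[OF X] _ _ \<rho>])
      show "vec_l2 (?E *\<^sub>v v) = vec_l2 v" if "v \<in> carrier_vec D" for v
        by (rule vec_l2_embed[OF that]) (use q in simp)
      show "vec_l2 (?X *\<^sub>v v) = vec_l2 v" if "v \<in> carrier_vec D" for v
        by (rule unitary_mat_preserves_vec_l2[OF X that])
    qed
    thus ?thesis unfolding sim using \<epsilon> by linarith
  qed
  thus ?thesis unfolding simulates_def by simp
qed

lemma N_bb_le:
  assumes "simulates D d vals g t \<tau> \<epsilon> a W\<^sub>0 steps"
  shows "N_bb D d vals g t \<tau> \<epsilon> \<le> enat (length steps)"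
  unfolding N_bb_def using assms by (intro Inf_lower) auto

section \<open>Number of segments and degree of the Taylor polynomial\<close>

lemma ln_2_ge_half: "1 / 2 \<le> ln (2 :: real)"
  using exp_half_le2 by (subst ln_ge_iff) auto

text \<open>The \<open>LEAST\<close> is meaningful only if the iteration falls below 2. As long as
  it does not, each logarithm lowers the value by at least 1, which is impossible n times. Zero
  iterations leave n \<ge> 2.\<close>

lemma log_star_pos:
  assumes "2 \<le> n" shows "1 \<le> log_star n"
proof -
  have "\<exists>r. (log 2 ^^ r) (real n) < 2"
  proof (rule ccontr)
    assume "\<nexists>r. (log 2 ^^ r) (real n) < 2"
    hence ge: "2 \<le> (log 2 ^^ r) (real n)" for r by (meson not_less)
    \<comment> \<open>The tangent bound ln z \<le> z - 1 at z = x / 2, followed by ln 2 \<ge> 1 /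
      2.\<close>
    have step: "log 2 x \<le> x - 1" if x: "2 \<le> x" for x :: real
    proof -
      have "ln (x / 2) \<le> x / 2 - 1" using x by (intro ln_le_minus_one) simp
      hence "ln x - ln 2 \<le> (x - 2) / 2" using x by (simp add: ln_div)
      also have "\<dots> \<le> (x - 2) * ln 2"
        using x ln_2_ge_half mult_left_mono[of "1 / 2" "ln 2" "x - 2"] by simp
      finally have "ln x \<le> (x - 1) * ln 2" by (simp add: algebra_simps)
      thus ?thesis by (simp add: log_def divide_le_eq)
    qed
    have "(log 2 ^^ r) (real n) \<le> real n - real r" for r
    proof (induction r)
      case (Suc r)
      have "(log 2 ^^ Suc r) (real n) \<le> (log 2 ^^ r) (real n) - 1" using step[OF ge[of r]] by simp
      thus ?case using Suc by simp
    qed simp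
    from this[of n] ge[of n] show False by simp
  qed
  hence "(log 2 ^^ log_star n) (real n) < 2" unfolding log_star_def by (rule LeastI_ex)
  hence "log_star n \<noteq> 0" using assms by (intro notI) simp
  thus ?thesis by simp
qed

text \<open>\<theta> stands for d^2 \<tau>. The logarithm in K is traded for a power: with y = (r /
  \<epsilon>)^(1 / (2 k)) it is 2 k log y \<le> 4 k y. Of the two powers of 5^k in the bound, one
  pays for k and the other for bounding r by a multiple of 5^k \<theta>.\<close>

lemma segment_count_bound:
  fixes c \<theta> \<epsilon> :: real and k :: nat
  assumes c: "0 < c" "c \<le> 5 ^ k * \<theta>" and k: "1 \<le> k" and \<epsilon>: "0 < \<epsilon>" "\<epsilon> < 1"
  shows "\<exists>r K. 0 < r \<and> 2 * \<theta> \<le> real r \<and> real r * (4 * (1 / 2) ^ K) \<le> \<epsilon> / 2 \<and>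
    real r * real K \<le> 40 * (2 + 1 / c)\<^sup>2 * (5 ^ (2 * k) * \<theta> powr (1 + 1 / (2 * real k)) / \<epsilon> powr (1 / (2 * real k)))"
proof -
  have "0 < 5 ^ k * \<theta>" using c by linarith
  hence \<theta>: "0 < \<theta>" by (simp add: zero_less_mult_iff)
  define r where "r = nat \<lceil>2 * \<theta>\<rceil>"
  \<comment> \<open>The 8 combines the 4 of the segment error with the 2 of \<epsilon> / 2.\<close>
  define K where "K = nat \<lceil>log 2 (8 * real r / \<epsilon>)\<rceil>"
  define A where "A = 2 + 1 / c"
  define p where "p = 1 / (2 * real k)"
  define y where "y = (real r / \<epsilon>) powr p"
  have r0: "0 < r" using \<theta> by (simp add: r_def)
  have r1: "1 \<le> real r" using r0 by simp
  have rge: "2 * \<theta> \<le> real r" unfolding r_def by (rule real_nat_ceiling_ge)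
  have "real r < 2 * \<theta> + 1" using \<theta> unfolding r_def by linarith
  also have "2 * \<theta> \<le> 2 * (5 ^ k * \<theta>)" using \<theta> by simp
  \<comment> \<open>The lower bound \<open>c\<close> on 5^k \<theta> turns the 1 lost in rounding up
    into a multiple of 5^k \<theta>; the summand 1 / c of the constant arises here.\<close>
  also have "1 \<le> 5 ^ k * \<theta> / c" using c by simp
  finally have rA: "real r \<le> A * (5 ^ k * \<theta>)" by (simp add: A_def algebra_simps)
  have A1: "1 \<le> A" using c by (simp add: A_def)
  have r\<epsilon>: "1 \<le> real r / \<epsilon>" using r1 \<epsilon> by simp
  have p: "0 < p" "p \<le> 1" using k by (simp_all add: p_def)
  have y1: "1 \<le> y" unfolding y_def using r\<epsilon> p by (intro ge_one_powr_ge_zero) auto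
  have pos8: "0 < 8 * real r / \<epsilon>" using r1 \<epsilon> by simp
  have "8 * real r / \<epsilon> = 2 powr (log 2 (8 * real r / \<epsilon>))" using pos8 by simp
  also have "\<dots> \<le> 2 powr (real K)" unfolding K_def by (intro powr_mono real_nat_ceiling_ge) simp
  also have "\<dots> = 2 ^ K" by (simp add: powr_realpow)
  finally have "8 * real r \<le> 2 ^ K * \<epsilon>" using \<epsilon> by (simp add: divide_le_eq)
  hence Kerr: "real r * (4 * (1 / 2) ^ K) \<le> \<epsilon> / 2" by (simp add: power_one_over field_simps)
  have lg8: "log 2 (8 * real r / \<epsilon>) = 3 + log 2 (real r / \<epsilon>)"
  proof -
    have "log 2 (8 * (real r / \<epsilon>)) = log 2 8 + log 2 (real r / \<epsilon>)" using r1 \<epsilon> by (simp add: log_def ln_mult ln_div add_divide_distrib diff_divide_distrib)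
    moreover have "log 2 8 = (3 :: real)" using log_pow_cancel[of 2 3] by simp
    ultimately show ?thesis by simp
  qed
  have lgr: "log 2 (real r / \<epsilon>) = 2 * real k * log 2 y"
    unfolding y_def log_powr using k by (simp add: p_def)
  have lgy: "log 2 y \<le> 2 * y"
  proof -
    have "ln y \<le> y - 1" using y1 by (intro ln_le_minus_one) simp
    also have "y - 1 \<le> 2 * y * (1 / 2)" by simp
    also have "\<dots> \<le> 2 * y * ln 2" using y1 ln_2_ge_half by (intro mult_left_mono) auto
    finally show ?thesis by (simp add: log_def divide_le_eq)
  qed
  have "0 \<le> log 2 (8 * real r / \<epsilon>)" unfolding lg8 using r\<epsilon> by simp
  hence "real K \<le> log 2 (8 * real r / \<epsilon>) + 1" unfolding K_def by linarith
  also have "\<dots> = 4 + 2 * real k * log 2 y" unfolding lg8 lgr by simp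
  also have "\<dots> \<le> 4 + 2 * real k * (2 * y)" by (intro add_left_mono mult_left_mono lgy) simp
  also have "\<dots> \<le> 8 * real k * y"
  proof -
    have "1 * 1 \<le> real k * y" using k y1 by (intro mult_mono) auto
    moreover have "2 * real k * (2 * y) = 4 * (real k * y)" "8 * real k * y = 8 * (real k * y)" by simp_all
    ultimately show ?thesis by linarith
  qed
  finally have Kle: "real K \<le> 8 * real k * y" .
  have "y \<le> (A * (5 ^ k * \<theta>) / \<epsilon>) powr p"
    unfolding y_def using rA r1 \<epsilon> p by (intro powr_mono2 divide_right_mono) auto
  also have "\<dots> = A powr p * (5 ^ k) powr p * (\<theta> powr p / \<epsilon> powr p)"
    using A1 \<theta> \<epsilon> by (simp add: powr_mult powr_divide mult.assoc)
  \<comment> \<open>Since p = 1 / (2 k), the power (5^k)^p is sqrt 5; it and \<open>A powr p\<close>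
    are bounded crudely by 5 and \<open>A\<close>.\<close>
  also have "\<dots> \<le> A * 5 * (\<theta> powr p / \<epsilon> powr p)"
  proof (intro mult_right_mono mult_mono)
    show "A powr p \<le> A" using powr_mono[of p 1 A] p A1 by simp
    have "(5 ^ k) powr p = 5 powr (real k * p)" by (simp add: powr_powr flip: powr_realpow)
    also have "real k * p = 1 / 2" using k by (simp add: p_def)
    also have "5 powr (1 / 2) \<le> (5 powr 1 :: real)" by (intro powr_mono) auto
    finally show "(5 ^ k) powr p \<le> (5 :: real)" by simp
  qed (use A1 in auto)
  finally have yle: "y \<le> A * 5 * (\<theta> powr p / \<epsilon> powr p)" .
  have kle: "real k \<le> 5 ^ k"
  proof -
    have "k < 2 ^ k" by (rule less_exp)
    also have "(2 :: nat) ^ k \<le> 5 ^ k" by (rule power_mono) auto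
    finally have "real k < real (5 ^ k)" by (simp only: of_nat_less_iff)
    thus ?thesis by simp
  qed
  \<comment> \<open>One factor 5^k comes from the bound on r, the other replaces k; the constant is
    8 * 5 = 40.\<close>
  have "real r * real K \<le> (A * (5 ^ k * \<theta>)) * (8 * 5 ^ k * (A * 5 * (\<theta> powr p / \<epsilon> powr p)))"
  proof (intro mult_mono rA)
    have "8 * real k * y \<le> 8 * 5 ^ k * (A * 5 * (\<theta> powr p / \<epsilon> powr p))"
      using kle yle y1 by (intro mult_mono) auto
    thus "real K \<le> 8 * 5 ^ k * (A * 5 * (\<theta> powr p / \<epsilon> powr p))" using Kle by linarith
  qed (use A1 \<theta> in auto)
  also have "\<dots> = 40 * A\<^sup>2 * (5 ^ (2 * k) * (\<theta> * \<theta> powr p) / \<epsilon> powr p)"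
    by (simp add: power2_eq_square power_mult_distrib mult_2 power_add)
  also have "\<theta> * \<theta> powr p = \<theta> powr (1 + p)" using \<theta> by (simp add: powr_add)
  finally have "real r * real K \<le> 40 * A\<^sup>2 * (5 ^ (2 * k) * \<theta> powr (1 + p) / \<epsilon> powr p)" .
  thus ?thesis using r0 rge Kerr unfolding A_def p_def by blast
qed

text \<open>Landau notation in several variables is rendered as uniformity over the region cut off
  by \<open>c\<close>, with a constant depending on \<open>c\<close> alone. The cut-off is what
  allows the number of segments to be rounded up to an integer.\<close>

theorem theorem2:
  shows "\<forall>c>0::real. \<exists>C>0::real.
    \<forall>(n::nat) (D::nat) (d::nat) (vals::complex list) (g::nat) (k::nat) (t::real) (\<tau>::real) (\<epsilon>::real).
      2 \<le> n \<longrightarrow> 1 \<le> D \<longrightarrow> D \<le> 2 ^ n \<longrightarrow> 1 \<le> d \<longrightarrow> distinct vals \<longrightarrow> 0 \<in> set vals \<longrightarrow> 1 \<le> g \<longrightarrow>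
      1 \<le> k \<longrightarrow> 0 < t \<longrightarrow> 0 < \<epsilon> \<longrightarrow> c \<le> (real d)\<^sup>2 * 5 ^ k * \<tau> \<longrightarrow>
      ereal_of_enat (N_bb D d vals g t \<tau> \<epsilon>)
        \<le> ereal (C * (real (log_star n) * (real d)\<^sup>2 * 5 ^ (2 * k)
              * ((real d)\<^sup>2 * \<tau>) powr (1 + 1 / (2 * real k)) / \<epsilon> powr (1 / (2 * real k))))"
proof (intro allI impI)
  fix c :: real assume c: "0 < c"
  \<comment> \<open>960 = 24 * 40: a segment of degree K costs 3 * K * 8 d = 24 K d calls, and 40 (2
    + 1 / c)^2 is the constant in the bound on r K.\<close>
  define C where "C = 960 * (2 + 1 / c)\<^sup>2"
  have "0 < 2 + 1 / c" using c by (simp add: add_pos_pos)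
  hence C: "0 < C" by (simp add: C_def)
  show "\<exists>C>0::real.
    \<forall>(n::nat) (D::nat) (d::nat) (vals::complex list) (g::nat) (k::nat) (t::real) (\<tau>::real) (\<epsilon>::real).
      2 \<le> n \<longrightarrow> 1 \<le> D \<longrightarrow> D \<le> 2 ^ n \<longrightarrow> 1 \<le> d \<longrightarrow> distinct vals \<longrightarrow> 0 \<in> set vals \<longrightarrow> 1 \<le> g \<longrightarrow>
      1 \<le> k \<longrightarrow> 0 < t \<longrightarrow> 0 < \<epsilon> \<longrightarrow> c \<le> (real d)\<^sup>2 * 5 ^ k * \<tau> \<longrightarrow>
      ereal_of_enat (N_bb D d vals g t \<tau> \<epsilon>)
        \<le> ereal (C * (real (log_star n) * (real d)\<^sup>2 * 5 ^ (2 * k)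
              * ((real d)\<^sup>2 * \<tau>) powr (1 + 1 / (2 * real k)) / \<epsilon> powr (1 / (2 * real k))))"
  proof (intro exI[of _ C] conjI C allI impI)
    fix n D d :: nat and vals :: "complex list" and g k :: nat and t \<tau> \<epsilon> :: real
    assume n: "2 \<le> n" and D: "1 \<le> D" and d: "1 \<le> d" and vals: "distinct vals" "0 \<in> set vals" and g: "1 \<le> g"
      and k: "1 \<le> k" and t: "0 < t" and \<epsilon>: "0 < \<epsilon>" and ct: "c \<le> (real d)\<^sup>2 * 5 ^ k * \<tau>"
    let ?\<theta> = "(real d)\<^sup>2 * \<tau>"
    let ?B = "5 ^ (2 * k) * ?\<theta> powr (1 + 1 / (2 * real k)) / \<epsilon> powr (1 / (2 * real k))"
    let ?R = "C * (real (log_star n) * (real d)\<^sup>2 * 5 ^ (2 * k)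
              * ?\<theta> powr (1 + 1 / (2 * real k)) / \<epsilon> powr (1 / (2 * real k)))"
    have B: "0 \<le> ?B" by simp
    have "0 < (real d)\<^sup>2 * 5 ^ k * \<tau>" using c ct by linarith
    moreover have "0 < (real d)\<^sup>2 * 5 ^ k" using d by simp
    ultimately have \<tau>: "0 < \<tau>" by (rule zero_less_mult_pos)
    show "ereal_of_enat (N_bb D d vals g t \<tau> \<epsilon>) \<le> ereal ?R"
    proof (cases "1 \<le> \<epsilon>")
      case True
      have "N_bb D d vals g t \<tau> \<epsilon> \<le> enat (length ([] :: (call \<times> complex mat) list))"
        using D d g vals(2) True by (intro N_bb_le[OF simulates_trivial]) auto
      hence "N_bb D d vals g t \<tau> \<epsilon> = 0" by (simp add: zero_enat_def[symmetric])
      moreover have "0 \<le> ?R" using C by simp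
      ultimately show ?thesis by simp
    next
      case False
      hence \<epsilon>1: "\<epsilon> < 1" by simp
      have c\<theta>: "c \<le> 5 ^ k * ?\<theta>" using ct by (simp add: mult_ac)
      obtain r K where r: "0 < r" "2 * ?\<theta> \<le> real r" and K: "real r * (4 * (1 / 2) ^ K) \<le> \<epsilon> / 2"
        and rK: "real r * real K \<le> 40 * (2 + 1 / c)\<^sup>2 * ?B"
        using segment_count_bound[OF c c\<theta> k \<epsilon> \<epsilon>1] by blast
      have d1: "1 \<le> real d" using d by simp
      have dd: "real d \<le> (real d)\<^sup>2" using d1 by (simp add: power2_eq_square)
      \<comment> \<open>The number of segments is tied to 2 d^2 \<tau>, which is at least the 2 sqrt
        d * \<tau> that s \<le> 1 / 2 asks for.\<close>
      have "sqrt (real d) \<le> (real d)\<^sup>2"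
      proof -
        have "sqrt (real d) \<le> sqrt ((real d)\<^sup>2)" by (rule real_sqrt_le_mono[OF dd])
        also have "\<dots> = real d" by simp
        finally show ?thesis using dd by linarith
      qed
      hence "sqrt (real d) * \<tau> \<le> ?\<theta>" using \<tau> by (intro mult_right_mono) auto
      hence s: "sqrt (real d) * \<tau> / real r \<le> 1 / 2" using r by (simp add: divide_le_eq)
      obtain a W\<^sub>0 steps where sim: "simulates D d vals g t \<tau> \<epsilon> a W\<^sub>0 steps"
        and len: "length steps = r * (3 * (K * (8 * d)))"
      proof -
        have "0 < D" "0 < d" "0 < g" using D d g by simp_all
        from simulates_segments[OF this vals t \<tau> \<epsilon> \<epsilon>1 r(1) s K] show ?thesis using that by blast
      qed
      have "real (length steps) = 24 * (real r * real K) * real d" unfolding len by simp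
      also have "\<dots> \<le> 24 * (40 * (2 + 1 / c)\<^sup>2 * ?B) * (real d)\<^sup>2"
        by (rule mult_mono[OF mult_left_mono[OF rK] dd]) (use B in auto)
      also have "\<dots> = C * (1 * ((real d)\<^sup>2 * ?B))" by (simp add: C_def)
      also have "\<dots> \<le> C * (real (log_star n) * ((real d)\<^sup>2 * ?B))"
        using log_star_pos[OF n] C B by (intro mult_left_mono mult_right_mono) auto
      also have "\<dots> = ?R" by (simp add: mult.assoc)
      finally have le: "real (length steps) \<le> ?R" .
      have "ereal_of_enat (N_bb D d vals g t \<tau> \<epsilon>) \<le> ereal_of_enat (enat (length steps))"
        using N_bb_le[OF sim] by (simp only: ereal_of_enat_le_iff)
      also have "\<dots> = ereal (real (length steps))" by simp
      also have "\<dots> \<le> ereal ?R" using le by simp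
      finally show ?thesis .
    qed
  qed
qed

end
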